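(* There exists a sequence $(C_d)$, indexed by even integers $d\ge2$, of real plane algebraic curves $C_d\subset\mathbb{C}P^2$ of degree $d$ such that $\mathbb{R}C_d$ is connected and $C_d$ has $t_{\mathbb{C}}(d)+O(d^3)$ real bitangents.
   Context: $t_{\mathbb{C}}(d)=\frac12 d(d-2)(d-3)(d+3)$ is the number of bitangents of a generic complex plane curve of degree $d$. A real bitangent is a line defined over $\mathbb{R}$ tangent to the curve at two points. *)

theory Defs
  imports "HOL-Analysis.Analysis"
begin

text \<open>A real plane curve of degree d is given by a ternary form
  F(x,y,z) = sum over i+j+k=d of c i j * x^i y^j z^k with real coefficients
  (k = d - i - j; values of c outside i+j \<le> d are irrelevant).
  Points of CP^2 are nonzero complex triples up to scaling.\<close>

definition hp_eval :: "nat \<Rightarrow> (nat \<Rightarrow> nat \<Rightarrow> real) \<Rightarrow> 'a::real_algebra_1 \<Rightarrow> 'a \<Rightarrow> 'a \<Rightarrow> 'a" where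
  "hp_eval d c x y z =
     (\<Sum>i\<le>d. \<Sum>j\<le>d-i. of_real (c i j) * x^i * y^j * z^(d-i-j))"

definition hp_dx :: "nat \<Rightarrow> (nat \<Rightarrow> nat \<Rightarrow> real) \<Rightarrow> complex \<Rightarrow> complex \<Rightarrow> complex \<Rightarrow> complex" where
  "hp_dx d c x y z =
     (\<Sum>i\<le>d. \<Sum>j\<le>d-i. of_real (c i j) * of_nat i * x^(i-1) * y^j * z^(d-i-j))"

definition hp_dy :: "nat \<Rightarrow> (nat \<Rightarrow> nat \<Rightarrow> real) \<Rightarrow> complex \<Rightarrow> complex \<Rightarrow> complex \<Rightarrow> complex" where
  "hp_dy d c x y z =
     (\<Sum>i\<le>d. \<Sum>j\<le>d-i. of_real (c i j) * of_nat j * x^i * y^(j-1) * z^(d-i-j))"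

definition hp_dz :: "nat \<Rightarrow> (nat \<Rightarrow> nat \<Rightarrow> real) \<Rightarrow> complex \<Rightarrow> complex \<Rightarrow> complex \<Rightarrow> complex" where
  "hp_dz d c x y z =
     (\<Sum>i\<le>d. \<Sum>j\<le>d-i. of_real (c i j) * of_nat (d-i-j) * x^i * y^j * z^(d-i-j-1))"

definition nonsingular_curve :: "nat \<Rightarrow> (nat \<Rightarrow> nat \<Rightarrow> real) \<Rightarrow> bool" where
  "nonsingular_curve d c \<longleftrightarrow>
     (\<exists>i j. i + j \<le> d \<and> c i j \<noteq> 0) \<and>
     (\<forall>x y z::complex. (x,y,z) \<noteq> (0,0,0) \<and> hp_eval d c x y z = 0 \<longrightarrow>
        (hp_dx d c x y z, hp_dy d c x y z, hp_dz d c x y z) \<noteq> (0,0,0))"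

definition real_cone :: "nat \<Rightarrow> (nat \<Rightarrow> nat \<Rightarrow> real) \<Rightarrow> (real \<times> real \<times> real) set" where
  "real_cone d c = {(x,y,z). (x,y,z) \<noteq> (0,0,0) \<and> hp_eval d c x y z = 0}"

text \<open>RC is (nonempty and) connected as a subspace of RP^2 with its quotient
  topology: open/closed sets of RP^2 correspond to open/closed subsets of
  R^3 - {0} that are invariant under nonzero scaling.\<close>
definition real_part_connected :: "nat \<Rightarrow> (nat \<Rightarrow> nat \<Rightarrow> real) \<Rightarrow> bool" where
  "real_part_connected d c \<longleftrightarrow>
     real_cone d c \<noteq> {} \<and>
     \<not> (\<exists>A B. A \<union> B = real_cone d c \<and> A \<inter> B = {} \<and> A \<noteq> {} \<and> B \<noteq> {} \<and>
            closedin (top_of_set (real_cone d c)) A \<and>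
            closedin (top_of_set (real_cone d c)) B \<and>
            (\<forall>v\<in>A. \<forall>t::real. t \<noteq> 0 \<longrightarrow> t *\<^sub>R v \<in> A) \<and>
            (\<forall>v\<in>B. \<forall>t::real. t \<noteq> 0 \<longrightarrow> t *\<^sub>R v \<in> B))"

text \<open>The line {a x + b y + c z = 0}, (a,b,c) a nonzero real triple, is tangent
  to the (nonsingular) curve at the point p: p lies on the curve and on the line,
  and the tangent line of the curve at p (grad F(p) . q = 0) is this line.\<close>
definition tangent_at ::
  "nat \<Rightarrow> (nat \<Rightarrow> nat \<Rightarrow> real) \<Rightarrow> real \<times> real \<times> real \<Rightarrow> complex \<times> complex \<times> complex \<Rightarrow> bool" where
  "tangent_at d c l p \<longleftrightarrow>
     (case l of (a,b,e) \<Rightarrow> case p of (x,y,z) \<Rightarrow>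
       (x,y,z) \<noteq> (0,0,0) \<and> hp_eval d c x y z = 0 \<and>
       of_real a * x + of_real b * y + of_real e * z = 0 \<and>
       (\<forall>u v w::complex. of_real a * u + of_real b * v + of_real e * w = 0 \<longrightarrow>
          hp_dx d c x y z * u + hp_dy d c x y z * v + hp_dz d c x y z * w = 0))"

definition proj_distinct :: "complex \<times> complex \<times> complex \<Rightarrow> complex \<times> complex \<times> complex \<Rightarrow> bool" where
  "proj_distinct p q \<longleftrightarrow>
     (case p of (x,y,z) \<Rightarrow> case q of (x',y',z') \<Rightarrow>
        \<not> (\<exists>t::complex. x' = t * x \<and> y' = t * y \<and> z' = t * z))"

definition real_bitangent :: "nat \<Rightarrow> (nat \<Rightarrow> nat \<Rightarrow> real) \<Rightarrow> real \<times> real \<times> real \<Rightarrow> bool" where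
  "real_bitangent d c l \<longleftrightarrow> l \<noteq> (0,0,0) \<and>
     (\<exists>p q. tangent_at d c l p \<and> tangent_at d c l q \<and> proj_distinct p q)"

definition real_bitangents :: "nat \<Rightarrow> (nat \<Rightarrow> nat \<Rightarrow> real) \<Rightarrow> (real \<times> real \<times> real) set set" where
  "real_bitangents d c = {{t *\<^sub>R l | t. t \<noteq> 0} | l. real_bitangent d c l}"

definition t_C :: "nat \<Rightarrow> real" where
  "t_C d = real d * (real d - 2) * (real d - 3) * (real d + 3) / 2"

end

theory Submission
  imports Defs "HOL-Computational_Algebra.Fundamental_Theorem_Algebra" "Jordan_Normal_Form.Determinant"
begin

text \<open>
  Write \<open>d = 2m\<close> and perturb a union of concentric conics \<open>z\<^sup>2 = a\<^sub>i (x\<^sup>2 + y\<^sup>2)\<close> by \<open>A Re (x + \<i>y)\<^sup>d\<close>. With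
  \<open>s = 1/r\<^sup>2\<close> the curve is \<open>q(s) = A cos (d \<theta>)\<close> in polar coordinates, where \<open>q(s) = \<Prod>(s - a\<^sub>i)\<close>. If
  \<open>{s > 0. \<bar>q s\<bar> \<le> A}\<close> is an interval, its real part is a cyclic chain of arcs over this interval,
  consecutive arcs meeting where \<open>q = \<plusminus>A\<close>, and so it is connected.

  Many bitangents: let \<open>m\<close> or \<open>m - 1\<close> (whichever is odd) of the conics be circles in a thin ring
  around the unit circle, and let the last one, if any, have no real points. Each of about \<open>d/2\<close> extrema
  of \<open>q\<close> is attained at \<open>2d\<close> angles, where a transversal of the ring can be moved into tangency.
  By Poincare-Miranda a line can be made tangent near two such places at once, which gives about
  \<open>d\<^sup>4/2\<close> lines.

  Not too many: with \<open>u = x + \<i>y\<close>, \<open>v = x - \<i>y\<close> the symmetries \<open>(u, v) \<mapsto> (\<zeta>u, v/\<zeta>)\<close>, \<open>\<zeta>\<^sup>d = 1\<close>, and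
  \<open>u \<leftrightarrow> v\<close> make the discriminant of the residual intersection of the curve with its tangent line
  at a point a polynomial in \<open>s = z\<^sup>2/(uv)\<close> alone, of degree \<open>d\<^sup>3/2 + O(d\<^sup>2)\<close>. There are at most \<open>2d\<close>
  points over each \<open>s\<close>, and every bitangent uses two points. The discriminant does not vanish
  identically for generic \<open>A\<close>, because it does not for \<open>A = 0\<close>.
\<close>

text \<open>Both estimates only have to reach the leading term d^4/2 of t_C(d), but with exactly
  this constant. For the upper bound, the size of the determinant times the largest degree of an
  entry would give about twice as much; hence rows and columns carry weights, and the parity in k is
  tracked so that the result is a polynomial in s. For the lower bound there are 2d arcs between
  consecutive extrema of cos (d \<theta>), hence about 2d^2 pairs of arcs, and about (d/2)^2 pairs
  of extrema of q. The obstacle is to show that these choices give different lines. A line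
  determines its two angles, these determine the arcs, and the value of cos (d \<theta>) has to
  determine the extremum of q, so the extremal values must be distinct. For equally spaced zeros
  their absolute values agree in symmetric pairs; an odd number of circles gives the two members of
  a pair opposite signs. Comparison with the limit \<epsilon> = 0 costs an error that must stay
  below half of every gap. So the gaps are fixed before the ring is made thin, and A is chosen last,
  to avoid finitely many bad values.\<close>

section \<open>Weighted polynomials on the double cover and an elimination determinant\<close>

text \<open>
  Functions on the double cover \<open>k\<^sup>2 = K(s)\<close> that are even or odd in \<open>k\<close> (according to the
  parity \<open>p\<close>) and of weight at most \<open>e\<close>, where \<open>s\<close> has weight 1 and \<open>k\<close> has weight \<open>m\<close>. The bound is an
  integer so that a matrix may carry negative row weights.
\<close>

definition graded :: "complex poly \<Rightarrow> nat \<Rightarrow> int \<Rightarrow> nat \<Rightarrow> (complex \<Rightarrow> complex \<Rightarrow> complex) \<Rightarrow> bool" where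
  "graded K m e p h \<longleftrightarrow>
     (\<exists>g. (g = 0 \<or> int (degree g) + (if odd p then int m else 0) \<le> e) \<and>
          (\<forall>s k. k\<^sup>2 = poly K s \<longrightarrow> h s k = (if odd p then k else 1) * poly g s))"

lemma graded_zero [simp]: "graded K m e p (\<lambda>s k. 0)"
  unfolding graded_def by (rule exI[of _ 0]) auto

lemma graded_add:
  assumes "graded K m e p f" "graded K m e p g"
  shows "graded K m e p (\<lambda>s k. f s k + g s k)"
proof -
  obtain u where u: "u = 0 \<or> int (degree u) + (if odd p then int m else 0) \<le> e"
    "\<And>s k. k\<^sup>2 = poly K s \<Longrightarrow> f s k = (if odd p then k else 1) * poly u s"
    using assms(1) unfolding graded_def by blast
  obtain v where v: "v = 0 \<or> int (degree v) + (if odd p then int m else 0) \<le> e"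
    "\<And>s k. k\<^sup>2 = poly K s \<Longrightarrow> g s k = (if odd p then k else 1) * poly v s"
    using assms(2) unfolding graded_def by blast
  have "degree (u + v) \<le> max (degree u) (degree v)" by (rule degree_add_le_max)
  with u(1) v(1) have "u + v = 0 \<or> int (degree (u + v)) + (if odd p then int m else 0) \<le> e"
    by (cases "u = 0"; cases "v = 0") (auto split: if_splits)
  moreover have "f s k + g s k = (if odd p then k else 1) * poly (u + v) s" if "k\<^sup>2 = poly K s" for s k
    using u(2)[OF that] v(2)[OF that] by (simp add: distrib_left)
  ultimately show ?thesis unfolding graded_def by blast
qed

lemma graded_mult:
  assumes K: "degree K \<le> 2 * m" and "graded K m e p f" "graded K m e' p' g"
  shows "graded K m (e + e') (p + p') (\<lambda>s k. f s k * g s k)"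
proof -
  obtain u where u: "u = 0 \<or> int (degree u) + (if odd p then int m else 0) \<le> e"
    "\<And>s k. k\<^sup>2 = poly K s \<Longrightarrow> f s k = (if odd p then k else 1) * poly u s"
    using assms(2) unfolding graded_def by blast
  obtain v where v: "v = 0 \<or> int (degree v) + (if odd p' then int m else 0) \<le> e'"
    "\<And>s k. k\<^sup>2 = poly K s \<Longrightarrow> g s k = (if odd p' then k else 1) * poly v s"
    using assms(3) unfolding graded_def by blast
  define w where "w = (if odd p \<and> odd p' then K else 1) * (u * v)"
  have "degree w \<le> (if odd p \<and> odd p' then 2 * m else 0) + (degree u + degree v)"
    unfolding w_def using K degree_mult_le[of K "u * v"] degree_mult_le[of u v] by auto
  hence "w = 0 \<or> int (degree w) + (if odd (p + p') then int m else 0) \<le> e + e'"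
    using u(1) v(1) by (cases "u = 0"; cases "v = 0") (auto simp: w_def split: if_splits)
  moreover have "f s k * g s k = (if odd (p + p') then k else 1) * poly w s" if "k\<^sup>2 = poly K s" for s k
    using u(2)[OF that] v(2)[OF that] that by (auto simp: w_def power2_eq_square)
  ultimately show ?thesis unfolding graded_def by blast
qed

lemma graded_sum:
  assumes "\<And>i. i \<in> I \<Longrightarrow> graded K m e p (f i)"
  shows "graded K m e p (\<lambda>s k. \<Sum>i\<in>I. f i s k)"
  using assms
  by (induction I rule: infinite_finite_induct) (auto intro!: graded_add)

lemma graded_const: "0 \<le> e \<Longrightarrow> even p \<Longrightarrow> graded K m e p (\<lambda>s k. c)"
  unfolding graded_def by (rule exI[of _ "[:c:]"]) auto

lemma graded_poly: "int (degree g) \<le> e \<Longrightarrow> even p \<Longrightarrow> graded K m e p (\<lambda>s k. poly g s)"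
  unfolding graded_def by (rule exI[of _ g]) auto

lemma graded_odd: "int m \<le> e \<Longrightarrow> odd p \<Longrightarrow> graded K m e p (\<lambda>s k. k)"
  unfolding graded_def by (rule exI[of _ 1]) auto

lemma graded_prod:
  assumes K: "degree K \<le> 2 * m" and "\<And>i. i \<in> I \<Longrightarrow> graded K m (e i) (p i) (f i)" "finite I"
  shows "graded K m (\<Sum>i\<in>I. e i) (\<Sum>i\<in>I. p i) (\<lambda>s k. \<Prod>i\<in>I. f i s k)"
  using assms(3,2)
proof (induction I rule: finite_induct)
  case empty
  then show ?case by (simp add: graded_const)
next
  case (insert i I)
  then show ?case by (simp add: graded_mult[OF K])
qed

lemma graded_parity_cong: "graded K m e p f \<Longrightarrow> even (p + p') \<Longrightarrow> e \<le> e' \<Longrightarrow> graded K m e' p' f"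
  unfolding graded_def by (elim exE, rule_tac x=g in exI) auto

lemma graded_cmult:
  assumes K: "degree K \<le> 2 * m" and "graded K m e p f"
  shows "graded K m e p (\<lambda>s k. c * f s k)"
  using graded_mult[OF K graded_const[of 0 0 K m c] assms(2)] by simp

text \<open>Each term of the Leibniz expansion meets every row and every column once, so all terms
  have the same weight and parity.\<close>

lemma graded_det:
  assumes K: "degree K \<le> 2 * m"
    and M: "\<And>i j. i < n \<Longrightarrow> j < n \<Longrightarrow> graded K m (w' j - w i) (p i + p' j) (\<lambda>s k. M s k i j)"
  shows "graded K m ((\<Sum>j<n. w' j) - (\<Sum>i<n. w i)) ((\<Sum>i<n. p i) + (\<Sum>j<n. p' j))
           (\<lambda>s k. Determinant.det (Matrix.mat n n (\<lambda>(i,j). M s k i j)))"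
proof -
  have det: "Determinant.det (Matrix.mat n n (\<lambda>(i,j). M s k i j)) =
      (\<Sum>\<pi>\<in>{\<pi>. \<pi> permutes {0..<n}}. signof \<pi> * (\<Prod>i\<in>{0..<n}. M s k i (\<pi> i)))" for s k
    by (subst det_def'[of _ n]) (auto intro!: sum.cong arg_cong2[of _ _ _ _ "(*)"] prod.cong
        simp: permutes_in_image[THEN iffD2, of _ "{0..<n}", simplified])
  show ?thesis unfolding det
  proof (rule graded_sum, rule graded_cmult[OF K])
    fix \<pi> assume "\<pi> \<in> {\<pi>. \<pi> permutes {0..<n}}"
    hence \<pi>: "\<pi> permutes {0..<n}" by simp
    have eq: "{0..<n} = {..<n}" by auto
    have "graded K m (\<Sum>i\<in>{0..<n}. w' (\<pi> i) - w i) (\<Sum>i\<in>{0..<n}. p i + p' (\<pi> i))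
       (\<lambda>s k. \<Prod>i\<in>{0..<n}. M s k i (\<pi> i))"
      using \<pi> by (intro graded_prod[OF K] M) (auto simp: permutes_in_image[THEN iffD2, of _ "{0..<n}", simplified])
    moreover have "(\<Sum>i\<in>{0..<n}. w' (\<pi> i)) = (\<Sum>i\<in>{0..<n}. w' i)"
      using sum.permute[OF \<pi>, of w'] by (simp add: o_def)
    moreover have "(\<Sum>i\<in>{0..<n}. p' (\<pi> i)) = (\<Sum>i\<in>{0..<n}. p' i)"
      using sum.permute[OF \<pi>, of p'] by (simp add: o_def)
    ultimately show "graded K m ((\<Sum>j<n. w' j) - (\<Sum>i<n. w i)) ((\<Sum>i<n. p i) + (\<Sum>j<n. p' j))
       (\<lambda>s k. \<Prod>i\<in>{0..<n}. M s k i (\<pi> i))"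
      by (simp add: sum_subtractf sum.distrib eq)
  qed
qed

text \<open>
  Sylvester matrix of \<open>r\<close> and \<open>r'\<close>, with \<open>n\<close> as formal degree of \<open>r\<close> so that its size does not jump when the
  leading coefficient vanishes.
\<close>

definition elim_entry :: "nat \<Rightarrow> complex poly \<Rightarrow> nat \<Rightarrow> nat \<Rightarrow> complex" where
  "elim_entry n r i j = (if i < n - 1 then (if i \<le> j then coeff r (j - i) else 0)
     else (if i - (n - 1) \<le> j then coeff (pderiv r) (j - (i - (n - 1))) else 0))"

definition elim_det :: "nat \<Rightarrow> complex poly \<Rightarrow> complex" where
  "elim_det n r = Determinant.det (Matrix.mat (2 * n - 1) (2 * n - 1) (\<lambda>(i,j). elim_entry n r i j))"

text \<open>A row holds the coefficients of one multiple of \<open>r\<close> or \<open>r'\<close> by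
  a power of the variable; both criteria below are read off from this.\<close>

lemma elim_entry_alt:
  "elim_entry n r i j = coeff (if i < n - 1 then monom 1 i * r else monom 1 (i - (n - 1)) * pderiv r) j"
  by (auto simp: elim_entry_def coeff_monom_mult)

lemma elim_generator_degree:
  fixes r :: "complex poly"
  assumes "degree r \<le> n" "n \<ge> 1" "i < 2 * n - 1"
  shows "degree (if i < n - 1 then monom 1 i * r else monom 1 (i - (n - 1)) * pderiv r) < 2 * n - 1"
proof (cases "i < n - 1")
  case True
  then show ?thesis using degree_mult_le[of "monom 1 i" r] assms by (simp add: degree_monom_eq)
next
  case False
  have "degree (monom 1 (i - (n - 1)) * pderiv r) \<le> (i - (n - 1)) + (degree r - 1)"
    using degree_mult_le[of "monom 1 (i - (n - 1))" "pderiv r"] degree_pderiv[of r] by (simp add: degree_monom_eq)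
  also have "\<dots> < 2 * n - 1" using assms False by auto
  finally show ?thesis using False by (simp only: if_False)
qed

text \<open>The powers of a common root form a kernel vector, because every row is a multiple of
  \<open>r\<close> or \<open>r'\<close>.\<close>

lemma elim_det_eq_0:
  assumes "degree r \<le> n" "n \<ge> 1" "poly r x = 0" "poly (pderiv r) x = 0"
  shows "elim_det n r = 0"
proof -
  let ?S = "2 * n - 1"
  let ?M = "Matrix.mat ?S ?S (\<lambda>(i,j). elim_entry n r i j)"
  let ?v = "Matrix.vec ?S (\<lambda>j. x ^ j)"
  have "?M *\<^sub>v ?v = 0\<^sub>v ?S"
  proof (rule eq_vecI)
    fix i assume "i < dim_vec (0\<^sub>v ?S :: complex Matrix.vec)"
    hence i: "i < ?S" by simp
    let ?g = "if i < n - 1 then monom 1 i * r else monom 1 (i - (n - 1)) * pderiv r"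
    have "vec_index (?M *\<^sub>v ?v) i = (\<Sum>j\<in>{0..<?S}. elim_entry n r i j * x ^ j)"
      using i by (simp add: scalar_prod_def)
    also have "\<dots> = (\<Sum>j<?S. coeff ?g j * x ^ j)"
      by (rule sum.cong) (auto simp: elim_entry_alt)
    also have "\<dots> = poly ?g x"
      unfolding poly_altdef
    proof (intro sum.mono_neutral_right ballI)
      show "{..degree ?g} \<subseteq> {..<?S}" using elim_generator_degree[OF assms(1,2) i] by fastforce
    qed (auto simp: coeff_eq_0)
    also have "\<dots> = 0" using assms by simp
    finally show "vec_index (?M *\<^sub>v ?v) i = vec_index (0\<^sub>v ?S) i" using i by simp
  qed simp
  moreover have "?v \<noteq> 0\<^sub>v ?S"
  proof
    assume "?v = 0\<^sub>v ?S"
    hence "vec_index ?v 0 = vec_index (0\<^sub>v ?S) 0" by simp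
    thus False using assms(2) by simp
  qed
  ultimately show ?thesis
    unfolding elim_det_def
    by (subst det_0_iff_vec_prod_zero[of _ ?S]) (auto intro!: exI[of _ ?v])
qed

text \<open>A dependency between the rows is a relation \<open>a r + b r' = 0\<close> with
  \<open>degree b < n\<close>. At the \<open>n\<close> simple roots of \<open>r\<close> the
  derivative does not vanish, so \<open>b\<close> does; hence \<open>b = 0\<close> and then
  \<open>a = 0\<close>.\<close>

lemma elim_det_ne_0:
  assumes deg: "degree r = n" "n \<ge> 1" and sqf: "rsquarefree r"
  shows "elim_det n r \<noteq> 0"
proof
  let ?S = "2 * n - 1"
  let ?M = "Matrix.mat ?S ?S (\<lambda>(i,j). elim_entry n r i j)"
  have C: "transpose_mat ?M \<in> carrier_mat ?S ?S" by simp
  assume "elim_det n r = 0"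
  hence "Determinant.det (transpose_mat ?M) = 0"
    unfolding elim_det_def by (subst det_transpose[of _ ?S]) auto
  then obtain v where v: "v \<in> carrier_vec ?S" "v \<noteq> 0\<^sub>v ?S" "transpose_mat ?M *\<^sub>v v = 0\<^sub>v ?S"
    using det_0_iff_vec_prod_zero[OF C] by blast
  define g where "g i = (if i < n - 1 then monom 1 i * r else monom 1 (i - (n - 1)) * pderiv r)" for i
  define a where "a = (\<Sum>i<n-1. monom (vec_index v i) i)"
  define b where "b = (\<Sum>i<n. monom (vec_index v (i + (n - 1))) i)"
  have dg: "degree (g i) < ?S" if "i < ?S" for i
    unfolding g_def by (rule elim_generator_degree) (use deg that in auto)
  have "(\<Sum>i<?S. Polynomial.smult (vec_index v i) (g i)) = 0"
  proof (rule poly_eqI)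
    fix j
    show "coeff (\<Sum>i<?S. Polynomial.smult (vec_index v i) (g i)) j = coeff 0 j"
    proof (cases "j < ?S")
      case True
      have "(\<Sum>i<?S. vec_index v i * coeff (g i) j) = vec_index (transpose_mat ?M *\<^sub>v v) j"
        using True v(1) by (auto simp: scalar_prod_def g_def elim_entry_alt intro!: sum.cong)
      also have "\<dots> = 0" unfolding v(3) using True by simp
      finally show ?thesis by (simp add: coeff_sum)
    next
      case False
      hence "coeff (g i) j = 0" if "i < ?S" for i
        using dg[OF that] by (simp add: coeff_eq_0)
      thus ?thesis by (simp add: coeff_sum)
    qed
  qed
  moreover have "(\<Sum>i<?S. Polynomial.smult (vec_index v i) (g i)) = a * r + b * pderiv r"
  proof -
    have split: "{..<?S} = {..<n-1} \<union> {n-1..<?S}" "{..<n-1} \<inter> {n-1..<?S} = {}" by auto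
    have "(\<Sum>i<?S. Polynomial.smult (vec_index v i) (g i)) =
       (\<Sum>i<n-1. Polynomial.smult (vec_index v i) (g i)) + (\<Sum>i=n-1..<?S. Polynomial.smult (vec_index v i) (g i))"
      by (subst split(1), rule sum.union_disjoint) auto
    also have "(\<Sum>i<n-1. Polynomial.smult (vec_index v i) (g i)) = a * r"
      by (simp add: a_def sum_distrib_right g_def smult_monom flip: mult_smult_left)
    also have "(\<Sum>i=n-1..<?S. Polynomial.smult (vec_index v i) (g i)) =
        (\<Sum>i<n. Polynomial.smult (vec_index v (i + (n - 1))) (g (i + (n - 1))))"
      using deg(2) by (intro sum.reindex_bij_witness[of _ "\<lambda>i. i + (n - 1)" "\<lambda>i. i - (n - 1)"]) auto
    also have "\<dots> = b * pderiv r"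
      unfolding b_def sum_distrib_right by (intro sum.cong) (auto simp: g_def smult_monom simp flip: mult_smult_left)
    finally show ?thesis .
  qed
  ultimately have eq: "a * r + b * pderiv r = 0" by simp
  have db: "degree b < n"
    unfolding b_def using deg(2) by (intro degree_sum_less) (auto intro: le_less_trans[OF degree_monom_le])
  have r0: "r \<noteq> 0" using deg by auto
  have b0: "b = 0"
  proof (rule ccontr)
    assume "b \<noteq> 0"
    have "poly b z = 0" if "poly r z = 0" for z
    proof -
      have "poly (a * r + b * pderiv r) z = 0" by (simp add: eq)
      thus ?thesis using that sqf by (auto simp: rsquarefree_roots)
    qed
    hence "card {z. poly r z = 0} \<le> card {z. poly b z = 0}"
      using \<open>b \<noteq> 0\<close> by (intro card_mono poly_roots_finite) auto
    also have "\<dots> \<le> degree b" using \<open>b \<noteq> 0\<close> by (rule card_poly_roots_bound)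
    finally have "card {z. poly r z = 0} < degree r" using db deg by simp
    moreover have "degree r = card {z. poly r z = 0}"
      using r0 by (subst complex_poly_decompose_rsquarefree[OF sqf, symmetric])
        (simp add: degree_prod_eq_sum_degree)
    ultimately show False by simp
  qed
  hence a0: "a = 0" using eq r0 by simp
  have "vec_index v i = 0" if "i < ?S" for i
  proof (cases "i < n - 1")
    case True
    have "coeff a i = vec_index v i" using True by (simp add: a_def coeff_sum)
    thus ?thesis using a0 by simp
  next
    case False
    have "coeff b (i - (n - 1)) = vec_index v i" using False that by (simp add: b_def coeff_sum)
    thus ?thesis using b0 by simp
  qed
  hence "v = 0\<^sub>v ?S" using v(1) by (intro eq_vecI) auto
  thus False using v(2) by simp
qed

section \<open>The curve restricted to a tangent line\<close>

definition qpoly :: "nat \<Rightarrow> (nat \<Rightarrow> complex) \<Rightarrow> complex poly" where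
  "qpoly m a = (\<Prod>i<m. [:- a i, 1:])"

definition eulerq :: "nat \<Rightarrow> (nat \<Rightarrow> complex) \<Rightarrow> complex poly" where
  "eulerq m a = pCons 0 (pderiv (qpoly m a))"

definition kappa2 :: "nat \<Rightarrow> (nat \<Rightarrow> complex) \<Rightarrow> complex \<Rightarrow> complex poly" where
  "kappa2 m a A = Polynomial.smult (of_nat m ^ 2) (qpoly m a ^ 2 - [:A ^ 2:])"

text \<open>
  For a point \<open>(u, v, z)\<close> of the curve put \<open>s = z\<^sup>2/(uv)\<close>, \<open>D = s q'(s)\<close> and
  \<open>k = m (A/2) ((u/v)\<^sup>m - (v/u)\<^sup>m)\<close>. Then \<open>k\<^sup>2 = m\<^sup>2 (q\<^sup>2 - A\<^sup>2)\<close>, the tangent line is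
  \<open>(u (1 + (D - k) t), v (1 - (D + k) t), z)\<close>, and \<open>linepoly\<close> is the equation of the curve on this
  line, divided by \<open>(uv)\<^sup>m\<close>. It does not involve \<open>A\<close>.
\<close>

definition linepoly :: "nat \<Rightarrow> (nat \<Rightarrow> complex) \<Rightarrow> complex \<Rightarrow> complex \<Rightarrow> complex poly" where
  "linepoly m a s k = (let D = poly (eulerq m a) s; q = poly (qpoly m a) s in
     (\<Prod>i<m. [:s - a i, 2 * a i * k, a i * (D\<^sup>2 - k\<^sup>2):]) -
     (Polynomial.smult ((q + k / of_nat m) / 2) ([:1, D - k:] ^ (2 * m)) +
      Polynomial.smult ((q - k / of_nat m) / 2) ([:1, - D - k:] ^ (2 * m))))"

text \<open>The shift divides by \<open>t^2\<close>: the base point is a double zero at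
  \<open>t = 0\<close>, and only the other intersections are of interest.\<close>

definition residual :: "nat \<Rightarrow> (nat \<Rightarrow> complex) \<Rightarrow> complex \<Rightarrow> complex \<Rightarrow> complex poly" where
  "residual m a s k = poly_shift 2 (linepoly m a s k)"

lemma degree_qpoly [simp]: "degree (qpoly m a) = m"
  by (simp add: qpoly_def degree_prod_eq_sum_degree)

lemma poly_qpoly: "poly (qpoly m a) s = (\<Prod>i<m. s - a i)"
  by (simp add: qpoly_def poly_prod)

lemma degree_eulerq: "degree (eulerq m a) \<le> m"
proof (cases m)
  case 0
  then show ?thesis by (simp add: eulerq_def qpoly_def)
next
  case (Suc n)
  then show ?thesis
    using degree_pderiv[of "qpoly m a"] degree_pCons_le[of 0 "pderiv (qpoly m a)"] by (simp add: eulerq_def)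
qed

lemma degree_kappa2: "degree (kappa2 m a A) \<le> 2 * m"
proof -
  have "degree (qpoly m a ^ 2 - [:A ^ 2:]) \<le> max (degree (qpoly m a ^ 2)) (degree [:A^2:])"
    by (rule degree_diff_le_max)
  also have "\<dots> \<le> 2 * m" using degree_power_le[of "qpoly m a" 2] by simp
  finally show ?thesis unfolding kappa2_def using degree_smult_le order_trans by blast
qed

text \<open>Exchanging \<open>u\<close> and \<open>v\<close> changes the signs of \<open>k\<close>
  and of the line parameter \<open>t\<close> together, and \<open>D\<close> and \<open>k\<close>
  both have weight \<open>m\<close>. Hence the coefficient of \<open>t^i\<close> gains the weight
  \<open>m i\<close> and the parity \<open>i\<close>.\<close>

definition gradedp :: "complex poly \<Rightarrow> nat \<Rightarrow> nat \<Rightarrow> nat \<Rightarrow> (complex \<Rightarrow> complex \<Rightarrow> complex poly) \<Rightarrow> bool" where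
  "gradedp K m e p f \<longleftrightarrow> (\<forall>i. graded K m (int (e + m * i)) (p + i) (\<lambda>s k. coeff (f s k) i))"

lemma gradedp_add: "gradedp K m e p f \<Longrightarrow> gradedp K m e p g \<Longrightarrow> gradedp K m e p (\<lambda>s k. f s k + g s k)"
  unfolding gradedp_def coeff_add by (intro allI graded_add) auto

lemma gradedp_mult:
  assumes "degree K \<le> 2 * m" "gradedp K m e p f" "gradedp K m e' p' g"
  shows "gradedp K m (e + e') (p + p') (\<lambda>s k. f s k * g s k)"
  unfolding gradedp_def coeff_mult
proof (intro allI graded_sum)
  fix n i :: nat assume i: "i \<in> {..n}"
  have "graded K m (int (e + m * i) + int (e' + m * (n - i))) (p + i + (p' + (n - i)))
      (\<lambda>s k. coeff (f s k) i * coeff (g s k) (n - i))"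
    using assms(2,3) unfolding gradedp_def by (intro graded_mult assms(1)) auto
  moreover have "m * i + m * (n - i) = m * n"
    using i by (simp flip: add_mult_distrib2)
  hence "int (e + m * i) + int (e' + m * (n - i)) = int (e + e' + m * n)"
    by (simp only: of_nat_add[symmetric] of_nat_eq_iff)
  moreover have "p + i + (p' + (n - i)) = p + p' + n" using i by simp
  ultimately show "graded K m (int (e + e' + m * n)) (p + p' + n)
      (\<lambda>s k. coeff (f s k) i * coeff (g s k) (n - i))" by (simp only:)
qed

lemma gradedp_const: "graded K m (int e) p c \<Longrightarrow> gradedp K m e p (\<lambda>s k. [:c s k:])"
  unfolding gradedp_def
proof
  fix i assume "graded K m (int e) p c"
  thus "graded K m (int (e + m * i)) (p + i) (\<lambda>s k. coeff [:c s k:] i)"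
    by (cases i) auto
qed

lemma gradedp_pCons:
  assumes "graded K m (int e) p c" "gradedp K m (e + m) (p + 1) f"
  shows "gradedp K m e p (\<lambda>s k. pCons (c s k) (f s k))"
  unfolding gradedp_def
proof
  fix i
  show "graded K m (int (e + m * i)) (p + i) (\<lambda>s k. coeff (pCons (c s k) (f s k)) i)"
    using assms by (cases i) (auto simp: gradedp_def algebra_simps)
qed

lemma gradedp_0 [simp]: "gradedp K m e p (\<lambda>s k. 0)"
  by (simp add: gradedp_def)

lemma gradedp_prod:
  assumes "degree K \<le> 2 * m" "\<And>i. i < n \<Longrightarrow> gradedp K m 1 0 (f i)"
  shows "gradedp K m n 0 (\<lambda>s k. \<Prod>i<n. f i s k)"
  using assms(2)
proof (induction n)
  case 0
  show ?case using gradedp_const[of K m 0 0 "\<lambda>s k. 1"] by (simp add: graded_const one_pCons)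
next
  case (Suc n)
  have "gradedp K m (n + 1) (0 + 0) (\<lambda>s k. (\<Prod>i<n. f i s k) * f n s k)"
    using Suc by (intro gradedp_mult assms(1)) auto
  thus ?case by simp
qed

text \<open>The exchange of \<open>u\<close> and \<open>v\<close> swaps the two powers, so neither
  has a parity, but half their sum is even and half their difference is odd. The bases are
  \<open>(1 - k t) + D t\<close> and \<open>(1 - k t) - D t\<close>, which yields a joint recursion
  for sum and difference.\<close>

lemma gradedp_power_parts:
  assumes K: "degree K \<le> 2 * m" and D: "degree d \<le> m"
  defines "P \<equiv> \<lambda>n s k. [:1, poly d s - k:] ^ n" and "Q \<equiv> \<lambda>n s k. [:1, - poly d s - k:] ^ n"
  shows "gradedp K m 0 0 (\<lambda>s k. Polynomial.smult (1/2) (P n s k + Q n s k))"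
    and "gradedp K m 0 1 (\<lambda>s k. Polynomial.smult (1/2) (P n s k - Q n s k))"
proof (induction n)
  case 0
  {
    case 1
    show ?case using gradedp_const[of K m 0 0 "\<lambda>s k. 1"]
      by (simp add: P_def Q_def graded_const one_pCons)
  next
    case 2
    show ?case by (simp add: P_def Q_def)
  }
next
  case (Suc n)
  have mk: "graded K m (int m) 1 (\<lambda>s k. - k)"
    using graded_cmult[OF K graded_odd[of m "int m" 1 K], of "-1"] by simp
  have A: "gradedp K m 0 0 (\<lambda>s k. [:1, - k:])"
    by (intro gradedp_pCons gradedp_0) (use mk in \<open>auto intro: graded_const\<close>)
  have B: "gradedp K m 0 1 (\<lambda>s k. [:0, poly d s:])"
    by (intro gradedp_pCons gradedp_0) (use D in \<open>auto intro: graded_poly\<close>)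
  {
    case 1
    have "gradedp K m 0 0 (\<lambda>s k. [:1, - k:] * Polynomial.smult (1/2) (P n s k + Q n s k))"
      using gradedp_mult[OF K A Suc.IH(1)] by (simp only: add_0)
    moreover have "gradedp K m 0 2 (\<lambda>s k. [:0, poly d s:] * Polynomial.smult (1/2) (P n s k - Q n s k))"
      using gradedp_mult[OF K B Suc.IH(2)] by (simp only: add_0 one_add_one)
    hence "gradedp K m 0 0 (\<lambda>s k. [:0, poly d s:] * Polynomial.smult (1/2) (P n s k - Q n s k))"
      unfolding gradedp_def by (auto intro: graded_parity_cong)
    ultimately have "gradedp K m 0 0 (\<lambda>s k. [:1, - k:] * Polynomial.smult (1/2) (P n s k + Q n s k)
       + [:0, poly d s:] * Polynomial.smult (1/2) (P n s k - Q n s k))" by (rule gradedp_add)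
    moreover have "[:1, - k:] * Polynomial.smult (1/2) (P n s k + Q n s k)
       + [:0, poly d s:] * Polynomial.smult (1/2) (P n s k - Q n s k)
       = Polynomial.smult (1/2) (P (Suc n) s k + Q (Suc n) s k)" for s k
      by (simp add: poly_eq_poly_eq_iff[symmetric] fun_eq_iff P_def Q_def algebra_simps)
    ultimately show ?case by simp
  next
    case 2
    have "gradedp K m 0 1 (\<lambda>s k. [:1, - k:] * Polynomial.smult (1/2) (P n s k - Q n s k))"
      using gradedp_mult[OF K A Suc.IH(2)] by (simp only: add_0)
    moreover have "gradedp K m 0 1 (\<lambda>s k. [:0, poly d s:] * Polynomial.smult (1/2) (P n s k + Q n s k))"
      using gradedp_mult[OF K B Suc.IH(1)] by (simp only: add_0 add_0_right)
    ultimately have "gradedp K m 0 1 (\<lambda>s k. [:1, - k:] * Polynomial.smult (1/2) (P n s k - Q n s k)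
       + [:0, poly d s:] * Polynomial.smult (1/2) (P n s k + Q n s k))" by (rule gradedp_add)
    moreover have "[:1, - k:] * Polynomial.smult (1/2) (P n s k - Q n s k)
       + [:0, poly d s:] * Polynomial.smult (1/2) (P n s k + Q n s k)
       = Polynomial.smult (1/2) (P (Suc n) s k - Q (Suc n) s k)" for s k
      by (simp add: poly_eq_poly_eq_iff[symmetric] fun_eq_iff P_def Q_def algebra_simps)
    ultimately show ?case by simp
  }
qed

lemma gradedp_linepoly:
  assumes K: "degree K \<le> 2 * m"
  shows "gradedp K m m 0 (linepoly m a)"
proof -
  let ?D = "\<lambda>s. poly (eulerq m a) s" and ?q = "\<lambda>s. poly (qpoly m a) s"
  define P where "P = (\<lambda>s k. [:1, ?D s - k:] ^ (2 * m))"
  define Q where "Q = (\<lambda>s k. [:1, - ?D s - k:] ^ (2 * m))"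
  have kk: "graded K m (int m) 1 (\<lambda>s k. k)" by (rule graded_odd) auto
  have k2: "graded K m (int (2 * m)) 2 (\<lambda>s k. - (k * k))"
    using graded_cmult[OF K graded_mult[OF K kk kk], of "-1"] by (simp add: numeral_2_eq_2)
  have D2: "graded K m (int (2 * m)) 2 (\<lambda>s k. ?D s * ?D s)"
    using graded_mult[OF K graded_poly graded_poly, of "eulerq m a" "int m" 1 "eulerq m a" "int m" 1]
      degree_eulerq[of m a]
      graded_mult[OF K graded_poly[of "eulerq m a" "int m" 0] graded_poly[of "eulerq m a" "int m" 0]]
    by (auto intro: graded_parity_cong)
  have "gradedp K m 1 0 (\<lambda>s k. [:s - a i, 2 * a i * k, a i * ((?D s)\<^sup>2 - k\<^sup>2):])" if "i < m" for i
  proof (intro gradedp_pCons gradedp_0)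
    show "graded K m (int 1) 0 (\<lambda>s k. s - a i)"
      using graded_poly[of "[:- a i, 1:]" 1 0 K m] by simp
    show "graded K m (int (1 + m)) (0 + 1) (\<lambda>s k. 2 * a i * k)"
      using graded_cmult[OF K kk, of "2 * a i"] by (auto intro: graded_parity_cong)
    have "graded K m (int (2 * m)) 2 (\<lambda>s k. a i * (?D s * ?D s + - (k * k)))"
      by (intro graded_cmult[OF K] graded_add k2 D2)
    thus "graded K m (int (1 + m + m)) (0 + 1 + 1) (\<lambda>s k. a i * ((?D s)\<^sup>2 - k\<^sup>2))"
      by (auto intro: graded_parity_cong simp: power2_eq_square)
  qed
  hence 1: "gradedp K m m 0 (\<lambda>s k. \<Prod>i<m. [:s - a i, 2 * a i * k, a i * ((?D s)\<^sup>2 - k\<^sup>2):])"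
    by (rule gradedp_prod[OF K])
  have "gradedp K m m 0 (\<lambda>s k. [:- ?q s:])"
    using gradedp_const[OF graded_poly[of "- qpoly m a" "int m" 0]] by simp
  from gradedp_mult[OF K this gradedp_power_parts(1)[OF K degree_eulerq[of m a], of "2 * m"]]
  have 2: "gradedp K m m 0 (\<lambda>s k. [:- ?q s:] * Polynomial.smult (1/2) (P s k + Q s k))"
    by (simp only: P_def Q_def add_0_right)
  have "gradedp K m m 1 (\<lambda>s k. [:- (k / of_nat m):])"
    using gradedp_const[OF graded_cmult[OF K kk, of "- 1 / of_nat m"]] by simp
  from gradedp_mult[OF K this gradedp_power_parts(2)[OF K degree_eulerq[of m a], of "2 * m"]]
  have "gradedp K m m 2 (\<lambda>s k. [:- (k / of_nat m):] * Polynomial.smult (1/2) (P s k - Q s k))"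
    by (simp only: P_def Q_def add_0_right one_add_one)
  hence 3: "gradedp K m m 0 (\<lambda>s k. [:- (k / of_nat m):] * Polynomial.smult (1/2) (P s k - Q s k))"
    unfolding gradedp_def by (auto intro: graded_parity_cong)
  \<comment> \<open>Regrouped by parity: the coefficients \<open>(q + k/m)/2\<close> and
    \<open>(q - k/m)/2\<close> turn into \<open>q\<close> times the half sum and \<open>k/m\<close>
    times the half difference.\<close>
  have eq: "linepoly m a s k = (\<Prod>i<m. [:s - a i, 2 * a i * k, a i * ((?D s)\<^sup>2 - k\<^sup>2):]) +
     ([:- ?q s:] * Polynomial.smult (1/2) (P s k + Q s k) +
      [:- (k / of_nat m):] * Polynomial.smult (1/2) (P s k - Q s k))" for s k
  proof -
    define c where "c = k / of_nat m"
    have "linepoly m a s k = (\<Prod>i<m. [:s - a i, 2 * a i * k, a i * ((?D s)\<^sup>2 - k\<^sup>2):]) -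
     (Polynomial.smult ((?q s + c) / 2) (P s k) + Polynomial.smult ((?q s - c) / 2) (Q s k))"
      by (simp add: linepoly_def Let_def c_def P_def Q_def)
    thus ?thesis unfolding c_def[symmetric]
      by (simp add: poly_eq_poly_eq_iff[symmetric] fun_eq_iff) (simp add: field_simps)
  qed
  show ?thesis using gradedp_add[OF 1 gradedp_add[OF 2 3]] by (simp add: eq[abs_def])
qed


section \<open>Degree and double zero of the equation on the tangent line\<close>

lemma degree_linear_power_le: "degree ([:1, c::complex:] ^ n) \<le> n"
  using degree_power_le[of "[:1, c:]" n] degree_pCons_le[of 1 "[:c:]"]
  by (metis degree_pCons_0 le_trans mult.commute mult_1_right mult_le_mono2 One_nat_def)

lemma degree_linepoly: "degree (linepoly m a s k) \<le> 2 * m"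
proof -
  have A: "degree (\<Prod>i<m. [:s - a i, 2 * a i * k, c i:]) \<le> 2 * m" for c
  proof -
    have "degree (\<Prod>i<m. [:s - a i, 2 * a i * k, c i:]) \<le> (\<Sum>i<m. degree [:s - a i, 2 * a i * k, c i:])"
      using degree_prod_sum_le[of "{..<m}" "\<lambda>i. [:s - a i, 2 * a i * k, c i:]"] by (simp only: o_def finite_lessThan)
    also have "\<dots> \<le> (\<Sum>i<m. 2)" by (intro sum_mono) auto
    finally show ?thesis by simp
  qed
  have B: "degree (Polynomial.smult c ([:1, c':] ^ (2 * m))) \<le> 2 * m" for c c' :: complex
    using degree_smult_le degree_linear_power_le order_trans by blast
  show ?thesis unfolding linepoly_def Let_def
    by (rule degree_diff_le[OF A degree_add_le[OF B B]])
qed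

lemma poly_linepoly_0: "poly (linepoly m a s k) 0 = 0"
  by (simp add: linepoly_def Let_def poly_prod poly_qpoly field_simps)

lemma poly_pderiv_prod:
  fixes f :: "nat \<Rightarrow> complex poly"
  assumes "finite I"
  shows "poly (pderiv (\<Prod>i\<in>I. f i)) x = (\<Sum>i\<in>I. poly (pderiv (f i)) x * (\<Prod>j\<in>I-{i}. poly (f j) x))"
  by (simp add: pderiv_prod poly_sum poly_prod mult.commute)

text \<open>Write \<open>s = (s - a i) + a i\<close> in each term of \<open>s q'(s)\<close>.\<close>

lemma euler_relation:
  "(\<Sum>i<m. a i * (\<Prod>j\<in>{..<m}-{i}. s - a j)) = poly (eulerq m a) s - of_nat m * poly (qpoly m a) s"
proof -
  have "poly (eulerq m a) s - of_nat m * poly (qpoly m a) s =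
     (\<Sum>i<m. s * (\<Prod>j\<in>{..<m}-{i}. s - a j)) - (\<Sum>i<m. (\<Prod>j<m. s - a j))"
    unfolding eulerq_def qpoly_def
    by (simp add: poly_pderiv_prod pderiv_pCons sum_distrib_left poly_prod)
  also have "\<dots> = (\<Sum>i<m. a i * (\<Prod>j\<in>{..<m}-{i}. s - a j))"
    unfolding sum_subtractf[symmetric]
    by (intro sum.cong refl) (simp add: prod.remove[of "{..<m}"] algebra_simps)
  finally show ?thesis ..
qed

text \<open>The line is tangent at \<open>t = 0\<close>: the conics and the subtracted powers both
  contribute \<open>2 k (D - m q)\<close>.\<close>

lemma poly_pderiv_linepoly_0:
  assumes "m \<ge> 1"
  shows "poly (pderiv (linepoly m a s k)) 0 = 0"
proof -
  define D where "D = poly (eulerq m a) s"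
  define q where "q = poly (qpoly m a) s"
  have m: "of_nat m \<noteq> (0::complex)" using assms by simp
  have pw: "poly (pderiv ([:1, c:] ^ n)) 0 = of_nat n * c" for c :: complex and n
    by (cases n) (simp_all add: pderiv_power_Suc pderiv_pCons del: power_Suc)
  have "poly (pderiv (\<Prod>i<m. [:s - a i, 2 * a i * k, a i * (D\<^sup>2 - k\<^sup>2):])) 0 =
     (\<Sum>i<m. 2 * k * (a i * (\<Prod>j\<in>{..<m}-{i}. s - a j)))"
    by (simp add: poly_pderiv_prod pderiv_pCons algebra_simps)
  also have "\<dots> = 2 * k * (D - of_nat m * q)"
    unfolding sum_distrib_left[symmetric] euler_relation D_def q_def ..
  finally have 1: "poly (pderiv (\<Prod>i<m. [:s - a i, 2 * a i * k, a i * (D\<^sup>2 - k\<^sup>2):])) 0 = 2 * k * (D - of_nat m * q)" .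
  show ?thesis
    unfolding linepoly_def Let_def D_def[symmetric] q_def[symmetric] pderiv_diff poly_diff 1
      pderiv_add poly_add pderiv_smult poly_smult pw
    using m by (simp add: field_simps)
qed

lemma linepoly_factor:
  assumes "m \<ge> 1"
  shows "linepoly m a s k = monom 1 2 * residual m a s k"
proof (rule poly_eqI)
  fix i
  have "coeff (linepoly m a s k) 0 = 0" using poly_linepoly_0[of m a s k] by (simp add: poly_0_coeff_0)
  moreover have "coeff (linepoly m a s k) 1 = 0"
    using poly_pderiv_linepoly_0[OF assms, of a s k] by (simp add: poly_0_coeff_0 coeff_pderiv)
  ultimately show "coeff (linepoly m a s k) i = coeff (monom 1 2 * residual m a s k) i"
    by (cases i rule: nat.exhaust[case_product nat.exhaust[of "i - 1"]])
      (auto simp: residual_def coeff_monom_mult coeff_poly_shift)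
qed

lemma residual_double_root:
  assumes "m \<ge> 1" "x \<noteq> 0" "poly (linepoly m a s k) x = 0" "poly (pderiv (linepoly m a s k)) x = 0"
  shows "poly (residual m a s k) x = 0 \<and> poly (pderiv (residual m a s k)) x = 0"
  using assms(2-4) unfolding linepoly_factor[OF assms(1)]
  by (auto simp: poly_monom pderiv_mult pderiv_monom)

lemma degree_residual: "degree (residual m a s k) \<le> 2 * m - 2"
  using degree_linepoly[of m a s k]
  by (intro degree_le) (auto simp: residual_def coeff_poly_shift coeff_eq_0)

text \<open>
  The second factor matters only for \<open>m = 1\<close>, where the matrix in \<open>elim_det\<close> is empty and its
  determinant is 1.
\<close>

definition line_disc :: "nat \<Rightarrow> (nat \<Rightarrow> complex) \<Rightarrow> complex \<Rightarrow> complex \<Rightarrow> complex" where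
  "line_disc m a s k = elim_det (2 * m - 2) (residual m a s k) * coeff (residual m a s k) (2 * m - 2)"

lemma line_disc_eq_0:
  assumes "m \<ge> 1" "x \<noteq> 0" "poly (linepoly m a s k) x = 0" "poly (pderiv (linepoly m a s k)) x = 0"
  shows "line_disc m a s k = 0"
proof -
  note r = residual_double_root[OF assms]
  show ?thesis
  proof (cases "m = 1")
    case True
    have "degree (residual m a s k) = 0" using degree_residual[of m a s k] True by simp
    then obtain c where "residual m a s k = [:c:]" by (rule degree_eq_zeroE)
    with r show ?thesis by (simp add: line_disc_def)
  next
    case False
    thus ?thesis using r assms(1) elim_det_eq_0[OF degree_residual, of m a s k x]
      by (simp add: line_disc_def)
  qed
qed

section \<open>The discriminant of the residual polynomial\<close>

lemma sum_lessThan_add: "(\<Sum>i<x + y. f i) = (\<Sum>i<x. f i) + (\<Sum>i<y. f (x + i))"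
  for f :: "nat \<Rightarrow> 'b::comm_monoid_add" and x y :: nat
  by (induction y) (auto simp: add.assoc)

text \<open>Entry \<open>(i, j)\<close> is a coefficient whose index differs from \<open>j\<close>
  by an amount depending on the row, so weights that are linear in \<open>i\<close> and
  \<open>j\<close> fit, shifted by the weight \<open>3 m\<close> of \<open>r\<close>. In the rows of
  \<open>r'\<close> the index goes up by one, which makes the shift \<open>4 m\<close>. For even
  \<open>n\<close> the parities of all rows and columns add up to an even number, so that the
  determinant depends on \<open>s\<close> alone.\<close>

lemma graded_elim_det:
  assumes K: "degree K \<le> 2 * m" and r: "gradedp K m (3 * m) 0 r" and n: "even n" "n \<ge> 1"
  shows "graded K m (int m * (int n ^ 2 + 6 * int n - 3)) 0 (\<lambda>s k. elim_det n (r s k))"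
proof -
  obtain t where t: "n = Suc t" using n(2) by (cases n) auto
  define w' where "w' j = int (m * j)" for j
  define w where "w i = (if i < t then int (m * i) - 3 * int m else int (m * (i - t)) - 4 * int m)" for i
  define p where "p i = (if i < t then i else Suc (i - t))" for i :: nat
  have "graded K m (w' j - w i) (p i + j) (\<lambda>s k. elim_entry n (r s k) i j)" for i j
  proof (cases "i < t")
    case True
    show ?thesis
    proof (cases "i \<le> j")
      case le: True
      have "graded K m (int (3 * m + m * (j - i))) (0 + (j - i)) (\<lambda>s k. coeff (r s k) (j - i))"
        using r unfolding gradedp_def by blast
      moreover have "int (3 * m + m * (j - i)) = w' j - w i"
        using le True by (auto simp: w'_def w_def algebra_simps dest!: le_Suc_ex)
      moreover have "even (0 + (j - i) + (p i + j))" using le True by (simp add: p_def)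
      ultimately have "graded K m (w' j - w i) (p i + j) (\<lambda>s k. coeff (r s k) (j - i))"
        using graded_parity_cong[OF _ _ order_refl] by (simp only:)
      thus ?thesis using True t le by (simp add: elim_entry_def)
    qed (use True t in \<open>simp add: elim_entry_def\<close>)
  next
    case False
    define i' where "i' = i - t"
    show ?thesis
    proof (cases "i' \<le> j")
      case le: True
      have "graded K m (int (3 * m + m * (Suc (j - i')))) (0 + Suc (j - i')) (\<lambda>s k. coeff (r s k) (Suc (j - i')))"
        using r unfolding gradedp_def by blast
      from graded_cmult[OF K this, of "of_nat (Suc (j - i'))"]
      have "graded K m (int (3 * m + m * (Suc (j - i')))) (0 + Suc (j - i')) (\<lambda>s k. coeff (pderiv (r s k)) (j - i'))"
        by (simp add: coeff_pderiv)
      moreover have "int (3 * m + m * (Suc (j - i'))) = w' j - w i"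
        using le False by (auto simp: w'_def w_def algebra_simps simp flip: i'_def dest!: le_Suc_ex)
      moreover have "even (0 + Suc (j - i') + (p i + j))" using le False by (simp add: p_def flip: i'_def)
      ultimately have "graded K m (w' j - w i) (p i + j) (\<lambda>s k. coeff (pderiv (r s k)) (j - i'))"
        using graded_parity_cong[OF _ _ order_refl] by (simp only:)
      thus ?thesis using False t le by (simp add: elim_entry_def i'_def)
    qed (use False t in \<open>simp add: elim_entry_def i'_def\<close>)
  qed
  from graded_det[OF K this]
  have "graded K m ((\<Sum>j<2*n-1. w' j) - (\<Sum>i<2*n-1. w i)) ((\<Sum>i<2*n-1. p i) + (\<Sum>j<2*n-1. j))
           (\<lambda>s k. elim_det n (r s k))"
    unfolding elim_det_def .
  moreover have eq: "2 * n - 1 = t + Suc t" using t by simp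
  have gauss: "2 * (\<Sum>i<x. i) = x * (x - 1)" for x :: nat
    by (induction x) (auto simp: algebra_simps diff_mult_distrib2 Suc_diff_le le_square)
  have gauss': "2 * (\<Sum>i<x. int i) = int x * (int x - 1)" for x :: nat
    by (induction x) (auto simp: algebra_simps)
  have W: "(\<Sum>j<2*n-1. w' j) - (\<Sum>i<2*n-1. w i) = int m * (int n ^ 2 + 6 * int n - 3)"
  proof -
    have 1: "(\<Sum>j<2*n-1. w' j) = int m * (\<Sum>j<2*n-1. int j)"
      by (simp add: w'_def sum_distrib_left)
    have "(\<Sum>i<2*n-1. w i) = (\<Sum>i<t. int (m * i) - 3 * int m) + (\<Sum>i<n. int (m * i) - 4 * int m)"
      unfolding eq sum_lessThan_add unfolding t by (simp add: w_def del: sum.lessThan_Suc)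
    also have "\<dots> = int m * (\<Sum>i<t. int i) + int m * (\<Sum>i<n. int i) - 3 * int m * int t - 4 * int m * int n"
      by (simp add: sum_subtractf sum_distrib_left)
    finally have "2 * ((\<Sum>j<2*n-1. w' j) - (\<Sum>i<2*n-1. w i)) =
        int m * (2 * (\<Sum>j<2*n-1. int j)) - int m * (2 * (\<Sum>i<t. int i)) - int m * (2 * (\<Sum>i<n. int i))
          + 6 * int m * int t + 8 * int m * int n" unfolding 1 by (simp add: algebra_simps)
    also have "\<dots> = 2 * (int m * (int n ^ 2 + 6 * int n - 3))"
      unfolding gauss' eq by (simp add: t algebra_simps power2_eq_square)
    finally show ?thesis by simp
  qed
  have "even ((\<Sum>i<2*n-1. p i) + (\<Sum>j<2*n-1. j))"
  proof -
    have "(\<Sum>i<2*n-1. p i) = (\<Sum>i<t. i) + (\<Sum>i<n. Suc i)"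
      unfolding eq sum_lessThan_add unfolding t by (simp add: p_def del: sum.lessThan_Suc)
    also have "(\<Sum>i<n. Suc i) = (\<Sum>i<n. i) + n" using sum.distrib[of "\<lambda>i. i" "\<lambda>_. 1" "{..<n}"] by simp
    finally have p: "(\<Sum>i<2*n-1. p i) = 2 * (\<Sum>i<t. i) + t + n" using t by simp
    have "(\<Sum>j<2*n-1. j) = (2 * n - 1) * (n - 1)"
      using gauss[of "2 * n - 1"] t by (simp add: algebra_simps)
    moreover have "odd (n - 1)" "odd (2 * n - 1)" "odd t" using n t by auto
    ultimately show ?thesis using p n by simp
  qed
  ultimately show ?thesis unfolding W
    using graded_parity_cong[OF _ _ order_refl, where p' = 0] by simp
qed

text \<open>With \<open>n = 2 m - 2\<close> the weights of the two factors add up to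
  \<open>m n (n + 7) = 4 m^3 + 6 m^2 - 10 m\<close>. The leading coefficient 4 is the one that
  becomes \<open>d^4/2\<close> in the end.\<close>

lemma line_disc_polynomial:
  assumes "m \<ge> 1"
  obtains \<Delta> where "degree \<Delta> \<le> 4 * m ^ 3 + 6 * m ^ 2"
    "\<And>s k. k\<^sup>2 = poly (kappa2 m a A) s \<Longrightarrow> line_disc m a s k = poly \<Delta> s"
proof -
  let ?K = "kappa2 m a A"
  let ?n = "2 * m - 2"
  note K = degree_kappa2[of m a A]
  have r: "gradedp ?K m (3 * m) 0 (residual m a)"
    unfolding gradedp_def residual_def coeff_poly_shift
  proof
    fix i
    have "graded ?K m (int (m + m * (i + 2))) (0 + (i + 2)) (\<lambda>s k. coeff (linepoly m a s k) (i + 2))"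
      using gradedp_linepoly[OF K] unfolding gradedp_def by blast
    thus "graded ?K m (int (3 * m + m * i)) (0 + i) (\<lambda>s k. coeff (linepoly m a s k) (i + 2))"
      by (rule graded_parity_cong) (auto simp: algebra_simps)
  qed
  hence c: "graded ?K m (int (3 * m + m * ?n)) (0 + ?n) (\<lambda>s k. coeff (residual m a s k) ?n)"
    unfolding gradedp_def by blast
  have "graded ?K m (int (4 * m ^ 3 + 6 * m ^ 2)) 0 (line_disc m a)"
  proof (cases "m = 1")
    case True
    have "line_disc m a s k = coeff (residual m a s k) ?n" for s k
      using True by (simp add: line_disc_def elim_det_def)
    hence "line_disc m a = (\<lambda>s k. coeff (residual m a s k) ?n)" by (intro ext)
    thus ?thesis using c True by (auto intro: graded_parity_cong)
  next
    case False
    obtain l where l: "m = l + 1" using assms by (metis le_add_diff_inverse2)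
    have "graded ?K m (int m * (int ?n ^ 2 + 6 * int ?n - 3) + int (3 * m + m * ?n)) (0 + (0 + ?n)) (line_disc m a)"
      unfolding line_disc_def[abs_def]
      by (intro graded_mult[OF K] graded_elim_det[OF K r] c) (use False assms in auto)
    thus ?thesis
      by (rule graded_parity_cong) (auto simp: l algebra_simps power2_eq_square power3_eq_cube)
  qed
  then obtain \<Delta> where \<Delta>: "\<Delta> = 0 \<or> int (degree \<Delta>) \<le> int (4 * m ^ 3 + 6 * m ^ 2)"
     "\<And>s k. k\<^sup>2 = poly ?K s \<Longrightarrow> line_disc m a s k = poly \<Delta> s" unfolding graded_def by auto
  from \<Delta>(1) have "degree \<Delta> \<le> 4 * m ^ 3 + 6 * m ^ 2" by (auto simp del: of_nat_add)
  with \<Delta>(2) show ?thesis by (rule that[rotated])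
qed

section \<open>Polynomial dependence of the discriminant on a parameter\<close>

definition polyfun :: "(complex \<Rightarrow> complex) \<Rightarrow> bool" where
  "polyfun f \<longleftrightarrow> (\<exists>p. \<forall>x. f x = poly p x)"

lemma polyfun_poly: "polyfun (\<lambda>x. poly p x)" by (auto simp: polyfun_def)

lemma polyfun_const [simp]: "polyfun (\<lambda>x. c)" using polyfun_poly[of "[:c:]"] by simp

lemma polyfun_id [simp]: "polyfun (\<lambda>x. x)" using polyfun_poly[of "[:0,1:]"] by simp

lemma polyfun_add: "polyfun f \<Longrightarrow> polyfun g \<Longrightarrow> polyfun (\<lambda>x. f x + g x)"
  unfolding polyfun_def by (metis poly_add)

lemma polyfun_mult: "polyfun f \<Longrightarrow> polyfun g \<Longrightarrow> polyfun (\<lambda>x. f x * g x)"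
  unfolding polyfun_def by (metis poly_mult)

lemma polyfun_sum: "(\<And>i. i \<in> I \<Longrightarrow> polyfun (f i)) \<Longrightarrow> polyfun (\<lambda>x. \<Sum>i\<in>I. f i x)"
  by (induction I rule: infinite_finite_induct) (auto intro: polyfun_add)

lemma polyfun_prod: "(\<And>i. i \<in> I \<Longrightarrow> polyfun (f i)) \<Longrightarrow> polyfun (\<lambda>x. \<Prod>i\<in>I. f i x)"
  by (induction I rule: infinite_finite_induct) (auto intro: polyfun_mult)

lemma polyfun_elim_det:
  assumes "\<And>i. polyfun (\<lambda>x. coeff (r x) i)"
  shows "polyfun (\<lambda>x. elim_det n (r x))"
proof -
  have "polyfun (\<lambda>x. elim_entry n (r x) i j)" for i j
    using assms polyfun_mult[OF polyfun_const assms]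
    by (cases "i < n - 1"; cases "i \<le> j"; cases "i - (n - 1) \<le> j")
      (simp_all only: elim_entry_def coeff_pderiv if_True if_False polyfun_const)
  thus ?thesis unfolding elim_det_def
    by (subst det_def'[of _ "2 * n - 1"]) 
      (auto intro!: polyfun_sum polyfun_mult polyfun_prod cong: prod.cong simp: permutes_in_image[THEN iffD2, of _ "{0..<2 * n - 1}", simplified])
qed

definition polyfunp :: "(complex \<Rightarrow> complex poly) \<Rightarrow> bool" where
  "polyfunp f \<longleftrightarrow> (\<forall>i. polyfun (\<lambda>x. coeff (f x) i))"

lemma polyfunp_const [simp]: "polyfunp (\<lambda>x. c)" by (simp add: polyfunp_def)

lemma polyfunp_add: "polyfunp f \<Longrightarrow> polyfunp g \<Longrightarrow> polyfunp (\<lambda>x. f x + g x)"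
  by (simp add: polyfunp_def polyfun_add)

lemma polyfunp_mult: "polyfunp f \<Longrightarrow> polyfunp g \<Longrightarrow> polyfunp (\<lambda>x. f x * g x)"
  by (simp add: polyfunp_def coeff_mult polyfun_sum polyfun_mult)

lemma polyfunp_pCons: "polyfun c \<Longrightarrow> polyfunp f \<Longrightarrow> polyfunp (\<lambda>x. pCons (c x) (f x))"
  unfolding polyfunp_def
proof
  fix i assume "polyfun c" "\<forall>i. polyfun (\<lambda>x. coeff (f x) i)"
  thus "polyfun (\<lambda>x. coeff (pCons (c x) (f x)) i)" by (cases i) auto
qed

lemma polyfunp_prod: "(\<And>i. i \<in> I \<Longrightarrow> polyfunp (f i)) \<Longrightarrow> polyfunp (\<lambda>x. \<Prod>i\<in>I. f i x)"
  by (induction I rule: infinite_finite_induct) (auto intro: polyfunp_mult)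

lemma polyfunp_power: "polyfunp f \<Longrightarrow> polyfunp (\<lambda>x. f x ^ n)"
  by (induction n) (auto intro: polyfunp_mult)

lemma polyfunp_linepoly:
  assumes "polyfun k"
  shows "polyfunp (\<lambda>x. linepoly m a s (k x))"
proof -
  have c: "polyfun (\<lambda>x. c * k x)" "polyfun (\<lambda>x. c - k x)" "polyfun (\<lambda>x. c * (d - (k x)\<^sup>2))"
     "polyfun (\<lambda>x. c + d * k x)" for c d
    using polyfun_mult[OF polyfun_const assms, of c] polyfun_add[OF polyfun_const polyfun_mult[OF polyfun_const assms, of "-1"], of c]
      polyfun_mult[OF polyfun_const polyfun_add[OF polyfun_const polyfun_mult[OF polyfun_const polyfun_mult[OF assms assms], of "-1"]], of c d]
      polyfun_add[OF polyfun_const polyfun_mult[OF polyfun_const assms]]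
    by (simp_all add: power2_eq_square)
  define D where "D = poly (eulerq m a) s"
  define q where "q = poly (qpoly m a) s"
  have eq: "linepoly m a s k' = (\<Prod>i<m. [:s - a i, 2 * a i * k', a i * (D\<^sup>2 - k'\<^sup>2):]) +
     ([:- q / 2 + (- (1 / (2 * of_nat m))) * k':] * [:1, D - k':] ^ (2 * m) +
      [:- q / 2 + (1 / (2 * of_nat m)) * k':] * [:1, - D - k':] ^ (2 * m))" for k'
    unfolding linepoly_def Let_def D_def[symmetric] q_def[symmetric]
    by (simp add: poly_eq_poly_eq_iff[symmetric] fun_eq_iff) (simp add: field_simps)
  show ?thesis unfolding eq
    by (intro polyfunp_add polyfunp_mult polyfunp_prod polyfunp_power polyfunp_pCons c polyfun_const polyfunp_const)
qed


text \<open>At a root \<open>x\<close> only the term that differentiates its own factor survives,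
  and it is \<open>2 x\<close> times a product of nonzero differences.\<close>

lemma rsquarefree_prod_quadratics:
  fixes \<tau> :: "nat \<Rightarrow> complex"
  assumes "finite I" "inj_on \<tau> I" "\<And>i. i \<in> I \<Longrightarrow> \<tau> i \<noteq> 0"
  shows "rsquarefree (\<Prod>i\<in>I. [:- \<tau> i, 0, 1:])"
  unfolding rsquarefree_roots
proof (intro allI notI)
  fix x assume x: "poly (\<Prod>i\<in>I. [:- \<tau> i, 0, 1:]) x = 0 \<and> poly (pderiv (\<Prod>i\<in>I. [:- \<tau> i, 0, 1:])) x = 0"
  then obtain i where i: "i \<in> I" "\<tau> i = x * x" using assms(1) by (auto simp: poly_prod algebra_simps)
  have "(\<Sum>j\<in>I. poly (pderiv [:- \<tau> j, 0, 1:]) x * (\<Prod>l\<in>I-{j}. poly [:- \<tau> l, 0, 1:] x)) =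
     (\<Sum>j\<in>{i}. poly (pderiv [:- \<tau> j, 0, 1:]) x * (\<Prod>l\<in>I-{j}. poly [:- \<tau> l, 0, 1:] x))"
  proof (rule sum.mono_neutral_right)
    show "\<forall>j\<in>I - {i}. poly (pderiv [:- \<tau> j, 0, 1:]) x * (\<Prod>l\<in>I-{j}. poly [:- \<tau> l, 0, 1:] x) = 0"
      using i assms(1) by (auto intro!: bexI[of _ i])
  qed (use i assms(1) in auto)
  hence "2 * x * (\<Prod>l\<in>I-{i}. x * x - \<tau> l) = 0"
    using x assms(1) by (simp add: poly_pderiv_prod pderiv_pCons algebra_simps)
  moreover have "x \<noteq> 0" using assms(3)[OF i(1)] i(2) by auto
  ultimately have "(\<Prod>l\<in>I-{i}. x * x - \<tau> l) = 0" by simp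
  then obtain l where "l \<in> I - {i}" "\<tau> l = x * x"
    using prod_zero_iff[OF finite_Diff[OF assms(1)], of "\<lambda>l. x * x - \<tau> l" "{i}"]
    by (metis right_minus_eq)
  thus False using i assms(2) by (auto simp: inj_on_def)
qed

text \<open>
  Here \<open>A = 0\<close>: the curve is a union of concentric conics, and a tangent line of one of them meets the
  others transversally.
\<close>

lemma line_disc_conics_ne_0:
  assumes m: "m \<ge> 1" and inj: "inj_on a {..<m}" and a0: "\<And>i. i < m \<Longrightarrow> a i \<noteq> 0"
  shows "line_disc m a (a 0) 0 \<noteq> 0"
proof -
  define D where "D = poly (eulerq m a) (a 0)"
  have q0: "poly (qpoly m a) (a 0) = 0" using m by (auto simp: poly_qpoly)
  let ?J = "{1..<m}"
  have split: "{..<m} = insert 0 ?J" "0 \<notin> ?J" using m by auto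
  have "D = (\<Sum>i<m. a i * (\<Prod>j\<in>{..<m}-{i}. a 0 - a j))"
    by (simp add: euler_relation D_def q0)
  also have "\<dots> = (\<Sum>i\<in>{0}. a i * (\<Prod>j\<in>{..<m}-{i}. a 0 - a j))"
    by (rule sum.mono_neutral_right) (use m in auto)
  also have "\<dots> = a 0 * (\<Prod>j\<in>{..<m}-{0}. a 0 - a j)" by simp
  also have "\<dots> \<noteq> 0" using m inj a0[of 0] by (auto simp: inj_on_def)
  finally have D: "D \<noteq> 0" .
  define \<tau> where "\<tau> i = (a i - a 0) / (a i * D\<^sup>2)" for i
  define C where "C = (\<Prod>i<m. a i * D\<^sup>2)"
  have C: "C \<noteq> 0" using a0 D by (auto simp: C_def)
  have fac: "[:a 0 - a i, 0, a i * D\<^sup>2:] = Polynomial.smult (a i * D\<^sup>2) [:- \<tau> i, 0, 1:]" if "i < m" for i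
    using a0[OF that] D by (simp add: \<tau>_def)
  \<comment> \<open>Both \<open>q\<close> and \<open>k\<close> vanish here, so the subtracted powers
    drop out; the factor of index 0 is \<open>a 0 D^2 t^2\<close>, which \<open>residual\<close>
    divides by \<open>t^2\<close>.\<close>
  have "linepoly m a (a 0) 0 = (\<Prod>i<m. [:a 0 - a i, 0, a i * D\<^sup>2:])"
    by (simp add: linepoly_def Let_def q0 D_def)
  also have "\<dots> = (\<Prod>i<m. Polynomial.smult (a i * D\<^sup>2) [:- \<tau> i, 0, 1:])"
    by (intro prod.cong refl fac) simp
  also have "\<dots> = Polynomial.smult C (\<Prod>i<m. [:- \<tau> i, 0, 1:])"
    by (simp only: prod_smult C_def)
  also have "(\<Prod>i<m. [:- \<tau> i, 0, 1:]) = monom 1 2 * (\<Prod>i\<in>?J. [:- \<tau> i, 0, 1:])"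
    unfolding split(1) using split(2) by (simp add: \<tau>_def monom_altdef numeral_2_eq_2)
  finally have L: "linepoly m a (a 0) 0 = monom 1 2 * Polynomial.smult C (\<Prod>i\<in>?J. [:- \<tau> i, 0, 1:])" by simp
  have r: "residual m a (a 0) 0 = Polynomial.smult C (\<Prod>i\<in>?J. [:- \<tau> i, 0, 1:])"
    unfolding residual_def L by (rule poly_eqI) (simp add: coeff_poly_shift coeff_monom_mult)
  have inj\<tau>: "inj_on \<tau> ?J"
  proof (rule inj_onI)
    fix i j assume ij: "i \<in> ?J" "j \<in> ?J" "\<tau> i = \<tau> j"
    have nz: "a i \<noteq> 0" "a j \<noteq> 0" "a 0 \<noteq> 0" using ij m by (auto intro!: a0)
    with ij D have "a i = a j" by (simp add: \<tau>_def field_simps)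
    thus "i = j" using inj ij by (auto simp: inj_on_def)
  qed
  have "\<tau> i \<noteq> 0" if "i \<in> ?J" for i
    using that inj_onD[OF inj, of i 0] m a0[of i] D by (auto simp: \<tau>_def)
  hence sqf: "rsquarefree (residual m a (a 0) 0)"
    using rsquarefree_prod_quadratics[OF _ inj\<tau>] C unfolding r rsquarefree_roots
    by (simp add: pderiv_smult)
  have "degree (\<Prod>i\<in>?J. [:- \<tau> i, 0, 1:]) = 2 * (m - 1)" by (simp add: degree_prod_eq_sum_degree)
  hence deg: "degree (residual m a (a 0) 0) = 2 * m - 2" using C by (simp add: r)
  have "coeff (residual m a (a 0) 0) (2 * m - 2) \<noteq> 0"
    using deg sqf by (metis leading_coeff_0_iff rsquarefree_def)
  moreover have "elim_det (2 * m - 2) (residual m a (a 0) 0) \<noteq> 0"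
  proof (cases "m = 1")
    case True
    then show ?thesis by (simp add: elim_det_def)
  next
    case False
    then show ?thesis using elim_det_ne_0[OF deg _ sqf] m by simp
  qed
  ultimately show ?thesis by (simp add: line_disc_def)
qed

text \<open>On the slice \<open>s = a 0\<close> the value of \<open>q\<close> is 0, so
  \<open>k = \<i> m A\<close> is a square root of \<open>kappa2\<close> that is polynomial in
  \<open>A\<close>. There \<open>line_disc\<close> becomes a polynomial in \<open>A\<close>, and it
  is nonzero at \<open>A = 0\<close>.\<close>

lemma finite_bad_parameters:
  assumes m: "m \<ge> 1" and inj: "inj_on a {..<m}" and a0: "\<And>i. i < m \<Longrightarrow> a i \<noteq> 0"
  shows "finite {A. \<forall>s k. k\<^sup>2 = poly (kappa2 m a A) s \<longrightarrow> line_disc m a s k = 0}"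
proof -
  have q0: "poly (qpoly m a) (a 0) = 0" using m by (auto simp: poly_qpoly)
  have "polyfunp (\<lambda>x. linepoly m a (a 0) (\<i> * of_nat m * x))"
    by (intro polyfunp_linepoly polyfun_mult) auto
  hence "polyfun (\<lambda>x. coeff (residual m a (a 0) (\<i> * of_nat m * x)) i)" for i
    by (simp add: residual_def coeff_poly_shift polyfunp_def)
  hence "polyfun (\<lambda>x. line_disc m a (a 0) (\<i> * of_nat m * x))"
    unfolding line_disc_def by (intro polyfun_mult polyfun_elim_det)
  then obtain p where p: "\<And>x. line_disc m a (a 0) (\<i> * of_nat m * x) = poly p x"
    unfolding polyfun_def by blast
  have "poly p 0 \<noteq> 0" using p[of 0] line_disc_conics_ne_0[OF assms] by simp
  hence "finite {x. poly p x = 0}" by (intro poly_roots_finite) auto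
  moreover have "poly p A = 0" if "\<forall>s k. k\<^sup>2 = poly (kappa2 m a A) s \<longrightarrow> line_disc m a s k = 0" for A
    using that p[of A] by (simp add: kappa2_def q0 power_mult_distrib)
  ultimately show ?thesis by (intro finite_subset[OF _ \<open>finite {x. poly p x = 0}\<close>]) blast
qed

section \<open>Rosette forms\<close>

definition rosette :: "nat \<Rightarrow> (nat \<Rightarrow> real) \<Rightarrow> real \<Rightarrow> complex \<Rightarrow> complex \<Rightarrow> complex \<Rightarrow> complex" where
  "rosette m a A u v z =
     (\<Prod>i<m. z\<^sup>2 - of_real (a i) * (u * v)) - of_real A / 2 * (u ^ (2 * m) + v ^ (2 * m))"

definition rosette_diff :: "nat \<Rightarrow> (nat \<Rightarrow> real) \<Rightarrow> real \<Rightarrow>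
    complex \<Rightarrow> complex \<Rightarrow> complex \<Rightarrow> complex \<Rightarrow> complex \<Rightarrow> complex \<Rightarrow> complex" where
  "rosette_diff m a A u v z u' v' z' =
     (\<Sum>i<m. (2 * z * z' - of_real (a i) * (u' * v + u * v')) *
        (\<Prod>j\<in>{..<m}-{i}. z\<^sup>2 - of_real (a j) * (u * v))) -
     of_real A * of_nat m * (u ^ (2 * m - 1) * u' + v ^ (2 * m - 1) * v')"

section \<open>Ternary forms with real coefficients\<close>

definition is_form :: "nat \<Rightarrow> (complex \<Rightarrow> complex \<Rightarrow> complex \<Rightarrow> complex) \<Rightarrow> bool" where
  "is_form d F \<longleftrightarrow> (\<exists>c. \<forall>x y z. hp_eval d c x y z = F x y z)"

lemma is_form_const: "is_form 0 (\<lambda>x y z. of_real r)"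
  unfolding is_form_def by (rule exI[of _ "\<lambda>_ _. r"]) (simp add: hp_eval_def)

lemma is_form_add: "is_form d F \<Longrightarrow> is_form d G \<Longrightarrow> is_form d (\<lambda>x y z. F x y z + G x y z)"
  unfolding is_form_def
proof (elim exE)
  fix b c assume "\<forall>x y z. hp_eval d b x y z = F x y z" "\<forall>x y z. hp_eval d c x y z = G x y z"
  thus "\<exists>c. \<forall>x y z. hp_eval d c x y z = F x y z + G x y z"
    by (intro exI[of _ "\<lambda>i j. b i j + c i j"]) (simp add: hp_eval_def sum.distrib ring_distribs)
qed

lemma is_form_scale: "is_form d F \<Longrightarrow> is_form d (\<lambda>x y z. of_real r * F x y z)"
  unfolding is_form_def
proof (elim exE)
  fix c assume "\<forall>x y z. hp_eval d c x y z = F x y z"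
  moreover have *: "hp_eval d (\<lambda>i j. r * c i j) x y z = of_real r * hp_eval d c x y z" for x y z :: complex
    by (simp add: hp_eval_def sum_distrib_left mult_ac)
  ultimately show "\<exists>c. \<forall>x y z. hp_eval d c x y z = of_real r * F x y z"
    by (intro exI[of _ "\<lambda>i j. r * c i j"]) simp
qed

lemma is_form_x: "is_form d F \<Longrightarrow> is_form (Suc d) (\<lambda>x y z. x * F x y z)"
  unfolding is_form_def
proof (elim exE)
  fix c assume c: "\<forall>x y z. hp_eval d c x y z = F x y z"
  let ?c = "\<lambda>i j. if i = 0 then 0 else c (i - 1) j"
  have "hp_eval (Suc d) ?c x y z = x * hp_eval d c x y z" for x y z :: complex
    unfolding hp_eval_def
    by (subst sum.atMost_Suc_shift) (simp add: sum_distrib_left mult_ac)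
  with c show "\<exists>c. \<forall>x y z. hp_eval (Suc d) c x y z = x * F x y z" by (intro exI[of _ ?c]) simp
qed

lemma is_form_y: "is_form d F \<Longrightarrow> is_form (Suc d) (\<lambda>x y z. y * F x y z)"
  unfolding is_form_def
proof (elim exE)
  fix c assume c: "\<forall>x y z. hp_eval d c x y z = F x y z"
  let ?c = "\<lambda>i j. if j = 0 then 0 else c i (j - 1)"
  have "hp_eval (Suc d) ?c x y z = y * hp_eval d c x y z" for x y z :: complex
  proof -
    have "(\<Sum>j\<le>Suc d - i. of_real (?c i j) * x ^ i * y ^ j * z ^ (Suc d - i - j)) =
       y * (\<Sum>j\<le>d - i. of_real (c i j) * x ^ i * y ^ j * z ^ (d - i - j))" if "i \<le> d" for i
      unfolding Suc_diff_le[OF that]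
      by (subst sum.atMost_Suc_shift) (simp add: sum_distrib_left mult_ac)
    thus ?thesis unfolding hp_eval_def by (simp add: sum_distrib_left)
  qed
  with c show "\<exists>c. \<forall>x y z. hp_eval (Suc d) c x y z = y * F x y z" by (intro exI[of _ ?c]) simp
qed

lemma is_form_z: "is_form d F \<Longrightarrow> is_form (Suc d) (\<lambda>x y z. z * F x y z)"
  unfolding is_form_def
proof (elim exE)
  fix c assume c: "\<forall>x y z. hp_eval d c x y z = F x y z"
  let ?c = "\<lambda>i j. if i + j \<le> d then c i j else 0"
  have "hp_eval (Suc d) ?c x y z = z * hp_eval d c x y z" for x y z :: complex
  proof -
    have "(\<Sum>j\<le>Suc d - i. of_real (?c i j) * x ^ i * y ^ j * z ^ (Suc d - i - j)) =
       z * (\<Sum>j\<le>d - i. of_real (c i j) * x ^ i * y ^ j * z ^ (d - i - j))" if "i \<le> d" for i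
      unfolding Suc_diff_le[OF that] using that
      by (simp add: sum_distrib_left mult_ac) (auto intro!: sum.cong simp: Suc_diff_le)
    thus ?thesis unfolding hp_eval_def by (simp add: sum_distrib_left)
  qed
  with c show "\<exists>c. \<forall>x y z. hp_eval (Suc d) c x y z = z * F x y z" by (intro exI[of _ ?c]) simp
qed

lemma is_form_circles:
  "is_form (2 * m) (\<lambda>x y z. \<Prod>i<m. z\<^sup>2 - of_real (a i) * ((x + \<i> * y) * (x - \<i> * y)))"
proof (induction m)
  case 0
  show ?case using is_form_const[of 1] by simp
next
  case (Suc m)
  let ?P = "\<lambda>x y z. \<Prod>i<m. z\<^sup>2 - of_real (a i) * ((x + \<i> * y) * (x - \<i> * y))"
  have "is_form (Suc (Suc (2 * m))) (\<lambda>x y z. z * (z * ?P x y z) +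
      of_real (- a m) * (x * (x * ?P x y z) + y * (y * ?P x y z)))"
    by (intro is_form_add is_form_scale is_form_x is_form_y is_form_z Suc.IH)
  moreover have "z * (z * P) + of_real (- a m) * (x * (x * P) + y * (y * P)) =
     P * (z\<^sup>2 - of_real (a m) * ((x + \<i> * y) * (x - \<i> * y)))" for x y z P
    by (simp add: algebra_simps power2_eq_square)
  ultimately show ?case by simp
qed

text \<open>Multiplication by \<open>x + \<i> y\<close> mixes the real and the imaginary part, so
  the two are treated together.\<close>

lemma is_form_rotation:
  "is_form n (\<lambda>x y z. ((x + \<i> * y) ^ n + (x - \<i> * y) ^ n) / 2) \<and>
   is_form n (\<lambda>x y z. ((x + \<i> * y) ^ n - (x - \<i> * y) ^ n) / (2 * \<i>))"
proof (induction n)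
  case 0
  show ?case using is_form_const[of 1] is_form_const[of 0] by simp
next
  case (Suc n)
  let ?R = "\<lambda>x y z::complex. ((x + \<i> * y) ^ n + (x - \<i> * y) ^ n) / 2"
  let ?I = "\<lambda>x y z::complex. ((x + \<i> * y) ^ n - (x - \<i> * y) ^ n) / (2 * \<i>)"
  have "is_form (Suc n) (\<lambda>x y z. x * ?R x y z + of_real (- 1) * (y * ?I x y z))"
    "is_form (Suc n) (\<lambda>x y z. x * ?I x y z + y * ?R x y z)"
    using Suc.IH by (intro is_form_add is_form_scale is_form_x is_form_y; simp)+
  moreover have "x * ?R x y z + of_real (- 1) * (y * ?I x y z) = ((x + \<i> * y) ^ Suc n + (x - \<i> * y) ^ Suc n) / 2"
    "x * ?I x y z + y * ?R x y z = ((x + \<i> * y) ^ Suc n - (x - \<i> * y) ^ Suc n) / (2 * \<i>)" for x y z :: complex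
    by (simp_all add: field_simps)
  ultimately show ?case by (simp only:)
qed

lemma rosette_is_form: "is_form (2 * m) (\<lambda>x y z. rosette m a A (x + \<i> * y) (x - \<i> * y) z)"
proof -
  have "is_form (2 * m) (\<lambda>x y z. (\<Prod>i<m. z\<^sup>2 - of_real (a i) * ((x + \<i> * y) * (x - \<i> * y))) +
     of_real (- A) * (((x + \<i> * y) ^ (2 * m) + (x - \<i> * y) ^ (2 * m)) / 2))"
    using is_form_rotation[of "2 * m"] by (intro is_form_add is_form_scale is_form_circles) auto
  thus ?thesis by (simp add: rosette_def)
qed

section \<open>Directional derivatives and homogeneity\<close>

lemma hp_eval_directional:
  fixes x y z :: complex
  shows "((\<lambda>t. hp_eval d c (x + t * x') (y + t * y') (z + t * z')) has_field_derivative
    hp_dx d c (x + t * x') (y + t * y') (z + t * z') * x' +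
    hp_dy d c (x + t * x') (y + t * y') (z + t * z') * y' +
    hp_dz d c (x + t * x') (y + t * y') (z + t * z') * z') (at t)"
  unfolding hp_eval_def hp_dx_def hp_dy_def hp_dz_def sum_distrib_right sum.distrib[symmetric]
  by (intro DERIV_sum) (auto intro!: derivative_eq_intros simp: algebra_simps)

lemma rosette_directional:
  "((\<lambda>t. rosette m a A (u + t * u') (v + t * v') (z + t * z')) has_field_derivative
    rosette_diff m a A (u + t * u') (v + t * v') (z + t * z') u' v' z') (at t)"
proof -
  have pw: "((\<lambda>t. (w + t * w') ^ (2 * m)) has_field_derivative
     of_nat (2 * m) * (w + t * w') ^ (2 * m - 1) * w') (at t)" for w w' :: complex
    by (auto intro!: derivative_eq_intros)
  have "((\<lambda>t. \<Prod>i<m. (z + t * z')\<^sup>2 - of_real (a i) * ((u + t * u') * (v + t * v'))) has_field_derivative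
    (\<Sum>i<m. (2 * (z + t * z') * z' - of_real (a i) * (u' * (v + t * v') + (u + t * u') * v')) *
        (\<Prod>j\<in>{..<m}-{i}. (z + t * z')\<^sup>2 - of_real (a j) * ((u + t * u') * (v + t * v'))))) (at t)"
    by (rule has_field_derivative_prod) (auto intro!: derivative_eq_intros simp: algebra_simps)
  from DERIV_diff[OF this DERIV_cmult[OF DERIV_add[OF pw[of u u'] pw[of v v']], of "of_real A / 2"]]
  show ?thesis unfolding rosette_def rosette_diff_def
    by (rule DERIV_cong) (simp add: algebra_simps)
qed

lemma rosette_scale: "rosette m a A (t * u) (t * v) (t * z) = t ^ (2 * m) * rosette m a A u v z"
proof -
  have "(t * z)\<^sup>2 - of_real (a i) * (t * u * (t * v)) = t\<^sup>2 * (z\<^sup>2 - of_real (a i) * (u * v))" for i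
    by (simp add: power2_eq_square algebra_simps)
  hence "(\<Prod>i<m. (t * z)\<^sup>2 - of_real (a i) * (t * u * (t * v))) =
      t ^ (2 * m) * (\<Prod>i<m. z\<^sup>2 - of_real (a i) * (u * v))"
    by (simp only: prod.distrib prod_constant card_lessThan power_mult)
  thus ?thesis
    by (simp add: rosette_def power_mult_distrib algebra_simps)
qed

lemma rosette_diff_linear:
  "rosette_diff m a A u v z (s * u') (s * v') (s * z') = s * rosette_diff m a A u v z u' v' z'"
  by (simp add: rosette_diff_def sum_distrib_left algebra_simps)

lemma rosette_diff_add:
  "rosette_diff m a A u v z (u' + u'') (v' + v'') (z' + z'') =
   rosette_diff m a A u v z u' v' z' + rosette_diff m a A u v z u'' v'' z''"
  by (simp add: rosette_diff_def sum.distrib[symmetric] algebra_simps)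

text \<open>Differentiate \<open>rosette_scale\<close> along a line and use uniqueness of
  derivatives; Euler's relation below is obtained in the same way. The factor \<open>t\<close> on
  the left avoids the exponent \<open>2 m - 1\<close>.\<close>

lemma rosette_diff_scale:
  assumes "t \<noteq> 0"
  shows "t * rosette_diff m a A (t * u) (t * v) (t * z) u' v' z' = t ^ (2 * m) * rosette_diff m a A u v z u' v' z'"
proof -
  have 1: "((\<lambda>s. rosette m a A (t * u + s * (t * u')) (t * v + s * (t * v')) (t * z + s * (t * z'))) has_field_derivative
    rosette_diff m a A (t * u) (t * v) (t * z) (t * u') (t * v') (t * z')) (at 0)"
    using rosette_directional[of m a A "t * u" "t * u'" "t * v" "t * v'" "t * z" "t * z'" 0] by simp
  have "((\<lambda>s. t ^ (2 * m) * rosette m a A (u + s * u') (v + s * v') (z + s * z')) has_field_derivative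
    t ^ (2 * m) * rosette_diff m a A u v z u' v' z') (at 0)"
    using DERIV_cmult[OF rosette_directional[of m a A u u' v v' z z' 0]] by simp
  moreover have "rosette m a A (t * u + s * (t * u')) (t * v + s * (t * v')) (t * z + s * (t * z')) =
     t ^ (2 * m) * rosette m a A (u + s * u') (v + s * v') (z + s * z')" for s
    using rosette_scale[of m a A t "u + s * u'" "v + s * v'" "z + s * z'"] by (simp add: algebra_simps)
  ultimately show ?thesis using DERIV_unique[OF 1] by (simp add: rosette_diff_linear)
qed

lemma rosette_euler: "rosette_diff m a A u v z u v z = of_nat (2 * m) * rosette m a A u v z"
proof -
  have 1: "((\<lambda>s. rosette m a A (u + s * u) (v + s * v) (z + s * z)) has_field_derivative
    rosette_diff m a A u v z u v z) (at 0)"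
    using rosette_directional[of m a A u u v v z z 0] by simp
  have "((\<lambda>s. (1 + s) ^ (2 * m) * rosette m a A u v z) has_field_derivative
    of_nat (2 * m) * rosette m a A u v z) (at 0)"
    by (auto intro!: derivative_eq_intros)
  moreover have "rosette m a A (u + s * u) (v + s * v) (z + s * z) =
     (1 + s) ^ (2 * m) * rosette m a A u v z" for s
    using rosette_scale[of m a A "1 + s" u v z] by (simp add: algebra_simps)
  ultimately show ?thesis using DERIV_unique[OF 1] by simp
qed

section \<open>Tangent lines of a rosette curve\<close>

text \<open>Charge a line with a point in \<open>X0\<close> to that point, and every other line to
  two points of \<open>X1\<close>. No point carries two lines, so the charges are disjoint; hence
  the factor 2 in front of \<open>card B\<close>.\<close>

lemma card_by_incidence:
  assumes fin: "finite X0" "finite X1"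
    and inc: "\<And>L. L \<in> B \<Longrightarrow> (\<exists>x\<in>X0. R L x) \<or> (\<exists>x\<in>X1. \<exists>y\<in>X1. x \<noteq> y \<and> R L x \<and> R L y)"
    and unique: "\<And>L L' x. L \<in> B \<Longrightarrow> L' \<in> B \<Longrightarrow> R L x \<Longrightarrow> R L' x \<Longrightarrow> L = L'"
  shows "finite B \<and> 2 * card B \<le> 2 * card X0 + card X1"
proof -
  define B0 where "B0 = {L \<in> B. \<exists>x\<in>X0. R L x}"
  define B1 where "B1 = B - B0"
  have B0B: "L \<in> B" if "L \<in> B0" for L using that by (simp add: B0_def)
  define e where "e L = (SOME x. x \<in> X0 \<and> R L x)" for L
  have e: "e L \<in> X0 \<and> R L (e L)" if "L \<in> B0" for L
  proof -
    have "\<exists>x. x \<in> X0 \<and> R L x" using that unfolding B0_def by blast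
    thus ?thesis unfolding e_def by (rule someI_ex)
  qed
  have inj_on_R: "inj_on h S" if "S \<subseteq> B" "\<forall>L\<in>S. R L (h L)" for h S
  proof (rule inj_onI)
    fix L L' assume L: "L \<in> S" "L' \<in> S" "h L = h L'"
    with that have "R L (h L)" "R L' (h L)" by auto
    with L that(1) show "L = L'" by (intro unique[of L L' "h L"]) auto
  qed
  have inj_e: "inj_on e B0" by (rule inj_on_R) (use e B0B in blast)+
  have "e ` B0 \<subseteq> X0" using e by blast
  hence B0: "finite B0" "card B0 \<le> card X0"
    using inj_on_finite[OF inj_e _ fin(1)] card_inj_on_le[OF inj_e _ fin(1)] by simp_all
  define fg where "fg L = (SOME p. fst p \<in> X1 \<and> snd p \<in> X1 \<and> fst p \<noteq> snd p \<and> R L (fst p) \<and> R L (snd p))" for L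
  define f where "f L = fst (fg L)" for L
  define g where "g L = snd (fg L)" for L
  have fg: "f L \<in> X1 \<and> g L \<in> X1 \<and> f L \<noteq> g L \<and> R L (f L) \<and> R L (g L)" if "L \<in> B1" for L
  proof -
    from that have "L \<in> B" "\<not> (\<exists>x\<in>X0. R L x)" unfolding B1_def B0_def by blast+
    with inc[of L] obtain x y where "x \<in> X1" "y \<in> X1" "x \<noteq> y" "R L x" "R L y" by blast
    hence "\<exists>p. fst p \<in> X1 \<and> snd p \<in> X1 \<and> fst p \<noteq> snd p \<and> R L (fst p) \<and> R L (snd p)"
      by (intro exI[of _ "(x, y)"]) simp
    thus ?thesis unfolding f_def g_def fg_def by (rule someI_ex)
  qed
  have B1: "L \<in> B" if "L \<in> B1" for L using that by (simp add: B1_def)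
  have inj: "inj_on f B1" "inj_on g B1" by (rule inj_on_R; use fg B1 in blast)+
  have "f ` B1 \<inter> g ` B1 = {}"
  proof -
    have False if L: "L \<in> B1" "L' \<in> B1" "f L = g L'" for L L'
    proof -
      note fgL = fg[OF L(1)] and fgL' = fg[OF L(2)]
      have "R L (f L)" using fgL by (elim conjE)
      moreover have "R L' (f L)" using fgL' unfolding L(3) by (elim conjE)
      ultimately have "L = L'" by (rule unique[OF B1[OF L(1)] B1[OF L(2)]])
      thus False using fgL L(3) by simp
    qed
    thus ?thesis by blast
  qed
  moreover have sub: "f ` B1 \<subseteq> X1" "g ` B1 \<subseteq> X1" using fg by blast+
  hence fB1: "finite B1" using inj_on_finite[OF inj(1) _ fin(2)] by simp
  ultimately have "card (f ` B1) + card (g ` B1) = card (f ` B1 \<union> g ` B1)"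
    by (intro card_Un_disjoint[symmetric]) simp_all
  also have "\<dots> \<le> card X1" using sub fin(2) by (intro card_mono) simp_all
  finally have "2 * card B1 \<le> card X1" using inj by (simp add: card_image)
  moreover have "B = B0 \<union> B1" "B0 \<inter> B1 = {}" unfolding B1_def B0_def by auto
  ultimately show ?thesis using B0 fB1 by (simp add: card_Un_disjoint)
qed

definition cartesian :: "complex \<times> complex \<times> complex \<Rightarrow> complex \<times> complex \<times> complex" where
  "cartesian p = (case p of (u, v, z) \<Rightarrow> ((u + v) / 2, (u - v) / (2 * \<i>), z))"

text \<open>A singular point would satisfy \<open>s q'(s) = 0\<close> and
  \<open>q(s) = \<plusminus>A\<close>. This is what \<open>regular_value\<close> forbids; it
  excludes only finitely many \<open>A\<close>.\<close>

locale rosette_curve =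
  fixes m :: nat and a :: "nat \<Rightarrow> real" and A :: real and c :: "nat \<Rightarrow> nat \<Rightarrow> real"
  assumes m: "m \<ge> 1"
    and eval: "hp_eval (2 * m) c x y z = rosette m a A (x + \<i> * y) (x - \<i> * y) (z :: complex)"
    and A: "A \<noteq> 0"
    and a0: "i < m \<Longrightarrow> a i \<noteq> 0"
    and regular_value: "poly (pderiv (qpoly m (\<lambda>i. of_real (a i)))) s = 0 \<or> s = 0 \<Longrightarrow>
          poly (qpoly m (\<lambda>i. of_real (a i))) s \<noteq> of_real A \<and> poly (qpoly m (\<lambda>i. of_real (a i))) s \<noteq> - of_real A"
begin

abbreviation (input) aa :: "nat \<Rightarrow> complex" where "aa \<equiv> \<lambda>i. of_real (a i)"

lemma uv_x: "(u + v) / 2 + \<i> * ((u - v) / (2 * \<i>)) = u" "(u + v) / 2 - \<i> * ((u - v) / (2 * \<i>)) = v" for u v :: complex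
  by (simp_all add: field_simps)

lemma eval_diff:
  "hp_dx (2 * m) c x y z * x' + hp_dy (2 * m) c x y z * y' + hp_dz (2 * m) c x y z * z' =
   rosette_diff m a A (x + \<i> * y) (x - \<i> * y) z (x' + \<i> * y') (x' - \<i> * y') z'"
proof -
  have 1: "((\<lambda>t. hp_eval (2 * m) c (x + t * x') (y + t * y') (z + t * z')) has_field_derivative
    hp_dx (2 * m) c x y z * x' + hp_dy (2 * m) c x y z * y' + hp_dz (2 * m) c x y z * z') (at 0)"
    using hp_eval_directional[of "2 * m" c x x' y y' z z' 0] by simp
  have "((\<lambda>t. rosette m a A (x + \<i> * y + t * (x' + \<i> * y')) (x - \<i> * y + t * (x' - \<i> * y')) (z + t * z')) has_field_derivative
    rosette_diff m a A (x + \<i> * y) (x - \<i> * y) z (x' + \<i> * y') (x' - \<i> * y') z') (at 0)"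
    using rosette_directional[of m a A "x + \<i> * y" "x' + \<i> * y'" "x - \<i> * y" "x' - \<i> * y'" z z' 0] by simp
  moreover have "hp_eval (2 * m) c (x + t * x') (y + t * y') (z + t * z') =
      rosette m a A (x + \<i> * y + t * (x' + \<i> * y')) (x - \<i> * y + t * (x' - \<i> * y')) (z + t * z')" for t
    unfolding eval by (simp add: algebra_simps)
  ultimately show ?thesis using DERIV_unique[OF 1] by simp
qed

lemma rosette_quotient:
  assumes "u * v \<noteq> 0"
  shows "(\<Prod>i<m. z\<^sup>2 - of_real (a i) * (u * v)) = (u * v) ^ m * poly (qpoly m aa) (z\<^sup>2 / (u * v))"
proof -
  have "z\<^sup>2 - of_real (a i) * (u * v) = (u * v) * (z\<^sup>2 / (u * v) - of_real (a i))" for i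
    using assms by (simp add: field_simps)
  thus ?thesis by (simp only: prod.distrib prod_constant card_lessThan poly_qpoly power_mult_distrib)
qed

text \<open>In the logarithmic directions, scaled by \<open>u\<close>, \<open>v\<close> and
  \<open>z\<close>, the differential of the product of conics is \<open>(u v)^m\<close> times a
  function of \<open>s\<close> alone.\<close>

lemma rosette_diff_quotient:
  fixes u v z :: complex
  assumes nz: "u * v \<noteq> 0"
  defines "s \<equiv> z\<^sup>2 / (u * v)"
  shows "rosette_diff m a A u v z (u * b) 0 0 =
      b * ((u * v) ^ m * (of_nat m * poly (qpoly m aa) s - poly (eulerq m aa) s) - of_real A * of_nat m * u ^ (2 * m))"
    and "rosette_diff m a A u v z 0 (v * b) 0 =
      b * ((u * v) ^ m * (of_nat m * poly (qpoly m aa) s - poly (eulerq m aa) s) - of_real A * of_nat m * v ^ (2 * m))"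
    and "z * rosette_diff m a A u v z 0 0 b = b * (2 * (u * v) ^ m * poly (eulerq m aa) s)"
proof -
  define P where "P i = (\<Prod>j\<in>{..<m}-{i}. z\<^sup>2 - of_real (a j) * (u * v))" for i
  define Q where "Q i = (\<Prod>j\<in>{..<m}-{i}. s - of_real (a j))" for i
  have P: "(u * v) * P i = (u * v) ^ m * Q i" if "i < m" for i
  proof -
    have "z\<^sup>2 - of_real (a j) * (u * v) = (u * v) * (s - of_real (a j))" for j
      using nz by (simp add: s_def field_simps)
    hence "P i = (u * v) ^ (m - 1) * Q i"
      using that by (simp only: P_def Q_def prod.distrib prod_constant card_Diff_singleton lessThan_iff finite_lessThan card_lessThan power_mult_distrib)
    thus ?thesis using m by (simp add: power_eq_if)
  qed
  have S: "(\<Sum>i<m. of_real (a i) * ((u * v) * P i)) = (u * v) ^ m * (poly (eulerq m aa) s - of_nat m * poly (qpoly m aa) s)"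
    unfolding euler_relation[symmetric] Q_def[symmetric] sum_distrib_left
    by (intro sum.cong refl) (simp add: P)
  have T: "(\<Sum>i<m. (u * v) * P i) = (u * v) ^ m * poly (pderiv (qpoly m aa)) s"
    by (simp add: qpoly_def poly_pderiv_prod pderiv_pCons Q_def[symmetric] sum_distrib_left P)
  have pw: "w ^ (2 * m - 1) * w = w ^ (2 * m)" for w :: complex using m by (simp add: power_eq_if)
  have pw': "w ^ (2 * m - 1) * (w * b) = b * w ^ (2 * m)" for w :: complex using pw[of w] by (simp add: mult_ac)
  have "rosette_diff m a A u v z (u * b) 0 0 = - b * (\<Sum>i<m. of_real (a i) * ((u * v) * P i)) - of_real A * of_nat m * (b * u ^ (2 * m))"
    unfolding rosette_diff_def P_def[symmetric] pw'[symmetric] by (simp add: sum_distrib_left sum_negf mult_ac)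
  thus "rosette_diff m a A u v z (u * b) 0 0 =
      b * ((u * v) ^ m * (of_nat m * poly (qpoly m aa) s - poly (eulerq m aa) s) - of_real A * of_nat m * u ^ (2 * m))"
    unfolding S by (simp add: algebra_simps)
  have "rosette_diff m a A u v z 0 (v * b) 0 = - b * (\<Sum>i<m. of_real (a i) * ((u * v) * P i)) - of_real A * of_nat m * (b * v ^ (2 * m))"
    unfolding rosette_diff_def P_def[symmetric] pw'[symmetric] by (simp add: sum_distrib_left sum_negf mult_ac)
  thus "rosette_diff m a A u v z 0 (v * b) 0 =
      b * ((u * v) ^ m * (of_nat m * poly (qpoly m aa) s - poly (eulerq m aa) s) - of_real A * of_nat m * v ^ (2 * m))"
    unfolding S by (simp add: algebra_simps)
  have "z * rosette_diff m a A u v z 0 0 b = 2 * b * (z\<^sup>2 / (u * v)) * (\<Sum>i<m. (u * v) * P i)"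
    unfolding rosette_diff_def P_def[symmetric] sum_distrib_left[symmetric, of _ P]
    using nz by (simp add: sum_distrib_left[symmetric] sum_distrib_right[symmetric] power2_eq_square)
  thus "z * rosette_diff m a A u v z 0 0 b = b * (2 * (u * v) ^ m * poly (eulerq m aa) s)"
    unfolding T s_def[symmetric] by (simp add: eulerq_def mult_ac)
qed

text \<open>If \<open>u\<close> or \<open>v\<close> is 0, all coordinates vanish. Otherwise the
  derivatives in \<open>u\<close> and \<open>v\<close> give \<open>u^d = v^d\<close> with
  \<open>d = 2 m\<close>. Together with the equation this forces \<open>s q'(s) = 0\<close>, and
  \<open>(u^d)^2 = (u v)^d\<close> turns the equation into \<open>q(s) = \<plusminus>A\<close>,
  against \<open>regular_value\<close>.\<close>

lemma rosette_nonsingular: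
  assumes nz: "(u, v, z) \<noteq> (0, 0, 0)" and on: "rosette m a A u v z = 0"
    and sing: "\<And>u' v' z'. rosette_diff m a A u v z u' v' z' = 0"
  shows False
proof -
  have m0: "of_nat m \<noteq> (0::complex)" using m by simp
  have AC: "of_real A \<noteq> (0::complex)" using A by simp
  have u0: "u = 0 \<or> v \<noteq> 0" using sing[of 1 0 0] m A by (auto simp: rosette_diff_def)
  have v0: "v = 0 \<or> u \<noteq> 0" using sing[of 0 1 0] m A by (auto simp: rosette_diff_def)
  have uv: "u * v \<noteq> 0"
  proof
    assume "u * v = 0"
    hence "u = 0" "v = 0" using u0 v0 by auto
    thus False using on nz m by (auto simp: rosette_def zero_power)
  qed
  define s where "s = z\<^sup>2 / (u * v)"
  define q where "q = poly (qpoly m aa) s"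
  define D where "D = poly (eulerq m aa) s"
  define w where "w = (u * v) ^ m"
  have w0: "w \<noteq> 0" using uv by (simp add: w_def)
  have 1: "w * (of_nat m * q - D) = of_real A * of_nat m * u ^ (2 * m)"
    using rosette_diff_quotient(1)[OF uv, of z 1] sing[of u 0 0] by (simp add: s_def q_def D_def w_def)
  have 2: "w * (of_nat m * q - D) = of_real A * of_nat m * v ^ (2 * m)"
    using rosette_diff_quotient(2)[OF uv, of z 1] sing[of 0 v 0] by (simp add: s_def q_def D_def w_def)
  have eq: "u ^ (2 * m) = v ^ (2 * m)" using 1 2 AC m0 by simp
  have 3: "w * q = of_real A * u ^ (2 * m)"
    using on rosette_quotient[OF uv, of z] eq by (simp add: rosette_def s_def q_def w_def)
  have "w * (of_nat m * q - D) = w * (of_nat m * q)" using 1 3 by (simp add: mult_ac)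
  hence "D = 0" using w0 by simp
  hence crit: "poly (pderiv (qpoly m aa)) s = 0 \<or> s = 0" by (auto simp: D_def eulerq_def)
  have "(u ^ (2 * m)) ^ 2 = w ^ 2"
  proof -
    have "(u ^ (2 * m)) ^ 2 = u ^ (2 * m) * v ^ (2 * m)" using eq by (simp add: power2_eq_square)
    thus ?thesis by (simp add: w_def power_mult_distrib flip: power_mult) (simp add: mult.commute)
  qed
  hence "u ^ (2 * m) = w \<or> u ^ (2 * m) = - w" by (simp add: power2_eq_iff)
  hence "w * q = w * of_real A \<or> w * q = w * (- of_real A)" using 3 by (auto simp: mult_ac)
  hence "q = of_real A \<or> q = - of_real A" using w0 by (metis mult_left_cancel)
  thus False using regular_value[OF crit] by (simp add: q_def)
qed

lemma gradient_ne_0: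
  assumes "(x, y, z) \<noteq> (0, 0, 0)" "hp_eval (2 * m) c x y z = 0"
  shows "(hp_dx (2 * m) c x y z, hp_dy (2 * m) c x y z, hp_dz (2 * m) c x y z) \<noteq> (0, 0, 0)"
proof
  assume g: "(hp_dx (2 * m) c x y z, hp_dy (2 * m) c x y z, hp_dz (2 * m) c x y z) = (0, 0, 0)"
  have "rosette_diff m a A (x + \<i> * y) (x - \<i> * y) z u' v' z' = 0" for u' v' z'
    using eval_diff[of x y z "(u' + v') / 2" "(u' - v') / (2 * \<i>)" z'] g unfolding uv_x by simp
  moreover have "(x + \<i> * y, x - \<i> * y, z) \<noteq> (0, 0, 0)"
    using assms(1) by (auto simp: eq_iff_diff_eq_0[symmetric])
  ultimately show False using rosette_nonsingular[of "x + \<i> * y" "x - \<i> * y" z] assms(2) eval by simp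
qed

lemma nonsingular: "nonsingular_curve (2 * m) c"
  unfolding nonsingular_curve_def
proof (intro conjI allI impI)
  show "\<exists>i j. i + j \<le> 2 * m \<and> c i j \<noteq> 0"
  proof (rule ccontr)
    assume "\<not> (\<exists>i j. i + j \<le> 2 * m \<and> c i j \<noteq> 0)"
    hence "hp_eval (2 * m) c 0 0 (1::complex) = 0"
      unfolding hp_eval_def by (intro sum.neutral ballI) auto
    thus False unfolding eval using m by (simp add: rosette_def power_0_left)
  qed
qed (use gradient_ne_0 in blast)

text \<open>The \<open>k\<close> of \<open>linepoly\<close> for a point of the curve; exchanging
  \<open>u\<close> and \<open>v\<close> changes its sign.\<close>

definition slope :: "complex \<Rightarrow> complex \<Rightarrow> complex" where
  "slope u v = of_nat m * (of_real A / 2) * (u ^ (2 * m) - v ^ (2 * m)) / (u * v) ^ m"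

text \<open>The equation of the curve gives the sum of \<open>A u^d\<close> and
  \<open>A v^d\<close>, the definition of \<open>slope\<close> gives their difference, where
  \<open>d = 2 m\<close>. The third claim comes from
  \<open>(U - V)^2 = (U + V)^2 - 4 U V\<close>.\<close>

lemma on_curve:
  assumes uv: "u * v \<noteq> 0" and on: "rosette m a A u v z = 0"
  defines "s \<equiv> z\<^sup>2 / (u * v)"
  shows "of_real A * u ^ (2 * m) = (u * v) ^ m * (poly (qpoly m aa) s + slope u v / of_nat m)"
    and "of_real A * v ^ (2 * m) = (u * v) ^ m * (poly (qpoly m aa) s - slope u v / of_nat m)"
    and "(slope u v)\<^sup>2 = poly (kappa2 m aa (of_real A)) s"
proof -
  define w where "w = (u * v) ^ m"
  define U where "U = u ^ (2 * m)"
  define V where "V = v ^ (2 * m)"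
  define q where "q = poly (qpoly m aa) s"
  have w0: "w \<noteq> 0" using uv by (simp add: w_def)
  have m0: "of_nat m \<noteq> (0::complex)" using m by simp
  have ww: "w\<^sup>2 = U * V" by (simp add: w_def U_def V_def power_mult_distrib power_mult power_commutes flip: power_mult) (simp add: mult.commute)
  have q: "w * q = of_real A / 2 * (U + V)"
    using on rosette_quotient[OF uv, of z] by (simp add: rosette_def s_def q_def w_def U_def V_def)
  have k: "slope u v = of_nat m * (of_real A / 2) * (U - V) / w" by (simp add: slope_def w_def U_def V_def)
  show "of_real A * u ^ (2 * m) = (u * v) ^ m * (poly (qpoly m aa) s + slope u v / of_nat m)"
    unfolding w_def[symmetric] q_def[symmetric] U_def[symmetric] distrib_left q k using w0 m0 by (simp add: field_simps)
  show "of_real A * v ^ (2 * m) = (u * v) ^ m * (poly (qpoly m aa) s - slope u v / of_nat m)"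
    unfolding w_def[symmetric] q_def[symmetric] V_def[symmetric] right_diff_distrib q k using w0 m0 by (simp add: field_simps)
  have q': "q = of_real A / 2 * (U + V) / w" using q w0 by (simp add: field_simps)
  have "(slope u v)\<^sup>2 = (of_nat m)\<^sup>2 * (of_real A)\<^sup>2 * (U - V)\<^sup>2 / (4 * w\<^sup>2)"
    unfolding k by (simp add: power_divide power_mult_distrib)
  also have "(U - V)\<^sup>2 = (U + V)\<^sup>2 - 4 * w\<^sup>2" unfolding ww by (simp add: power2_eq_square algebra_simps)
  also have "(of_nat m)\<^sup>2 * (of_real A)\<^sup>2 * ((U + V)\<^sup>2 - 4 * w\<^sup>2) / (4 * w\<^sup>2) = (of_nat m)\<^sup>2 * (q\<^sup>2 - (of_real A)\<^sup>2)"
  proof -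
    have "q\<^sup>2 = (of_real A)\<^sup>2 * (U + V)\<^sup>2 / (4 * w\<^sup>2)"
      unfolding q' by (simp add: power_divide power_mult_distrib)
    thus ?thesis using w0 by (simp add: field_simps)
  qed
  finally show "(slope u v)\<^sup>2 = poly (kappa2 m aa (of_real A)) s" by (simp add: kappa2_def q_def)
qed

text \<open>Replacing \<open>A u^d\<close> and \<open>A v^d\<close> by means of
  \<open>on_curve\<close> removes \<open>A\<close>, \<open>u\<close> and \<open>v\<close> from the
  restricted equation, up to the factor \<open>(u v)^m\<close>.\<close>

lemma rosette_on_line:
  assumes uv: "u * v \<noteq> 0" and on: "rosette m a A u v z = 0"
  defines "s \<equiv> z\<^sup>2 / (u * v)" and "k \<equiv> slope u v"
  defines "D \<equiv> poly (eulerq m aa) s"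
  shows "rosette m a A (u * (1 + (D - k) * t)) (v * (1 - (D + k) * t)) z = (u * v) ^ m * poly (linepoly m aa s k) t"
proof -
  define q where "q = poly (qpoly m aa) s"
  define x where "x = 1 + (D - k) * t"
  define y where "y = 1 - (D + k) * t"
  have "z\<^sup>2 - of_real (a i) * (u * x * (v * y)) = (u * v) * (s - of_real (a i) * (x * y))" for i
    using uv by (simp add: s_def field_simps)
  hence 1: "(\<Prod>i<m. z\<^sup>2 - of_real (a i) * (u * x * (v * y))) = (u * v) ^ m * (\<Prod>i<m. s - of_real (a i) * (x * y))"
    by (simp only: prod.distrib prod_constant card_lessThan power_mult_distrib)
  have 2: "of_real A / 2 * ((u * x) ^ (2 * m) + (v * y) ^ (2 * m)) =
      (u * v) ^ m * ((q + k / of_nat m) / 2 * x ^ (2 * m) + (q - k / of_nat m) / 2 * y ^ (2 * m))"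
  proof -
    have "of_real A / 2 * ((u * x) ^ (2 * m) + (v * y) ^ (2 * m)) =
       (of_real A * u ^ (2 * m)) * x ^ (2 * m) / 2 + (of_real A * v ^ (2 * m)) * y ^ (2 * m) / 2"
      by (simp add: power_mult_distrib field_simps)
    thus ?thesis unfolding on_curve(1,2)[OF uv on] s_def[symmetric] q_def[symmetric] k_def[symmetric]
      by (simp add: algebra_simps)
  qed
  have 3: "poly [:s - of_real (a i), 2 * of_real (a i) * k, of_real (a i) * (D\<^sup>2 - k\<^sup>2):] t = s - of_real (a i) * (x * y)" for i
    by (simp add: x_def y_def algebra_simps power2_eq_square)
  have 4: "poly [:1, D - k:] t = x" "poly [:1, - D - k:] t = y"
    by (simp_all add: x_def y_def algebra_simps)
  have "poly (linepoly m aa s k) t = (\<Prod>i<m. s - of_real (a i) * (x * y)) -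
     ((q + k / of_nat m) / 2 * x ^ (2 * m) + (q - k / of_nat m) / 2 * y ^ (2 * m))"
    unfolding linepoly_def Let_def D_def[symmetric] q_def[symmetric]
    by (simp only: poly_diff poly_add poly_smult poly_power poly_prod 3 4)
  thus ?thesis unfolding x_def[symmetric] y_def[symmetric] rosette_def 1 2 by (simp only: right_diff_distrib)
qed

text \<open>Here \<open>eulerq\<close> vanishes at \<open>s\<close> if the tangent line passes through the centre \<open>u = v = 0\<close>.\<close>

lemma tangent_pair:
  assumes uv: "u * v \<noteq> 0" and on: "rosette m a A u v 1 = 0" and on': "rosette m a A u' v' 1 = 0"
    and ne: "(u, v) \<noteq> (u', v')"
    and t: "rosette_diff m a A u v 1 (u' - u) (v' - v) 0 = 0"
    and t': "rosette_diff m a A u' v' 1 (u' - u) (v' - v) 0 = 0"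
  defines "s \<equiv> 1 / (u * v)"
  shows "poly (eulerq m aa) s = 0 \<or> line_disc m aa s (slope u v) = 0"
proof (rule disjCI)
  define D where "D = poly (eulerq m aa) s"
  define k where "k = slope u v"
  define q where "q = poly (qpoly m aa) s"
  define w where "w = (u * v) ^ m"
  have m0: "of_nat m \<noteq> (0::complex)" using m by simp
  have w0: "w \<noteq> 0" using uv by (simp add: w_def)
  have s: "s = 1\<^sup>2 / (u * v)" by (simp add: s_def)
  assume "line_disc m aa s (slope u v) \<noteq> 0"
  hence L: "line_disc m aa s k \<noteq> 0" by (simp add: k_def)
  show "poly (eulerq m aa) s = 0"
  proof (rule ccontr)
    assume "poly (eulerq m aa) s \<noteq> 0"
    hence D0: "D \<noteq> 0" by (simp add: D_def)
    define b where "b = (u' - u) / u"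
    define b' where "b' = (v' - v) / v"
    have u': "u' = u * (1 + b)" "v' = v * (1 + b')" "u' - u = u * b" "v' - v = v * b'"
      using uv by (simp_all add: b_def b'_def field_simps)
    have "rosette_diff m a A u v 1 (u' - u) (v' - v) 0 = rosette_diff m a A u v 1 (u * b) 0 0 + rosette_diff m a A u v 1 0 (v * b') 0"
      using rosette_diff_add[of m a A u v 1 "u * b" 0 0 "v * b'" 0 0] by (simp add: u'(3,4))
    also have "\<dots> = w * (b' * (k - D) - b * (D + k))"
      unfolding rosette_diff_quotient[OF uv] s[symmetric] D_def[symmetric] q_def[symmetric] w_def[symmetric]
        mult.assoc[of "of_real A"] mult.left_commute[of "of_real A"] on_curve(1,2)[OF uv on]
        k_def[symmetric]
      using m0 by (simp add: field_simps)
    finally have rel: "b * (D + k) = b' * (k - D)" using t w0 by simp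
    \<comment> \<open>In coordinates scaled by \<open>u\<close> and \<open>v\<close> the tangent
      direction is \<open>(D - k, - (D + k))\<close>. As \<open>D \<noteq> 0\<close>, not both
      entries vanish; if the first one does, \<open>\<tau>\<close> is read off from the
      second.\<close>
    obtain \<tau> where \<tau>: "b = (D - k) * \<tau>" "b' = - (D + k) * \<tau>"
    proof (cases "D - k = 0")
      case True
      hence "b = 0" using rel D0 by auto
      with True D0 that[of "- b' / (D + k)"] show ?thesis by (simp add: field_simps)
    next
      case False
      with rel that[of "b / (D - k)"] show ?thesis by (simp add: field_simps)
    qed
    have \<tau>0: "\<tau> \<noteq> 0" using \<tau> ne u' by auto
    have pt: "u' = u * (1 + (D - k) * \<tau>)" "v' = v * (1 - (D + k) * \<tau>)"
      unfolding u'(1,2) \<tau> by (simp_all add: algebra_simps)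
    have dir: "u' - u = \<tau> * (u * (D - k))" "v' - v = \<tau> * (- v * (D + k))"
      unfolding u'(3,4) \<tau> by (simp_all add: algebra_simps)
    have pt': "u + \<tau> * (u * (D - k)) = u'" "v + \<tau> * (- v * (D + k)) = v'"
      unfolding pt by (simp_all add: algebra_simps)
    note line = rosette_on_line[OF uv on, folded s, folded D_def k_def, folded w_def]
    have "poly (linepoly m aa s k) \<tau> = 0"
      using line[of \<tau>] on' w0 by (simp add: pt)
    moreover have "poly (pderiv (linepoly m aa s k)) \<tau> = 0"
    proof -
      have "((\<lambda>t. rosette m a A (u + t * (u * (D - k))) (v + t * (- v * (D + k))) (1 + t * 0)) has_field_derivative
        rosette_diff m a A (u + \<tau> * (u * (D - k))) (v + \<tau> * (- v * (D + k))) (1 + \<tau> * 0) (u * (D - k)) (- v * (D + k)) 0) (at \<tau>)"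
        by (rule rosette_directional)
      moreover have "rosette m a A (u + t * (u * (D - k))) (v + t * (- v * (D + k))) (1 + t * 0) = w * poly (linepoly m aa s k) t" for t
        unfolding line[symmetric] by (simp add: algebra_simps)
      moreover have "((\<lambda>t. w * poly (linepoly m aa s k) t) has_field_derivative w * poly (pderiv (linepoly m aa s k)) \<tau>) (at \<tau>)"
        by (intro DERIV_cmult poly_DERIV)
      ultimately have "w * poly (pderiv (linepoly m aa s k)) \<tau> =
         rosette_diff m a A u' v' 1 (u * (D - k)) (- v * (D + k)) 0"
        using DERIV_unique unfolding pt' by simp
      moreover have "\<tau> * rosette_diff m a A u' v' 1 (u * (D - k)) (- v * (D + k)) 0 = 0"
        using t' rosette_diff_linear[of m a A u' v' 1 \<tau> "u * (D - k)" "- v * (D + k)" 0]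
        unfolding dir by simp
      ultimately show ?thesis using w0 \<tau>0 by simp
    qed
    ultimately have "line_disc m aa s k = 0" using line_disc_eq_0[OF m \<tau>0] by blast
    thus False using L by simp
  qed
qed

end

section \<open>An upper bound for the number of real bitangents\<close>

text \<open>A linear form that vanishes on the kernel of another one is a multiple of it, so both
  real normals are proportional to the complex gradient. Their ratio is real, being a quotient of
  real coordinates.\<close>

lemma proportional_normals:
  fixes g1 g2 g3 :: complex and a b e a' b' e' :: real
  assumes l: "(a, b, e) \<noteq> (0, 0, 0)" and l': "(a', b', e') \<noteq> (0, 0, 0)" and g: "(g1, g2, g3) \<noteq> (0, 0, 0)"
    and k: "\<And>u v w. of_real a * u + of_real b * v + of_real e * w = 0 \<Longrightarrow> g1 * u + g2 * v + g3 * w = 0"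
    and k': "\<And>u v w. of_real a' * u + of_real b' * v + of_real e' * w = 0 \<Longrightarrow> g1 * u + g2 * v + g3 * w = 0"
  obtains r where "r \<noteq> 0" "a = r * a'" "b = r * b'" "e = r * e'"
proof -
  have *: "\<exists>\<kappa>. \<kappa> \<noteq> 0 \<and> g1 = \<kappa> * of_real x \<and> g2 = \<kappa> * of_real y \<and> g3 = \<kappa> * of_real z"
    if n: "(x, y, z) \<noteq> (0, 0, 0)"
      and n': "\<And>u v w. of_real x * u + of_real y * v + of_real z * w = 0 \<Longrightarrow> g1 * u + g2 * v + g3 * w = 0"
    for x y z :: real
  proof -
    have e: "g1 * of_real y = g2 * of_real x" "g1 * of_real z = g3 * of_real x" "g2 * of_real z = g3 * of_real y"
      using n'[of "of_real y" "- of_real x" 0] n'[of "of_real z" 0 "- of_real x"] n'[of 0 "of_real z" "- of_real y"]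
      by (simp_all add: algebra_simps)
    consider "x \<noteq> 0" | "y \<noteq> 0" | "z \<noteq> 0" using n by auto
    hence "\<exists>\<kappa>. g1 = \<kappa> * of_real x \<and> g2 = \<kappa> * of_real y \<and> g3 = \<kappa> * of_real z"
    proof cases
      case 1
      with e show ?thesis by (intro exI[of _ "g1 / of_real x"]) (simp add: field_simps)
    next
      case 2
      with e show ?thesis by (intro exI[of _ "g2 / of_real y"]) (simp add: field_simps)
    next
      case 3
      with e show ?thesis by (intro exI[of _ "g3 / of_real z"]) (simp add: field_simps)
    qed
    then obtain \<kappa> where "g1 = \<kappa> * of_real x" "g2 = \<kappa> * of_real y" "g3 = \<kappa> * of_real z" by blast
    moreover from this g have "\<kappa> \<noteq> 0" by auto
    ultimately show ?thesis by blast
  qed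
  have "\<exists>\<kappa>. \<kappa> \<noteq> 0 \<and> g1 = \<kappa> * of_real a \<and> g2 = \<kappa> * of_real b \<and> g3 = \<kappa> * of_real e"
    by (rule *[OF l]) (erule k)
  then obtain \<kappa> where \<kappa>: "\<kappa> \<noteq> 0" "g1 = \<kappa> * of_real a" "g2 = \<kappa> * of_real b" "g3 = \<kappa> * of_real e"
    by (elim exE conjE)
  have "\<exists>\<kappa>. \<kappa> \<noteq> 0 \<and> g1 = \<kappa> * of_real a' \<and> g2 = \<kappa> * of_real b' \<and> g3 = \<kappa> * of_real e'"
    by (rule *[OF l']) (erule k')
  then obtain \<mu> where \<mu>: "\<mu> \<noteq> 0" "g1 = \<mu> * of_real a'" "g2 = \<mu> * of_real b'" "g3 = \<mu> * of_real e'"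
    by (elim exE conjE)
  have eq: "of_real x = (\<mu> / \<kappa>) * of_real x'" if "\<kappa> * of_real x = \<mu> * of_real x'" for x x' :: real
    using that \<kappa>(1) by (simp add: field_simps)
  have eqs: "of_real a = (\<mu> / \<kappa>) * of_real a'" "of_real b = (\<mu> / \<kappa>) * of_real b'" "of_real e = (\<mu> / \<kappa>) * of_real e'"
    by (rule eq, use \<kappa> \<mu> in simp)+
  have "\<exists>r. \<mu> / \<kappa> = complex_of_real r"
  proof -
    have q: "\<exists>r. \<mu> / \<kappa> = complex_of_real r" if "of_real x = (\<mu> / \<kappa>) * of_real x'" "x' \<noteq> 0" for x x' :: real
      using that by (intro exI[of _ "x / x'"]) simp
    consider "a' \<noteq> 0" | "b' \<noteq> 0" | "e' \<noteq> 0" using l' by auto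
    thus ?thesis by cases (rule q[OF eqs(1)] q[OF eqs(2)] q[OF eqs(3)]; assumption)+
  qed
  then obtain r where r: "\<mu> / \<kappa> = complex_of_real r" by blast
  have "r \<noteq> 0" using r \<kappa>(1) \<mu>(1) by auto
  moreover have "a = r * a'" "b = r * b'" "e = r * e'"
    using eqs unfolding r of_real_mult[symmetric] of_real_eq_iff by simp_all
  ultimately show ?thesis by (rule that)
qed

lemma card_poly_zeros_le:
  fixes p :: "complex poly"
  assumes "p \<noteq> 0" "degree p \<le> n"
  shows "finite {x. poly p x = 0} \<and> card {x. poly p x = 0} \<le> n"
  using card_poly_roots_bound[OF assms(1)] poly_roots_finite[OF assms(1)] assms(2) by simp

context rosette_curve
begin

lemma tangent_at_iff:
  "tangent_at (2 * m) c (l1, l2, l3) (cartesian (u, v, z)) \<longleftrightarrow>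
     (u, v, z) \<noteq> (0, 0, 0) \<and> rosette m a A u v z = 0 \<and>
     of_real l1 * ((u + v) / 2) + of_real l2 * ((u - v) / (2 * \<i>)) + of_real l3 * z = 0 \<and>
     (\<forall>u' v' z'. of_real l1 * ((u' + v') / 2) + of_real l2 * ((u' - v') / (2 * \<i>)) + of_real l3 * z' = 0 \<longrightarrow>
        rosette_diff m a A u v z u' v' z' = 0)"
proof -
  have nz: "((u + v) / 2, (u - v) / (2 * \<i>), z) \<noteq> (0, 0, 0) \<longleftrightarrow> (u, v, z) \<noteq> (0, 0, 0)"
    using uv_x[of u v] by (auto simp: eq_neg_iff_add_eq_0)
  have all: "(\<forall>x y z. P x y z) \<longleftrightarrow> (\<forall>u' v' z'. P ((u' + v') / 2) ((u' - v') / (2 * \<i>)) z')"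
    for P :: "complex \<Rightarrow> complex \<Rightarrow> complex \<Rightarrow> bool"
  proof safe
    fix x y z assume "\<forall>u' v' z'. P ((u' + v') / 2) ((u' - v') / (2 * \<i>)) z'"
    hence "P (((x + \<i> * y) + (x - \<i> * y)) / 2) (((x + \<i> * y) - (x - \<i> * y)) / (2 * \<i>)) z" by blast
    thus "P x y z" by simp
  qed auto
  show ?thesis
    unfolding tangent_at_def cartesian_def prod.case nz eval uv_x eval_diff
    by (subst all) (simp only: uv_x)
qed

lemma tangent_at_unique:
  assumes "tangent_at (2 * m) c l p" "tangent_at (2 * m) c l' p" "l \<noteq> (0, 0, 0)" "l' \<noteq> (0, 0, 0)"
  shows "{t *\<^sub>R l | t. t \<noteq> 0} = {t *\<^sub>R l' | t. t \<noteq> 0}"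
proof -
  obtain a b e where l: "l = (a, b, e)" by (cases l)
  obtain a' b' e' where l': "l' = (a', b', e')" by (cases l')
  obtain x y z where p: "p = (x, y, z)" by (cases p)
  have g: "(hp_dx (2 * m) c x y z, hp_dy (2 * m) c x y z, hp_dz (2 * m) c x y z) \<noteq> (0, 0, 0)"
    using assms(1) unfolding tangent_at_def l p by (intro gradient_ne_0) auto
  obtain r where r: "r \<noteq> 0" "a = r * a'" "b = r * b'" "e = r * e'"
    using proportional_normals[of a b e a' b' e' "hp_dx (2 * m) c x y z" "hp_dy (2 * m) c x y z" "hp_dz (2 * m) c x y z"]
      assms g unfolding tangent_at_def l l' p by auto
  have ll: "l = r *\<^sub>R l'" "l' = (1 / r) *\<^sub>R l" using r(1) by (simp_all add: l l' r)
  have sub: "{t *\<^sub>R n | t. t \<noteq> 0} \<subseteq> {t *\<^sub>R n' | t. t \<noteq> 0}"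
    if "n = \<rho> *\<^sub>R n'" "\<rho> \<noteq> 0" for n n' :: "real \<times> real \<times> real" and \<rho>
  proof
    fix x assume "x \<in> {t *\<^sub>R n | t. t \<noteq> 0}"
    then obtain t where "x = t *\<^sub>R n" "t \<noteq> 0" by blast
    hence "x = (t * \<rho>) *\<^sub>R n'" "t * \<rho> \<noteq> 0" using that by simp_all
    thus "x \<in> {t *\<^sub>R n' | t. t \<noteq> 0}" by blast
  qed
  show ?thesis using sub[OF ll(1)] sub[OF ll(2)] r(1) by (intro equalityI) simp_all
qed

text \<open>The points outside the scope of \<open>tangent_pair\<close>, that is with
  \<open>z = 0\<close> or \<open>u v = 0\<close>, scaled to a normal form. There are O(m) of them
  and each carries at most one tangent line, which is far below the leading term.\<close>

definition special_points :: "(complex \<times> complex \<times> complex) set" where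
  "special_points = {(u, 1, 0) | u. rosette m a A u 1 0 = 0} \<union>
     ({(u, 0, 1) | u. rosette m a A u 0 1 = 0} \<union> {(0, v, 1) | v. rosette m a A 0 v 1 = 0})"

definition affine_points :: "(complex \<times> complex \<times> complex) set" where
  "affine_points = {(u, v, 1) | u v. u * v \<noteq> 0 \<and> rosette m a A u v 1 = 0}"

lemma card_special_points: "finite special_points \<and> card special_points \<le> 6 * m"
proof -
  have AC: "of_real A / 2 \<noteq> (0::complex)" using A by simp
  define p where "p = monom (\<Prod>i<m. - of_real (a i)) m - monom (of_real A / 2) (2 * m) - [:of_real A / 2 :: complex:]"
  have "coeff p (2 * m) \<noteq> 0" using AC m by (auto simp: p_def coeff_pCons split: nat.splits)
  hence "p \<noteq> 0" by auto
  moreover have "degree p \<le> 2 * m"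
    unfolding p_def by (intro degree_diff_le) (auto intro: order_trans[OF degree_monom_le])
  ultimately have P: "finite {u. poly p u = 0}" "card {u. poly p u = 0} \<le> 2 * m"
    using card_poly_zeros_le by blast+
  have pp: "rosette m a A u 1 0 = poly p u" for u
  proof -
    have "0\<^sup>2 - of_real (a i) * (u * 1) = (- of_real (a i)) * u" for i by simp
    hence "(\<Prod>i<m. 0\<^sup>2 - of_real (a i) * (u * 1)) = (\<Prod>i<m. - of_real (a i)) * u ^ m"
      by (simp only: prod.distrib prod_constant card_lessThan)
    thus ?thesis by (simp add: rosette_def p_def poly_monom algebra_simps)
  qed
  define r where "r = 1 - monom (of_real A / 2 :: complex) (2 * m)"
  have "coeff r (2 * m) \<noteq> 0" using AC m by (auto simp: r_def)
  hence "r \<noteq> 0" by auto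
  moreover have "degree r \<le> 2 * m"
    unfolding r_def by (intro degree_diff_le) (auto intro: order_trans[OF degree_monom_le])
  ultimately have R: "finite {u. poly r u = 0}" "card {u. poly r u = 0} \<le> 2 * m"
    using card_poly_zeros_le by blast+
  have rr: "rosette m a A u 0 1 = poly r u" "rosette m a A 0 u 1 = poly r u" for u
    using m by (simp_all add: rosette_def r_def poly_monom power_0_left)
  have e: "{(u, 1, 0) | u. rosette m a A u 1 0 = 0} = (\<lambda>u. (u, 1, 0)) ` {u. poly p u = 0}"
     "{(u, 0, 1) | u. rosette m a A u 0 1 = 0} = (\<lambda>u. (u, 0, 1)) ` {u. poly r u = 0}"
     "{(0, u, 1) | u. rosette m a A 0 u 1 = 0} = (\<lambda>u. (0, u, 1)) ` {u. poly r u = 0}"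
    by (auto simp: pp rr)
  have "card special_points \<le> 2 * m + (2 * m + 2 * m)"
    unfolding special_points_def e
    using card_image_le[OF P(1), of "\<lambda>u. (u, 1 :: complex, 0 :: complex)"]
      card_image_le[OF R(1), of "\<lambda>u. (u, 0 :: complex, 1 :: complex)"]
      card_image_le[OF R(1), of "\<lambda>u. (0 :: complex, u, 1 :: complex)"] P(2) R(2)
    by (intro order_trans[OF card_Un_le] add_mono) auto
  thus ?thesis using P(1) R(1) unfolding special_points_def e by simp
qed

lemma tangency_normalise:
  assumes "tangent_at (2 * m) c l p"
  obtains w t where "t \<noteq> 0" "p = (t * fst (cartesian w), t * fst (snd (cartesian w)), t * snd (snd (cartesian w)))"
    "tangent_at (2 * m) c l (cartesian w)" "w \<in> special_points \<or> w \<in> affine_points"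
proof -
  obtain l1 l2 l3 where l: "l = (l1, l2, l3)" by (cases l)
  obtain x y z where p: "p = (x, y, z)" by (cases p)
  define u where "u = x + \<i> * y"
  define v where "v = x - \<i> * y"
  have pc: "p = cartesian (u, v, z)" by (simp add: p cartesian_def u_def v_def)
  note T = assms[unfolded l pc tangent_at_iff]
  have scaled: "tangent_at (2 * m) c l (cartesian (u / t, v / t, z / t))" if t: "t \<noteq> 0" for t
  proof -
    have t': "1 / t \<noteq> 0" using t by simp
    have "rosette m a A (u / t) (v / t) (z / t) = 0"
      using rosette_scale[of m a A "1 / t" u v z] T by simp
    moreover have "of_real l1 * ((u / t + v / t) / 2) + of_real l2 * ((u / t - v / t) / (2 * \<i>)) + of_real l3 * (z / t) = 0"
    proof -
      have "of_real l1 * ((u / t + v / t) / 2) + of_real l2 * ((u / t - v / t) / (2 * \<i>)) + of_real l3 * (z / t) =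
        (of_real l1 * ((u + v) / 2) + of_real l2 * ((u - v) / (2 * \<i>)) + of_real l3 * z) / t"
        by (simp add: add_divide_distrib diff_divide_distrib algebra_simps)
      thus ?thesis using T by simp
    qed
    moreover have "rosette_diff m a A (u / t) (v / t) (z / t) u' v' z' = 0"
      if "rosette_diff m a A u v z u' v' z' = 0" for u' v' z'
      using rosette_diff_scale[OF t', of m a A u v z u' v' z'] that t by simp
    ultimately show ?thesis unfolding l tangent_at_iff using T t by auto
  qed
  have pe: "p = (t * fst (cartesian (u / t, v / t, z / t)), t * fst (snd (cartesian (u / t, v / t, z / t))),
       t * snd (snd (cartesian (u / t, v / t, z / t))))" if "t \<noteq> 0" for t
    unfolding pc using that by (simp add: cartesian_def field_simps)
  show ?thesis
  proof (cases "z = 0")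
    case False
    have "rosette m a A (u / z) (v / z) 1 = 0"
      using rosette_scale[of m a A "1 / z" u v z] T False by simp
    hence "(u / z, v / z, z / z) \<in> special_points \<or> (u / z, v / z, z / z) \<in> affine_points"
      using False by (auto simp: special_points_def affine_points_def)
    with False that[OF False pe scaled] show ?thesis by blast
  next
    case True
    have "v \<noteq> 0"
    proof
      assume "v = 0"
      with T True have "of_real A * u ^ (2 * m) = 0" using m by (auto simp: rosette_def power_0_left)
      with A have "u = 0" by simp
      with T True \<open>v = 0\<close> show False by simp
    qed
    have "rosette m a A (u / v) 1 0 = 0"
      using rosette_scale[of m a A "1 / v" u v z] T True \<open>v \<noteq> 0\<close> by simp
    hence "(u / v, v / v, z / v) \<in> special_points"
      using True \<open>v \<noteq> 0\<close> by (auto simp: special_points_def)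
    with that[OF \<open>v \<noteq> 0\<close> pe scaled] \<open>v \<noteq> 0\<close> show ?thesis by blast
  qed
qed

definition points_over_zeros :: "complex poly \<Rightarrow> (complex \<times> complex \<times> complex) set" where
  "points_over_zeros G = {(u, v, 1) | u v. u * v \<noteq> 0 \<and> rosette m a A u v 1 = 0 \<and> poly G (1 / (u * v)) = 0}"

text \<open>Over a fixed \<open>s\<close> one has \<open>v = 1 / (s u)\<close>, and the equation
  becomes quadratic in \<open>u ^ (2 * m)\<close>; so there are at most \<open>4 m\<close> values of
  \<open>u\<close>.\<close>

lemma card_points_over_zeros:
  assumes "G \<noteq> 0"
  shows "finite (points_over_zeros G) \<and> card (points_over_zeros G) \<le> degree G * (4 * m)"
proof -
  define Z where "Z = {s. poly G s = 0}"
  have Z: "finite Z" "card Z \<le> degree G" using card_poly_zeros_le[OF assms order_refl] by (auto simp: Z_def)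
  \<comment> \<open>The zero set may contain \<open>s = 0\<close>, where division by 0 gives 0; the
    leading coefficient \<open>A / 2\<close> is the same there, so the bound for the number of roots
    covers this case.\<close>
  define H where "H s = monom (of_real A / 2) (4 * m) - monom (poly (qpoly m aa) s / s ^ m) (2 * m)
     + [:of_real A / 2 / s ^ (2 * m) :: complex:]" for s
  have H: "finite {u. poly (H s) u = 0}" "card {u. poly (H s) u = 0} \<le> 4 * m" for s
  proof -
    have "coeff (H s) (4 * m) \<noteq> 0" using A m by (auto simp: H_def coeff_pCons split: nat.splits)
    hence "H s \<noteq> 0" by auto
    moreover have "degree (H s) \<le> 4 * m"
      unfolding H_def by (intro degree_diff_le degree_add_le) (auto intro: order_trans[OF degree_monom_le])
    ultimately show "finite {u. poly (H s) u = 0}" "card {u. poly (H s) u = 0} \<le> 4 * m"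
      using card_poly_zeros_le by blast+
  qed
  have sub: "points_over_zeros G \<subseteq> (\<Union>s\<in>Z. (\<lambda>u. (u, 1 / (s * u), 1)) ` {u. poly (H s) u = 0})"
    unfolding points_over_zeros_def
  proof clarify
    fix u v :: complex assume uv: "u * v \<noteq> 0" and on: "rosette m a A u v 1 = 0" and G: "poly G (1 / (u * v)) = 0"
    define s where "s = 1 / (u * v)"
    have s: "s \<noteq> 0" "u * v = 1 / s" "v = 1 / (s * u)" using uv by (auto simp: s_def)
    have "poly (qpoly m aa) s / s ^ m = of_real A / 2 * (u ^ (2 * m) + v ^ (2 * m))"
    proof -
      have "(u * v) ^ m * poly (qpoly m aa) s = of_real A / 2 * (u ^ (2 * m) + v ^ (2 * m))"
        using on rosette_quotient[OF uv, of 1] by (simp add: rosette_def s_def)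
      moreover have "poly (qpoly m aa) s / s ^ m = (u * v) ^ m * poly (qpoly m aa) s"
        by (simp add: s_def power_divide)
      ultimately show ?thesis by (simp only:)
    qed
    moreover have "poly (H s) u = of_real A / 2 * u ^ (4 * m) - poly (qpoly m aa) s / s ^ m * u ^ (2 * m) + of_real A / 2 / s ^ (2 * m)"
      by (simp add: H_def poly_monom)
    ultimately have "poly (H s) u = of_real A / 2 * u ^ (4 * m) - of_real A / 2 * (u ^ (2 * m) + v ^ (2 * m)) * u ^ (2 * m) + of_real A / 2 / s ^ (2 * m)"
      by (simp only:)
    also have "u ^ (4 * m) = u ^ (2 * m) * u ^ (2 * m)" by (simp flip: power_add)
    also have "of_real A / 2 / s ^ (2 * m) = of_real A / 2 * (u * v) ^ (2 * m)" unfolding s(2) by (simp add: power_divide)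
    finally have "poly (H s) u = 0" by (simp add: power_mult_distrib algebra_simps)
    moreover have "s \<in> Z" using G by (simp add: Z_def s_def)
    ultimately show "(u, v, 1) \<in> (\<Union>s\<in>Z. (\<lambda>u. (u, 1 / (s * u), 1)) ` {u. poly (H s) u = 0})"
      using s(3) by auto
  qed
  have fin: "finite (\<Union>s\<in>Z. (\<lambda>u. (u, 1 / (s * u), 1 :: complex)) ` {u. poly (H s) u = 0})"
    using Z(1) H(1) by auto
  have "card (\<Union>s\<in>Z. (\<lambda>u. (u, 1 / (s * u), 1 :: complex)) ` {u. poly (H s) u = 0}) \<le>
     (\<Sum>s\<in>Z. card ((\<lambda>u. (u, 1 / (s * u), 1 :: complex)) ` {u. poly (H s) u = 0}))"
    by (rule card_UN_le[OF Z(1)])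
  also have "\<dots> \<le> (\<Sum>s\<in>Z. 4 * m)"
    using H by (intro sum_mono order_trans[OF card_image_le]) auto
  also have "\<dots> \<le> degree G * (4 * m)" using Z(2) by simp
  finally show ?thesis using card_mono[OF fin sub] finite_subset[OF sub fin] by auto
qed

text \<open>The polynomial \<open>G\<close> covers both alternatives of \<open>tangent_pair\<close>.
  A line that touches at a special point is charged to it, any other line to two points over zeros
  of \<open>G\<close>. The assumed nonzero value makes the discriminant a nonzero
  polynomial.\<close>

lemma finite_real_bitangents:
  assumes disc: "k\<^sup>2 = poly (kappa2 m aa (of_real A)) s" "line_disc m aa s k \<noteq> 0"
  shows "finite (real_bitangents (2 * m) c) \<and>
     2 * card (real_bitangents (2 * m) c) \<le> 12 * m + (m + (4 * m ^ 3 + 6 * m ^ 2)) * (4 * m)"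
proof -
  obtain \<Delta> where \<Delta>: "degree \<Delta> \<le> 4 * m ^ 3 + 6 * m ^ 2"
    "\<And>s k. k\<^sup>2 = poly (kappa2 m aa (of_real A)) s \<Longrightarrow> line_disc m aa s k = poly \<Delta> s"
    using line_disc_polynomial[OF m, of aa "of_real A"] by metis
  define G where "G = eulerq m aa * \<Delta>"
  have "\<Delta> \<noteq> 0" using \<Delta>(2)[OF disc(1)] disc(2) by auto
  moreover have "eulerq m aa \<noteq> 0" using m by (simp add: eulerq_def pderiv_eq_0_iff)
  ultimately have G0: "G \<noteq> 0" by (simp add: G_def)
  have dG: "degree G \<le> m + (4 * m ^ 3 + 6 * m ^ 2)"
    unfolding G_def using degree_mult_le[of "eulerq m aa" \<Delta>] degree_eulerq[of m aa] \<Delta>(1) by linarith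
  define X1 where "X1 = points_over_zeros G"
  have X1: "finite X1" "card X1 \<le> degree G * (4 * m)"
    using card_points_over_zeros[OF G0] unfolding X1_def by auto
  define R where "R L x \<longleftrightarrow> (\<exists>l. l \<noteq> (0, 0, 0) \<and> L = {t *\<^sub>R l | t. t \<noteq> 0} \<and> tangent_at (2 * m) c l (cartesian x))"
    for L :: "(real \<times> real \<times> real) set" and x
  have residual: "(u, v, 1) \<in> X1" if "(u, v, 1) \<in> affine_points" "(u', v', 1) \<in> affine_points" "(u, v) \<noteq> (u', v')"
    "tangent_at (2 * m) c l (cartesian (u, v, 1))" "tangent_at (2 * m) c l (cartesian (u', v', 1))" for u v u' v' l
  proof -
    obtain l1 l2 l3 where l: "l = (l1, l2, l3)" by (cases l)
    have uv: "u * v \<noteq> 0" "rosette m a A u v 1 = 0" "rosette m a A u' v' 1 = 0"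
      using that(1,2) by (auto simp: affine_points_def)
    note T = that(4)[unfolded l tangent_at_iff] and T' = that(5)[unfolded l tangent_at_iff]
    have "of_real l1 * (((u' - u) + (v' - v)) / 2) + of_real l2 * (((u' - u) - (v' - v)) / (2 * \<i>)) + of_real l3 * 0 =
       (of_real l1 * ((u' + v') / 2) + of_real l2 * ((u' - v') / (2 * \<i>)) + of_real l3 * 1) -
       (of_real l1 * ((u + v) / 2) + of_real l2 * ((u - v) / (2 * \<i>)) + of_real l3 * 1)"
      by (simp add: field_simps)
    also have "\<dots> = 0" using T T' by simp
    finally have "rosette_diff m a A u v 1 (u' - u) (v' - v) 0 = 0" "rosette_diff m a A u' v' 1 (u' - u) (v' - v) 0 = 0"
      using T T' by blast+
    from tangent_pair[OF uv that(3) this]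
    have "poly G (1 / (u * v)) = 0"
      using \<Delta>(2)[OF on_curve(3)[OF uv(1,2)]] by (auto simp: G_def)
    thus ?thesis using uv by (auto simp: X1_def points_over_zeros_def)
  qed
  have inc: "(\<exists>x\<in>special_points. R L x) \<or> (\<exists>x\<in>X1. \<exists>y\<in>X1. x \<noteq> y \<and> R L x \<and> R L y)"
    if L: "L \<in> real_bitangents (2 * m) c" for L
  proof -
    obtain l p q where l: "L = {t *\<^sub>R l | t. t \<noteq> 0}" "l \<noteq> (0, 0, 0)"
      and pq: "tangent_at (2 * m) c l p" "tangent_at (2 * m) c l q" "proj_distinct p q"
      using L unfolding real_bitangents_def real_bitangent_def by blast
    obtain w t where w: "t \<noteq> 0" "p = (t * fst (cartesian w), t * fst (snd (cartesian w)), t * snd (snd (cartesian w)))"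
      "tangent_at (2 * m) c l (cartesian w)" "w \<in> special_points \<or> w \<in> affine_points"
      by (rule tangency_normalise[OF pq(1)])
    obtain w' t' where w': "t' \<noteq> 0" "q = (t' * fst (cartesian w'), t' * fst (snd (cartesian w')), t' * snd (snd (cartesian w')))"
      "tangent_at (2 * m) c l (cartesian w')" "w' \<in> special_points \<or> w' \<in> affine_points"
      by (rule tangency_normalise[OF pq(2)])
    have ne: "w \<noteq> w'"
    proof
      assume eq: "w = w'"
      have "\<exists>\<tau>. fst q = \<tau> * fst p \<and> fst (snd q) = \<tau> * fst (snd p) \<and> snd (snd q) = \<tau> * snd (snd p)"
        using w(1) by (intro exI[of _ "t' / t"]) (simp add: w(2) w'(2) eq)
      thus False using pq(3) by (auto simp: proj_distinct_def split: prod.splits)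
    qed
    have RR: "R L w" "R L w'" unfolding R_def using l w(3) w'(3) by blast+
    show ?thesis
    proof (cases "w \<in> special_points \<or> w' \<in> special_points")
      case True
      thus ?thesis using RR by blast
    next
      case False
      hence aff: "w \<in> affine_points" "w' \<in> affine_points" using w(4) w'(4) by auto
      then obtain u v u' v' where e: "w = (u, v, 1)" "w' = (u', v', 1)" by (auto simp: affine_points_def)
      have "w \<in> X1" "w' \<in> X1"
        using residual[of u v u' v' l] residual[of u' v' u v l] aff ne w(3) w'(3) unfolding e by auto
      thus ?thesis using ne RR by blast
    qed
  qed
  have unique: "L = L'" if "R L x" "R L' x" for L L' x
    using that tangent_at_unique unfolding R_def by blast
  have "finite (real_bitangents (2 * m) c) \<and> 2 * card (real_bitangents (2 * m) c) \<le> 2 * card special_points + card X1"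
    by (rule card_by_incidence[of special_points X1 _ R]) (use card_special_points X1 inc unique in auto)
  moreover have "card X1 \<le> (m + (4 * m ^ 3 + 6 * m ^ 2)) * (4 * m)"
    using X1(2) mult_le_mono1[OF dG] order_trans by blast
  ultimately show ?thesis using card_special_points by linarith
qed

end

section \<open>Connectedness of the real part\<close>

lemma cos_add_nat_periods: "cos (x + 2 * pi * real k) = cos x"
proof (induction k)
  case (Suc k)
  have "x + 2 * pi * real (Suc k) = (x + 2 * pi * real k) + 2 * pi" by (simp add: algebra_simps)
  thus ?case using Suc by (simp only: cos_periodic)
qed simp

lemma hp_eval_of_real: "complex_of_real (hp_eval d c x y z) = hp_eval d c (of_real x) (of_real y) (of_real z)"
  by (simp add: hp_eval_def)

lemma connected_chain:
  fixes P :: "nat \<Rightarrow> 'a::topological_space set"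
  assumes con: "\<And>n. connected (P n)" and meet: "\<And>n. P n \<inter> P (Suc n) \<noteq> {}"
  shows "connected (\<Union>n. P n)"
proof -
  have *: "connected (\<Union>i\<le>n. P i)" for n
  proof (induction n)
    case 0
    then show ?case using con by simp
  next
    case (Suc n)
    have "(\<Union>i\<le>n. P i) \<inter> P (Suc n) \<noteq> {}" using meet[of n] by auto
    then show ?case using connected_Un[OF Suc.IH con] by (simp add: atMost_Suc Un_commute)
  qed
  have ne: "P 0 \<noteq> {}" using meet[of 0] by auto
  have "connected (\<Union>n. \<Union>i\<le>n. P i)"
    by (rule connected_Union) (use * ne in auto)
  moreover have "(\<Union>n. \<Union>i\<le>n. P i) = (\<Union>n. P n)" by auto
  ultimately show ?thesis by simp
qed

text \<open>Every point of the cone can be scaled into \<open>T\<close>, so a separation into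
  scale-invariant pieces would separate \<open>T\<close>.\<close>

lemma real_part_connected_slice:
  assumes T: "connected T" "T \<noteq> {}" "T \<subseteq> real_cone d c"
    and cover: "\<And>v. v \<in> real_cone d c \<Longrightarrow> \<exists>t. t \<noteq> 0 \<and> t *\<^sub>R v \<in> T"
  shows "real_part_connected d c"
  unfolding real_part_connected_def
proof (intro conjI notI)
  show "real_cone d c = {} \<Longrightarrow> False" using T by auto
next
  assume "\<exists>A B. A \<union> B = real_cone d c \<and> A \<inter> B = {} \<and> A \<noteq> {} \<and> B \<noteq> {} \<and>
            closedin (top_of_set (real_cone d c)) A \<and>
            closedin (top_of_set (real_cone d c)) B \<and>
            (\<forall>v\<in>A. \<forall>t::real. t \<noteq> 0 \<longrightarrow> t *\<^sub>R v \<in> A) \<and>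
            (\<forall>v\<in>B. \<forall>t::real. t \<noteq> 0 \<longrightarrow> t *\<^sub>R v \<in> B)"
  then obtain A B where AB: "A \<union> B = real_cone d c" "A \<inter> B = {}" "A \<noteq> {}" "B \<noteq> {}"
    "closedin (top_of_set (real_cone d c)) A" "closedin (top_of_set (real_cone d c)) B"
    and inv: "\<forall>v\<in>A. \<forall>t::real. t \<noteq> 0 \<longrightarrow> t *\<^sub>R v \<in> A" "\<forall>v\<in>B. \<forall>t::real. t \<noteq> 0 \<longrightarrow> t *\<^sub>R v \<in> B"
    by (elim exE conjE) (rule that)
  have cl: "closedin (top_of_set T) (T \<inter> S)" if "closedin (top_of_set (real_cone d c)) S" for S
  proof -
    obtain C where C: "closed C" "S = real_cone d c \<inter> C" using \<open>closedin (top_of_set (real_cone d c)) S\<close>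
      unfolding closedin_closed by blast
    hence "T \<inter> S = T \<inter> C" using T(3) by blast
    thus ?thesis using C(1) by (auto simp: closedin_closed)
  qed
  have ne: "T \<inter> S \<noteq> {}"
    if S: "S \<subseteq> real_cone d c" "S \<noteq> {}" and inv: "\<forall>v\<in>S. \<forall>t::real. t \<noteq> 0 \<longrightarrow> t *\<^sub>R v \<in> S" for S
  proof -
    obtain v where v: "v \<in> S" using S(2) by auto
    then obtain t where t: "t \<noteq> 0" "t *\<^sub>R v \<in> T" using cover S(1) by (meson subsetD)
    thus ?thesis using inv v by auto
  qed
  have sub: "A \<subseteq> real_cone d c" "B \<subseteq> real_cone d c" using AB(1) by auto
  have "T \<inter> A \<noteq> {}" using sub(1) AB(1,3) inv(1) by (intro ne) simp_all
  moreover have "T \<inter> B \<noteq> {}" using sub(2) AB(1,4) inv(2) by (intro ne) simp_all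
  moreover have "T \<subseteq> (T \<inter> A) \<union> (T \<inter> B)" "(T \<inter> A) \<inter> (T \<inter> B) = {}" using AB T(3) by blast+
  ultimately show False
    using T(1) cl[OF AB(5)] cl[OF AB(6)] unfolding connected_closedin by blast
qed

context rosette_curve
begin

definition qr :: "real \<Rightarrow> real" where "qr s = (\<Prod>i<m. s - a i)"

lemma real_eval: "hp_eval (2 * m) c x y z = (\<Prod>i<m. z\<^sup>2 - a i * (x\<^sup>2 + y\<^sup>2)) - A * Re (Complex x y ^ (2 * m))"
proof -
  have u: "of_real x + \<i> * of_real y = Complex x y" "of_real x - \<i> * of_real y = cnj (Complex x y)"
    by (simp_all add: complex_eq_iff)
  have n: "Complex x y * cnj (Complex x y) = of_real (x\<^sup>2 + y\<^sup>2)"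
    by (simp add: complex_eq_iff power2_eq_square)
  have "Complex x y ^ (2 * m) + cnj (Complex x y) ^ (2 * m) = of_real (2 * Re (Complex x y ^ (2 * m)))"
    by (metis complex_add_cnj complex_cnj_power)
  hence "complex_of_real (hp_eval (2 * m) c x y z) =
     (\<Prod>i<m. of_real z ^ 2 - of_real (a i) * of_real (x\<^sup>2 + y\<^sup>2)) - of_real A / 2 * of_real (2 * Re (Complex x y ^ (2 * m)))"
    unfolding hp_eval_of_real eval u rosette_def n by (simp only:)
  also have "\<dots> = of_real ((\<Prod>i<m. z\<^sup>2 - a i * (x\<^sup>2 + y\<^sup>2)) - A * Re (Complex x y ^ (2 * m)))"
    by simp
  finally show ?thesis by (simp only: of_real_eq_iff)
qed

lemma polar_eval:
  fixes \<theta> :: real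
  assumes "s > 0"
  shows "hp_eval (2 * m) c (cos \<theta> / sqrt s) (sin \<theta> / sqrt s) 1 = (qr s - A * cos (real (2 * m) * \<theta>)) / s ^ m"
proof -
  have "(cos \<theta> / sqrt s)\<^sup>2 + (sin \<theta> / sqrt s)\<^sup>2 = 1 / s"
    using assms by (simp add: power_divide add_divide_distrib[symmetric])
  moreover have "1\<^sup>2 - a i * (1 / s) = (s - a i) / s" for i using assms by (simp add: field_simps)
  ultimately have 1: "(\<Prod>i<m. 1\<^sup>2 - a i * ((cos \<theta> / sqrt s)\<^sup>2 + (sin \<theta> / sqrt s)\<^sup>2)) = qr s / s ^ m"
    by (simp only: qr_def prod_dividef prod_constant card_lessThan)
  have "Complex (cos \<theta> / sqrt s) (sin \<theta> / sqrt s) = of_real (1 / sqrt s) * cis \<theta>"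
    by (simp add: complex_eq_iff)
  hence "Complex (cos \<theta> / sqrt s) (sin \<theta> / sqrt s) ^ (2 * m) = of_real ((1 / sqrt s) ^ (2 * m)) * cis (real (2 * m) * \<theta>)"
    by (simp only: power_mult_distrib Complex.DeMoivre of_real_power)
  also have "(1 / sqrt s) ^ (2 * m) = 1 / s ^ m" using assms by (simp add: power_divide power_mult)
  finally have "Re (Complex (cos \<theta> / sqrt s) (sin \<theta> / sqrt s) ^ (2 * m)) = cos (real (2 * m) * \<theta>) / s ^ m"
    by simp
  thus ?thesis unfolding real_eval 1 by (simp add: diff_divide_distrib)
qed

text \<open>In the polar equation \<open>cos (d \<theta>) = q(s) / A\<close> the branches of the arc
  cosine give the arcs \<open>pt n\<close>; consecutive arcs meet where \<open>q(s) = - A\<close>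
  for even \<open>n\<close> and where \<open>q(s) = A\<close> for odd \<open>n\<close>. The chain
  simply keeps running around the circle. By \<open>infinity\<close> the curve avoids the line
  \<open>z = 0\<close>, so the slice \<open>z = 1\<close> sees every point.\<close>

lemma real_part_connectedI:
  assumes Apos: "A > 0"
    and interval: "is_interval {s. s > 0 \<and> \<bar>qr s\<bar> \<le> A}"
    and ends: "\<exists>s>0. qr s = A" "\<exists>s>0. qr s = - A"
    and infinity: "\<bar>qr 0\<bar> > A"
  shows "real_part_connected (2 * m) c"
proof -
  define J where "J = {s. s > 0 \<and> \<bar>qr s\<bar> \<le> A}"
  define ac where "ac s = arccos (qr s / A)" for s
  define th where "th n s = (if even n then ac s + 2 * pi * real (n div 2) else 2 * pi * real (Suc (n div 2)) - ac s) / (2 * m)" for n s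
  define pt where "pt n s = (cos (th n s) / sqrt s, sin (th n s) / sqrt s, 1 :: real)" for n s
  define T where "T = (\<Union>n. pt n ` J)"
  have m0: "real (2 * m) > 0" using m by simp
  have range: "- 1 \<le> qr s / A" "qr s / A \<le> 1" if "s \<in> J" for s
    using that Apos by (auto simp: J_def field_simps)
  have cont: "continuous_on J (pt n)" for n
  proof -
    have "continuous_on J (\<lambda>s. qr s / A)" unfolding qr_def using Apos by (intro continuous_intros) auto
    hence "continuous_on J ac" unfolding ac_def
      by (rule continuous_on_arccos) (use range in auto)
    hence "continuous_on J (th n)" unfolding th_def using m0 by (cases "even n") (auto intro!: continuous_intros)
    thus ?thesis unfolding pt_def by (intro continuous_intros) (auto simp: J_def)
  qed
  have conJ: "connected J" using interval is_interval_connected unfolding J_def by blast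
  have th: "cos (real (2 * m) * th n s) = qr s / A" if "s \<in> J" for n s
  proof -
    have "real (2 * m) * th n s = (if even n then ac s + 2 * pi * real (n div 2) else 2 * pi * real (Suc (n div 2)) - ac s)"
      unfolding th_def using m0 by simp
    moreover have "cos (ac s + 2 * pi * real k) = cos (ac s)" "cos (2 * pi * real k - ac s) = cos (ac s)" for k
      using cos_add_nat_periods[of "ac s" k] cos_add_nat_periods[of "- ac s" k] by (simp_all add: add.commute)
    moreover have "cos (ac s) = qr s / A" unfolding ac_def using range[OF that] by (rule cos_arccos)
    ultimately show ?thesis by (cases "even n") (simp_all only: if_True if_False)
  qed
  have meet: "pt n ` J \<inter> pt (Suc n) ` J \<noteq> {}" for n
  proof (cases "even n")
    case True
    obtain s where s: "s > 0" "qr s = - A" using ends by blast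
    hence "ac s = pi" "s \<in> J" using Apos by (auto simp: ac_def J_def)
    hence "th n s = th (Suc n) s" using True by (auto simp: th_def algebra_simps)
    hence "pt n s = pt (Suc n) s" by (simp add: pt_def)
    thus ?thesis using \<open>s \<in> J\<close> by blast
  next
    case False
    obtain s where s: "s > 0" "qr s = A" using ends by blast
    hence "ac s = 0" "s \<in> J" using Apos by (auto simp: ac_def J_def)
    hence "th n s = th (Suc n) s" using False by (auto simp: th_def algebra_simps elim!: oddE)
    hence "pt n s = pt (Suc n) s" by (simp add: pt_def)
    thus ?thesis using \<open>s \<in> J\<close> by blast
  qed
  have "connected T" unfolding T_def
    by (rule connected_chain) (use meet connected_continuous_image[OF cont conJ] in auto)
  moreover have "T \<noteq> {}" using meet[of 0] by (auto simp: T_def)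
  moreover have "T \<subseteq> real_cone (2 * m) c"
  proof -
    have "pt n s \<in> real_cone (2 * m) c" if s: "s \<in> J" for n s
    proof -
      have "s > 0" using s by (simp add: J_def)
      from polar_eval[OF this, of "th n s"] show ?thesis
        using th[OF s, of n] Apos by (simp add: pt_def real_cone_def)
    qed
    thus ?thesis by (auto simp: T_def)
  qed
  moreover have "\<exists>t. t \<noteq> 0 \<and> t *\<^sub>R p \<in> T" if p: "p \<in> real_cone (2 * m) c" for p
  proof -
    obtain x y z where pe: "p = (x, y, z)" by (cases p)
    have nz: "(x, y, z) \<noteq> (0, 0, 0)" and on: "hp_eval (2 * m) c x y z = 0" using p by (auto simp: pe real_cone_def)
    have z: "z \<noteq> 0"
    proof
      assume z: "z = 0"
      define r where "r = x\<^sup>2 + y\<^sup>2"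
      have r: "r > 0" using nz z by (auto simp: r_def sum_power2_gt_zero_iff)
      have "(\<Prod>i<m. z\<^sup>2 - a i * r) = r ^ m * qr 0"
      proof -
        have "z\<^sup>2 - a i * r = r * (0 - a i)" for i by (simp add: z)
        thus ?thesis by (simp only: qr_def prod.distrib prod_constant card_lessThan)
      qed
      hence "r ^ m * qr 0 = A * Re (Complex x y ^ (2 * m))" using on unfolding real_eval r_def[symmetric] by simp
      hence "r ^ m * \<bar>qr 0\<bar> = A * \<bar>Re (Complex x y ^ (2 * m))\<bar>" using r Apos by (metis abs_mult abs_of_pos zero_less_power)
      also have "\<dots> \<le> A * cmod (Complex x y ^ (2 * m))" using Apos abs_Re_le_cmod by (intro mult_left_mono) auto
      also have "cmod (Complex x y ^ (2 * m)) = r ^ m"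
        by (simp add: norm_power power_mult cmod_power2 r_def)
      finally have "\<bar>qr 0\<bar> \<le> A" using r by (simp add: mult.commute)
      thus False using infinity by simp
    qed
    define X where "X = x / z"
    define Y where "Y = y / z"
    have XY: "(1 / z) *\<^sub>R p = (X, Y, 1)" using z by (simp add: pe X_def Y_def)
    have onXY: "hp_eval (2 * m) c X Y 1 = 0"
    proof -
      have "hp_eval (2 * m) c (of_real X) (of_real Y) (1::complex) = 0"
        using rosette_scale[of m a A "1 / of_real z" "of_real x + \<i> * of_real y" "of_real x - \<i> * of_real y" "of_real z"]
          hp_eval_of_real[of "2 * m" c x y z] on z
        unfolding eval by (simp add: X_def Y_def add_divide_distrib diff_divide_distrib)
      thus ?thesis using hp_eval_of_real[of "2 * m" c X Y 1] by simp
    qed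
    define r where "r = cmod (Complex X Y)"
    have r: "r > 0"
    proof (rule ccontr)
      assume "\<not> r > 0"
      hence "X = 0" "Y = 0" by (simp_all add: r_def complex_eq_iff)
      with onXY show False unfolding real_eval using m by (simp add: zero_complex.code[symmetric] power_0_left)
    qed
    define \<theta> where "\<theta> = Arg2pi (Complex X Y)"
    have \<theta>: "\<theta> \<ge> 0" "Complex X Y = of_real r * cis \<theta>"
      using Arg2pi_ge_0 Arg2pi_eq[of "Complex X Y"] by (auto simp: \<theta>_def r_def cis_conv_exp)
    define s where "s = 1 / r\<^sup>2"
    have s: "s > 0" "sqrt s = 1 / r" using r by (auto simp: s_def real_sqrt_divide)
    have XYp: "X = cos \<theta> / sqrt s" "Y = sin \<theta> / sqrt s"
      using arg_cong[OF \<theta>(2), of Re] arg_cong[OF \<theta>(2), of Im] s(2) by simp_all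
    have q: "qr s = A * cos (real (2 * m) * \<theta>)"
      using onXY polar_eval[OF s(1), of \<theta>] s(1) unfolding XYp by simp
    have sJ: "s \<in> J" using s(1) q Apos by (simp add: J_def abs_mult)
    define \<phi> where "\<phi> = real (2 * m) * \<theta>"
    define k where "k = nat \<lfloor>\<phi> / (2 * pi)\<rfloor>"
    define \<psi> where "\<psi> = \<phi> - 2 * pi * real k"
    have "\<phi> \<ge> 0" using \<theta>(1) by (simp add: \<phi>_def)
    hence k: "real k \<le> \<phi> / (2 * pi)" "\<phi> / (2 * pi) < real k + 1" unfolding k_def by (simp_all add: floor_less_iff)
    hence \<psi>: "0 \<le> \<psi>" "\<psi> < 2 * pi" unfolding \<psi>_def by (simp_all add: field_simps)
    have cp: "cos \<psi> = qr s / A"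
      using cos_add_nat_periods[of \<psi> k] q Apos by (simp add: \<psi>_def \<phi>_def mult_ac)
    have "\<exists>n. th n s = \<theta>"
    proof (cases "\<psi> \<le> pi")
      case True
      hence "ac s = \<psi>" unfolding ac_def cp[symmetric] using \<psi> by (simp add: arccos_cos)
      hence "th (2 * k) s = \<theta>" using m0 by (simp add: th_def \<psi>_def \<phi>_def)
      thus ?thesis by blast
    next
      case False
      have "cos (2 * pi - \<psi>) = qr s / A" using cp by (simp add: cos_diff)
      hence "ac s = 2 * pi - \<psi>" unfolding ac_def using \<psi> False by (metis arccos_cos diff_ge_0_iff_ge less_imp_le linorder_not_le mult_2 le_diff_eq add_le_cancel_left diff_le_eq)
      hence "th (2 * k + 1) s = \<theta>" using m0 by (simp add: th_def \<psi>_def \<phi>_def field_simps)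
      thus ?thesis by blast
    qed
    then obtain n where "th n s = \<theta>" ..
    hence "pt n s = (X, Y, 1)" unfolding pt_def XYp by simp
    hence "(1 / z) *\<^sub>R p \<in> T" using sJ unfolding XY T_def by (metis UN_iff UNIV_I imageI)
    thus ?thesis using z by (intro exI[of _ "1 / z"]) simp
  qed
  ultimately show ?thesis by (rule real_part_connected_slice)
qed

end

section \<open>Tools for the lower bound\<close>

text \<open>Apply Brouwer's theorem to \<open>p - (f p, g p)\<close> clamped to the rectangle. If
  \<open>f > 0\<close> at a fixed point, the clamping acted at the left side, where
  \<open>f \<le> 0\<close>; the other cases are alike.\<close>

lemma poincare_miranda:
  fixes f g :: "real \<times> real \<Rightarrow> real"
  assumes ab: "a \<le> b" "c \<le> d"
    and cont: "continuous_on ({a..b} \<times> {c..d}) f" "continuous_on ({a..b} \<times> {c..d}) g"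
    and f: "\<And>y. y \<in> {c..d} \<Longrightarrow> f (a, y) \<le> 0" "\<And>y. y \<in> {c..d} \<Longrightarrow> f (b, y) \<ge> 0"
    and g: "\<And>x. x \<in> {a..b} \<Longrightarrow> g (x, c) \<le> 0" "\<And>x. x \<in> {a..b} \<Longrightarrow> g (x, d) \<ge> 0"
  obtains x y where "x \<in> {a..b}" "y \<in> {c..d}" "f (x, y) = 0" "g (x, y) = 0"
proof -
  let ?S = "{a..b} \<times> {c..d}"
  define h where "h p = (max a (min b (fst p - f p)), max c (min d (snd p - g p)))" for p
  have "continuous_on ?S h" unfolding h_def by (intro continuous_intros cont)
  moreover have "h ` ?S \<subseteq> ?S" using ab by (auto simp: h_def)
  moreover have "compact ?S" "convex ?S" "?S \<noteq> {}" using ab by (auto intro!: compact_Times convex_Times)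
  ultimately obtain p where p: "p \<in> ?S" "h p = p" using brouwer[of ?S h] by blast
  obtain x y where xy: "p = (x, y)" by (cases p)
  have x: "x \<in> {a..b}" "max a (min b (x - f (x, y))) = x" and y: "y \<in> {c..d}" "max c (min d (y - g (x, y))) = y"
    using p by (auto simp: xy h_def)
  have "f (x, y) = 0"
  proof (rule ccontr)
    assume "f (x, y) \<noteq> 0"
    then consider "f (x, y) > 0" | "f (x, y) < 0" by linarith
    thus False
    proof cases
      case 1
      with x have "x = a" by (auto simp: max_def min_def split: if_splits)
      with 1 f(1)[OF y(1)] show False by simp
    next
      case 2
      with x have "x = b" by (auto simp: max_def min_def split: if_splits)
      with 2 f(2)[OF y(1)] show False by simp
    qed
  qed
  moreover have "g (x, y) = 0"
  proof (rule ccontr)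
    assume "g (x, y) \<noteq> 0"
    then consider "g (x, y) > 0" | "g (x, y) < 0" by linarith
    thus False
    proof cases
      case 1
      with y have "y = c" by (auto simp: max_def min_def split: if_splits)
      with 1 g(1)[OF x(1)] show False by simp
    next
      case 2
      with y have "y = d" by (auto simp: max_def min_def split: if_splits)
      with 2 g(2)[OF x(1)] show False by simp
    qed
  qed
  ultimately show ?thesis using x(1) y(1) that by blast
qed

lemma continuous_on_SUP:
  fixes f :: "'a::metric_space \<times> 'b::metric_space \<Rightarrow> real"
  assumes "compact X" "compact W" "W \<noteq> {}" "continuous_on (X \<times> W) f"
  shows "continuous_on X (\<lambda>x. SUP w\<in>W. f (x, w))"
  unfolding continuous_on_iff
proof (intro ballI allI impI)
  fix x e assume x: "x \<in> X" and e: "(0::real) < e"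
  have "uniformly_continuous_on (X \<times> W) f"
    using assms by (intro compact_uniformly_continuous compact_Times)
  then obtain d where d: "d > 0" "\<And>p q. p \<in> X \<times> W \<Longrightarrow> q \<in> X \<times> W \<Longrightarrow> dist q p < d \<Longrightarrow> dist (f q) (f p) < e / 2"
    using e unfolding uniformly_continuous_on_def by (metis half_gt_zero)
  have bdd: "bdd_above ((\<lambda>w. f (y, w)) ` W)" if "y \<in> X" for y
  proof -
    have "continuous_on W (\<lambda>w. f (y, w))"
      by (rule continuous_on_compose2[OF assms(4)]) (use that in \<open>auto intro!: continuous_intros\<close>)
    hence "compact ((\<lambda>w. f (y, w)) ` W)" using assms(2) by (rule compact_continuous_image)
    thus ?thesis by (intro bounded_imp_bdd_above compact_imp_bounded)
  qed
  have le: "(SUP w\<in>W. f (y, w)) \<le> (SUP w\<in>W. f (y', w)) + e / 2" if "y \<in> X" "y' \<in> X" "dist y y' < d" for y y'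
  proof (rule cSUP_least[OF assms(3)])
    fix w assume w: "w \<in> W"
    have "dist (f (y, w)) (f (y', w)) < e / 2" using that w by (intro d(2)) (auto simp: dist_Pair_Pair)
    hence "f (y, w) \<le> f (y', w) + e / 2" unfolding dist_real_def by linarith
    also have "f (y', w) \<le> (SUP w\<in>W. f (y', w))" by (rule cSUP_upper[OF w bdd[OF that(2)]])
    finally show "f (y, w) \<le> (SUP w\<in>W. f (y', w)) + e / 2" by simp
  qed
  have "dist (SUP w\<in>W. f (y, w)) (SUP w\<in>W. f (x, w)) < e" if "y \<in> X" "dist y x < d" for y
    using le[OF that(1) x that(2)] le[OF x that(1)] that(2) e by (simp add: dist_real_def dist_commute)
  thus "\<exists>d>0. \<forall>y\<in>X. dist y x < d \<longrightarrow> dist (SUP w\<in>W. f (y, w)) (SUP w\<in>W. f (x, w)) < e"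
    using d(1) by blast
qed

lemma SUP_attained:
  fixes f :: "'a::topological_space \<Rightarrow> real"
  assumes "compact W" "W \<noteq> {}" "continuous_on W f"
  obtains w where "w \<in> W" "(SUP w\<in>W. f w) = f w" "\<And>v. v \<in> W \<Longrightarrow> f v \<le> f w"
proof -
  obtain w where w: "w \<in> W" "\<And>v. v \<in> W \<Longrightarrow> f v \<le> f w" using continuous_attains_sup[OF assms] by blast
  have "(SUP w\<in>W. f w) = f w" by (rule cSup_eq_maximum) (use w in auto)
  with w show ?thesis using that by blast
qed

lemma SUP_close:
  fixes f g :: "'a \<Rightarrow> real"
  assumes "W \<noteq> {}" "bdd_above (f ` W)" "bdd_above (g ` W)" "\<And>w. w \<in> W \<Longrightarrow> \<bar>f w - g w\<bar> \<le> e"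
  shows "\<bar>(SUP w\<in>W. f w) - (SUP w\<in>W. g w)\<bar> \<le> e"
proof -
  have "(SUP w\<in>W. f w) \<le> (SUP w\<in>W. g w) + e"
  proof (rule cSUP_least[OF assms(1)])
    fix w assume w: "w \<in> W"
    show "f w \<le> (SUP w\<in>W. g w) + e" using assms(4)[OF w] cSUP_upper[OF w assms(3)] by linarith
  qed
  moreover have "(SUP w\<in>W. g w) \<le> (SUP w\<in>W. f w) + e"
  proof (rule cSUP_least[OF assms(1)])
    fix w assume w: "w \<in> W"
    show "g w \<le> (SUP w\<in>W. f w) + e" using assms(4)[OF w] cSUP_upper[OF w assms(2)] by linarith
  qed
  ultimately show ?thesis by linarith
qed

section \<open>Extrema of a product with equally spaced zeros\<close>

definition fallprod :: "nat \<Rightarrow> real \<Rightarrow> real" where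
  "fallprod N w = (\<Prod>i<N. w - real i)"

text \<open>For \<open>s = 1 + \<epsilon> w\<close> the ring factors of \<open>q\<close> multiply to
  \<open>\<epsilon>^N\<close> times \<open>fallprod N w\<close>. So, up to a factor
  \<open>2^e\<close>, the peaks are the rescaled extrema of \<open>q\<close> between neighbouring
  circles in the limit of a thin ring.\<close>

definition peak :: "nat \<Rightarrow> nat \<Rightarrow> real" where
  "peak N j = (SUP w\<in>{real j..real (Suc j)}. \<bar>fallprod N w\<bar>)"

lemma continuous_on_fallprod [continuous_intros]: "continuous_on S f \<Longrightarrow> continuous_on S (\<lambda>x. fallprod N (f x))"
  unfolding fallprod_def by (intro continuous_intros)

lemma peak_attained:
  obtains w where "w \<in> {real j..real (Suc j)}" "peak N j = \<bar>fallprod N w\<bar>"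
    "\<And>v. v \<in> {real j..real (Suc j)} \<Longrightarrow> \<bar>fallprod N v\<bar> \<le> \<bar>fallprod N w\<bar>"
proof -
  have "continuous_on {real j..real (Suc j)} (\<lambda>w. \<bar>fallprod N w\<bar>)" by (intro continuous_intros)
  then obtain w where "w \<in> {real j..real (Suc j)}" "peak N j = \<bar>fallprod N w\<bar>"
    "\<And>v. v \<in> {real j..real (Suc j)} \<Longrightarrow> \<bar>fallprod N v\<bar> \<le> \<bar>fallprod N w\<bar>"
    unfolding peak_def using SUP_attained[of "{real j..real (Suc j)}" "\<lambda>w. \<bar>fallprod N w\<bar>"] by auto
  thus ?thesis by (rule that)
qed

lemma fallprod_bound: "0 \<le> w \<Longrightarrow> w \<le> real N \<Longrightarrow> \<bar>fallprod N w\<bar> \<le> real N ^ N"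
proof -
  assume w: "0 \<le> w" "w \<le> real N"
  have "\<bar>fallprod N w\<bar> = (\<Prod>i<N. \<bar>w - real i\<bar>)" by (simp add: fallprod_def abs_prod)
  also have "\<dots> \<le> (\<Prod>i<N. real N)" using w by (intro prod_mono) auto
  finally show ?thesis by simp
qed

lemma peak_bound:
  assumes "Suc j \<le> N"
  shows "peak N j \<le> real N ^ N"
proof -
  obtain w where w: "w \<in> {real j..real (Suc j)}" "peak N j = \<bar>fallprod N w\<bar>"
    by (metis peak_attained)
  have "real (Suc j) \<le> real N" using assms by (simp only: of_nat_le_iff)
  thus ?thesis using w fallprod_bound[of w N] by simp
qed

lemma fallprod_zero: "i < N \<Longrightarrow> fallprod N (real i) = 0"
  by (auto simp: fallprod_def)

lemma peak_pos: assumes "Suc j < N" shows "peak N j > 0"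
proof -
  obtain w where w: "peak N j = \<bar>fallprod N w\<bar>"
    "\<And>v. v \<in> {real j..real (Suc j)} \<Longrightarrow> \<bar>fallprod N v\<bar> \<le> \<bar>fallprod N w\<bar>"
    using peak_attained[of j N] by metis
  have "real j + 1/2 \<noteq> real i" for i
  proof
    assume "real j + 1/2 = real i"
    hence "real (2 * j + 1) = real (2 * i)" by simp
    hence "2 * j + 1 = 2 * i" by (simp only: of_nat_eq_iff)
    thus False by presburger
  qed
  hence "fallprod N (real j + 1/2) \<noteq> 0" by (auto simp: fallprod_def)
  hence "0 < \<bar>fallprod N (real j + 1/2)\<bar>" by simp
  also have "\<dots> \<le> \<bar>fallprod N w\<bar>" by (rule w(2)) simp
  finally show ?thesis using w(1) by simp
qed

text \<open>The shift makes the peaks decrease towards the middle of \<open>[0, N - 1]\<close>.\<close>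

lemma fallprod_shift: "(real N - 1 - w) * fallprod N (w + 1) = - (w + 1) * fallprod N w"
proof (cases N)
  case (Suc n)
  have 1: "fallprod (Suc n) (w + 1) = (w + 1) * (\<Prod>i<n. w - real i)"
    unfolding fallprod_def prod.lessThan_Suc_shift by (simp add: algebra_simps)
  have 2: "fallprod (Suc n) w = (\<Prod>i<n. w - real i) * (w - real n)" by (simp add: fallprod_def)
  show ?thesis unfolding Suc 1 2 by (simp add: algebra_simps)
qed (simp add: fallprod_def)

lemma fallprod_reflect: "fallprod N (real N - 1 - w) = (-1) ^ N * fallprod N w"
proof -
  have "fallprod N (real N - 1 - w) = (\<Prod>i<N. - (w - real (N - Suc i)))"
    unfolding fallprod_def by (intro prod.cong) (auto simp: of_nat_diff algebra_simps)
  also have "\<dots> = (\<Prod>i<N. - (w - real i))" by (rule prod.nat_diff_reindex)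
  also have "\<dots> = (-1) ^ N * fallprod N w"
    unfolding fallprod_def using prod.distrib[of "\<lambda>_. -1" "\<lambda>i. w - real i" "{..<N}"] by simp
  finally show ?thesis .
qed

text \<open>On this window the \<open>N - 1 - j\<close> factors of index above \<open>j\<close> are
  at most 0 and the others at least 0; the number \<open>N - 1 - j\<close> has the parity of
  \<open>j\<close> because \<open>N\<close> is odd.\<close>

lemma fallprod_sign:
  assumes "odd N" "Suc j < N" "w \<in> {real j..real (Suc j)}"
  shows "(-1) ^ j * fallprod N w = \<bar>fallprod N w\<bar>"
proof -
  have split: "{..<N} = {..j} \<union> {Suc j..<N}" "{..j} \<inter> {Suc j..<N} = {}" using assms(2) by auto
  have p: "fallprod N w = (\<Prod>i\<le>j. w - real i) * (\<Prod>i=Suc j..<N. w - real i)"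
    unfolding fallprod_def split(1) by (rule prod.union_disjoint) auto
  have 1: "(\<Prod>i\<le>j. w - real i) \<ge> 0" using assms(3) by (intro prod_nonneg) auto
  have "(\<Prod>i=Suc j..<N. w - real i) = (\<Prod>i=Suc j..<N. (-1) * (real i - w))" by simp
  also have "\<dots> = (-1) ^ (N - Suc j) * (\<Prod>i=Suc j..<N. real i - w)" by (simp only: prod.distrib prod_constant card_atLeastLessThan)
  finally have 2: "(\<Prod>i=Suc j..<N. w - real i) = (-1) ^ (N - Suc j) * (\<Prod>i=Suc j..<N. real i - w)" .
  have 3: "(\<Prod>i=Suc j..<N. real i - w) \<ge> 0" using assms(3) by (intro prod_nonneg) auto
  have "(-1) ^ j * (-1::real) ^ (N - Suc j) = 1"
  proof -
    have "even (j + (N - Suc j))" using assms(1,2) by simp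
    thus ?thesis by (simp flip: power_add)
  qed
  hence "(-1) ^ j * fallprod N w = (\<Prod>i\<le>j. w - real i) * (\<Prod>i=Suc j..<N. real i - w)"
    unfolding p 2 by (simp add: mult_ac)
  moreover from this have "(-1) ^ j * fallprod N w \<ge> 0" using 1 3 by simp
  ultimately show ?thesis by (metis abs_mult abs_of_nonneg abs_power_minus mult_1 power_one abs_one)
qed

lemma peak_reflect:
  assumes "Suc j < N"
  shows "peak N (N - 2 - j) = peak N j"
proof -
  have "(\<lambda>w. real N - 1 - w) ` {real j..real (Suc j)} = {real (N - 2 - j)..real (Suc (N - 2 - j))}"
    using assms by (auto simp: image_iff of_nat_diff algebra_simps intro!: bexI[of _ "real N - 1 - _"])
  hence "peak N (N - 2 - j) = (SUP w\<in>{real j..real (Suc j)}. \<bar>fallprod N (real N - 1 - w)\<bar>)"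
    unfolding peak_def by (metis (no_types, lifting) image_image image_cong)
  thus ?thesis by (simp add: fallprod_reflect peak_def abs_mult)
qed

text \<open>Moving a maximiser of the later window one step to the left multiplies the absolute
  value by \<open>(N - 1 - x) / (x + 1)\<close>, which exceeds 1 in the left half.\<close>

lemma peak_decreasing:
  assumes "2 * j + 4 < N"
  shows "peak N (Suc j) < peak N j"
proof -
  obtain w where w: "w \<in> {real (Suc j)..real (Suc (Suc j))}" "peak N (Suc j) = \<bar>fallprod N w\<bar>"
    using peak_attained[of "Suc j" N] by metis
  obtain v where v: "peak N j = \<bar>fallprod N v\<bar>"
    "\<And>x. x \<in> {real j..real (Suc j)} \<Longrightarrow> \<bar>fallprod N x\<bar> \<le> \<bar>fallprod N v\<bar>"
    using peak_attained[of j N] by metis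
  define x where "x = w - 1"
  have x: "x \<in> {real j..real (Suc j)}" using w by (simp add: x_def)
  have N: "real (2 * j + 4) < real N" using assms by (simp only: of_nat_less_iff)
  have pos: "0 < \<bar>fallprod N w\<bar>" using peak_pos[of "Suc j" N] assms w(2) by simp
  have "(real N - 1 - x) * \<bar>fallprod N w\<bar> = (x + 1) * \<bar>fallprod N x\<bar>"
    using arg_cong[OF fallprod_shift[of N x], of abs] x N by (simp add: abs_mult x_def)
  moreover have "(x + 1) * \<bar>fallprod N w\<bar> < (real N - 1 - x) * \<bar>fallprod N w\<bar>"
    using pos x N by (intro mult_strict_right_mono) auto
  ultimately have "(x + 1) * \<bar>fallprod N w\<bar> < (x + 1) * \<bar>fallprod N x\<bar>" by simp
  hence "\<bar>fallprod N w\<bar> < \<bar>fallprod N x\<bar>" using x by (simp add: mult_less_cancel_left)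
  also have "\<dots> \<le> \<bar>fallprod N v\<bar>" using x by (rule v(2))
  finally show ?thesis using w v by simp
qed

text \<open>Up to the reflection \<open>j \<mapsto> N - 2 - j\<close> the peaks are strictly
  decreasing. As \<open>N - 2\<close> is odd, reflected indices have different parity, and the signs
  tell them apart.\<close>

lemma signed_peaks_distinct:
  assumes N: "odd N" and j: "Suc j < N" "Suc j' < N" and eq: "(-1) ^ j * peak N j = (-1) ^ j' * peak N j'"
  shows "j = j'"
proof -
  have pp: "peak N j > 0" "peak N j' > 0" using j peak_pos by auto
  have par: "even j \<longleftrightarrow> even j'" using eq pp by (cases "even j"; cases "even j'") auto
  hence same: "peak N j = peak N j'" using eq by (cases "even j") auto
  have mono: "peak N l' < peak N l" if "l < l'" "2 * l' + 2 < N" for l l'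
    using that
  proof (induction l' rule: less_Suc_induct[case_names step trans])
    case (step i)
    thus ?case by (intro peak_decreasing) simp
  next
    case (trans i j k)
    thus ?case by simp
  qed
  define fold where "fold i = (if 2 * i + 2 < N then i else N - 2 - i)" for i
  have fold: "peak N (fold i) = peak N i \<and> 2 * fold i + 2 < N" if "Suc i < N" for i
  proof (cases "2 * i + 2 < N")
    case False
    have "2 * (N - 2 - i) + 2 < N" using False that N by presburger
    thus ?thesis using False peak_reflect[OF that] by (simp add: fold_def)
  qed (simp add: fold_def)
  have "fold j = fold j'"
    using mono[of "fold j" "fold j'"] mono[of "fold j'" "fold j"] fold[OF j(1)] fold[OF j(2)] same
    by (cases "fold j" "fold j'" rule: linorder_cases) auto
  hence "j = j' \<or> j + j' = N - 2" using j unfolding fold_def by (auto split: if_splits)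
  moreover have "odd (N - 2)" "even (j + j')" using N j par by auto
  ultimately show ?thesis by metis
qed

section \<open>Chords of the unit circle\<close>

text \<open>
  \<open>chord_point \<sigma> \<epsilon> \<phi>\<^sub>1 \<phi>\<^sub>2 w\<close> is the point with \<open>1/r\<^sup>2 = 1 + \<epsilon>w\<close> on the line through \<open>cis \<phi>\<^sub>1\<close> and
  \<open>cis \<phi>\<^sub>2\<close>, near \<open>cis \<phi>\<^sub>2\<close> for \<open>\<sigma> = 1\<close> and near \<open>cis \<phi>\<^sub>1\<close> for \<open>\<sigma> = -1\<close>.
\<close>

definition height :: "nat \<Rightarrow> nat \<Rightarrow> real \<Rightarrow> real \<Rightarrow> real" where
  "height N e \<epsilon> w = fallprod N w * (2 + \<epsilon> * w) ^ e / (1 + \<epsilon> * w) ^ (N + e)"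

definition chord_point :: "real \<Rightarrow> real \<Rightarrow> real \<Rightarrow> real \<Rightarrow> real \<Rightarrow> complex" where
  "chord_point \<sigma> \<epsilon> \<phi>\<^sub>1 \<phi>\<^sub>2 w = cis ((\<phi>\<^sub>1 + \<phi>\<^sub>2) / 2) *
     Complex (cos ((\<phi>\<^sub>2 - \<phi>\<^sub>1) / 2)) (\<sigma> * sqrt (1 / (1 + \<epsilon> * w) - (cos ((\<phi>\<^sub>2 - \<phi>\<^sub>1) / 2))\<^sup>2))"

lemma chord_point_0:
  assumes "0 \<le> \<phi>\<^sub>2 - \<phi>\<^sub>1" "\<phi>\<^sub>2 - \<phi>\<^sub>1 \<le> 2 * pi"
  shows "chord_point 1 0 \<phi>\<^sub>1 \<phi>\<^sub>2 w = cis \<phi>\<^sub>2" "chord_point (-1) 0 \<phi>\<^sub>1 \<phi>\<^sub>2 w = cis \<phi>\<^sub>1"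
proof -
  define \<beta> where "\<beta> = (\<phi>\<^sub>2 - \<phi>\<^sub>1) / 2"
  have "sin \<beta> \<ge> 0" using assms by (intro sin_ge_zero) (auto simp: \<beta>_def)
  moreover have "1 - (cos \<beta>)\<^sup>2 = (sin \<beta>)\<^sup>2" by (simp add: sin_squared_eq)
  ultimately have s: "sqrt (1 - (cos \<beta>)\<^sup>2) = sin \<beta>" by simp
  have "Complex (cos \<beta>) (sin \<beta>) = cis \<beta>" "Complex (cos \<beta>) (- sin \<beta>) = cis (- \<beta>)"
    by (simp_all add: complex_eq_iff)
  thus "chord_point 1 0 \<phi>\<^sub>1 \<phi>\<^sub>2 w = cis \<phi>\<^sub>2" "chord_point (-1) 0 \<phi>\<^sub>1 \<phi>\<^sub>2 w = cis \<phi>\<^sub>1"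
    unfolding chord_point_def \<beta>_def[symmetric] by (simp_all add: s cis_mult) (simp_all add: \<beta>_def field_simps)
qed

lemma norm_chord_point:
  assumes "\<sigma>\<^sup>2 = 1" "(cos ((\<phi>\<^sub>2 - \<phi>\<^sub>1) / 2))\<^sup>2 \<le> 1 / (1 + \<epsilon> * w)"
  shows "(cmod (chord_point \<sigma> \<epsilon> \<phi>\<^sub>1 \<phi>\<^sub>2 w))\<^sup>2 = 1 / (1 + \<epsilon> * w)"
  using assms by (simp add: chord_point_def norm_mult cmod_power2 power_mult_distrib)

lemma uniformly_close:
  fixes f :: "real \<times> 'a::metric_space \<Rightarrow> real"
  assumes "compact K" "continuous_on ({0..1} \<times> K) f" "\<delta> > 0"
  shows "\<exists>\<epsilon>\<^sub>0>0. \<forall>\<epsilon>. 0 \<le> \<epsilon> \<and> \<epsilon> < \<epsilon>\<^sub>0 \<longrightarrow> (\<forall>k\<in>K. \<bar>f (\<epsilon>, k) - f (0, k)\<bar> < \<delta>)"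
proof -
  have "uniformly_continuous_on ({0..1} \<times> K) f"
    using assms by (intro compact_uniformly_continuous compact_Times) auto
  then obtain d where d: "d > 0"
    "\<forall>p\<in>{0..1} \<times> K. \<forall>q\<in>{0..1} \<times> K. dist q p < d \<longrightarrow> dist (f q) (f p) < \<delta>"
    using assms(3) unfolding uniformly_continuous_on_def by meson
  show ?thesis
  proof (intro exI[of _ "min d 1"] conjI allI impI ballI)
    fix \<epsilon> k assume e: "0 \<le> \<epsilon> \<and> \<epsilon> < min d 1" and k: "k \<in> K"
    have "dist (f (\<epsilon>, k)) (f (0, k)) < \<delta>"
      using d(2)[rule_format, of "(0, k)" "(\<epsilon>, k)"] e k by (simp add: dist_Pair_Pair dist_real_def)
    thus "\<bar>f (\<epsilon>, k) - f (0, k)\<bar> < \<delta>" by (simp add: dist_real_def)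
  qed (use d(1) in auto)
qed

lemma continuous_on_chord_point:
  fixes f g h k :: "'a::metric_space \<Rightarrow> real"
  assumes "continuous_on S f" "continuous_on S g" "continuous_on S h" "continuous_on S k"
    "\<And>x. x \<in> S \<Longrightarrow> 1 + f x * k x \<noteq> 0"
  shows "continuous_on S (\<lambda>x. chord_point \<sigma> (f x) (g x) (h x) (k x))"
proof -
  have "continuous_on S (\<lambda>x. cos ((h x - g x) / 2))"
    by (rule continuous_on_cos) (use assms(2,3) in \<open>auto intro!: continuous_intros\<close>)
  moreover have "continuous_on S (\<lambda>x. (g x + h x) / 2)"
    using assms(2,3) by (auto intro!: continuous_intros)
  ultimately show ?thesis unfolding chord_point_def Complex_eq cis_conv_exp
    using assms by (intro continuous_intros) auto
qed

lemma continuous_on_height: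
  assumes "continuous_on S f" "continuous_on S k" "\<And>x. x \<in> S \<Longrightarrow> 1 + f x * k x \<noteq> 0"
  shows "continuous_on S (\<lambda>x. height N e (f x) (k x))"
  unfolding height_def using assms by (auto intro!: continuous_intros)

text \<open>Compactness of the parameter box makes the thickness uniform over all chords, so
  \<open>\<epsilon>\<close> can be fixed before any line is considered.\<close>

lemma chord_limit:
  assumes "\<delta> > 0"
  obtains \<epsilon>\<^sub>0 where "\<epsilon>\<^sub>0 > 0"
    "\<And>\<epsilon> w. 0 \<le> \<epsilon> \<Longrightarrow> \<epsilon> < \<epsilon>\<^sub>0 \<Longrightarrow> w \<in> {0..real N} \<Longrightarrow> \<bar>height N e \<epsilon> w - height N e 0 w\<bar> < \<delta>"
    "\<And>\<epsilon> \<phi>\<^sub>1 \<phi>\<^sub>2 w \<sigma>. 0 \<le> \<epsilon> \<Longrightarrow> \<epsilon> < \<epsilon>\<^sub>0 \<Longrightarrow> w \<in> {0..real N} \<Longrightarrow> \<phi>\<^sub>1 \<in> {0..2 * pi} \<Longrightarrow> \<phi>\<^sub>2 \<in> {0..2 * pi} \<Longrightarrow>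
       \<sigma> \<in> {1, -1} \<Longrightarrow> \<bar>Re (chord_point \<sigma> \<epsilon> \<phi>\<^sub>1 \<phi>\<^sub>2 w ^ n) - Re (chord_point \<sigma> 0 \<phi>\<^sub>1 \<phi>\<^sub>2 w ^ n)\<bar> < \<delta>"
proof -
  have nz: "1 + \<epsilon> * w \<noteq> 0" if "0 \<le> \<epsilon>" "0 \<le> w" for \<epsilon> w :: real
    using mult_nonneg_nonneg[OF that] by linarith
  have "continuous_on ({0..1} \<times> {0..real N}) (\<lambda>p. height N e (fst p) (snd p))"
    by (intro continuous_on_height continuous_intros) (auto simp: nz)
  from uniformly_close[OF compact_Icc this assms] obtain e1 where e1: "e1 > 0"
    "\<forall>\<epsilon>. 0 \<le> \<epsilon> \<and> \<epsilon> < e1 \<longrightarrow> (\<forall>w\<in>{0..real N}. \<bar>height N e \<epsilon> w - height N e 0 w\<bar> < \<delta>)" by auto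
  let ?K = "{0..2 * pi} \<times> {0..2 * pi} \<times> {0..real N}"
  have K: "compact ?K" by (intro compact_Times) auto
  have "\<exists>\<epsilon>\<^sub>0>0. \<forall>\<epsilon>. 0 \<le> \<epsilon> \<and> \<epsilon> < \<epsilon>\<^sub>0 \<longrightarrow> (\<forall>k\<in>?K. \<bar>Re (chord_point \<sigma> \<epsilon> (fst k) (fst (snd k)) (snd (snd k)) ^ n)
      - Re (chord_point \<sigma> 0 (fst k) (fst (snd k)) (snd (snd k)) ^ n)\<bar> < \<delta>)" for \<sigma>
  proof -
    have "continuous_on ({0..1} \<times> ?K) (\<lambda>p. Re (chord_point \<sigma> (fst p) (fst (snd p)) (fst (snd (snd p))) (snd (snd (snd p))) ^ n))"
      by (intro continuous_intros continuous_on_chord_point) (auto simp: nz)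
    from uniformly_close[OF K this assms] show ?thesis by simp
  qed
  from this[of 1] this[of "-1"] obtain e2 e3 where e2: "e2 > 0"
     "\<forall>\<epsilon>. 0 \<le> \<epsilon> \<and> \<epsilon> < e2 \<longrightarrow> (\<forall>k\<in>?K. \<bar>Re (chord_point 1 \<epsilon> (fst k) (fst (snd k)) (snd (snd k)) ^ n)
      - Re (chord_point 1 0 (fst k) (fst (snd k)) (snd (snd k)) ^ n)\<bar> < \<delta>)"
    and e3: "e3 > 0" "\<forall>\<epsilon>. 0 \<le> \<epsilon> \<and> \<epsilon> < e3 \<longrightarrow> (\<forall>k\<in>?K. \<bar>Re (chord_point (-1) \<epsilon> (fst k) (fst (snd k)) (snd (snd k)) ^ n)
      - Re (chord_point (-1) 0 (fst k) (fst (snd k)) (snd (snd k)) ^ n)\<bar> < \<delta>)" by meson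
  show ?thesis
  proof (rule that[of "min e1 (min e2 e3)"])
    show "min e1 (min e2 e3) > 0" using e1 e2 e3 by simp
    show "\<bar>height N e \<epsilon> w - height N e 0 w\<bar> < \<delta>"
      if "0 \<le> \<epsilon>" "\<epsilon> < min e1 (min e2 e3)" "w \<in> {0..real N}" for \<epsilon> w
      using e1(2) that by simp
    show "\<bar>Re (chord_point \<sigma> \<epsilon> \<phi>\<^sub>1 \<phi>\<^sub>2 w ^ n) - Re (chord_point \<sigma> 0 \<phi>\<^sub>1 \<phi>\<^sub>2 w ^ n)\<bar> < \<delta>"
      if "0 \<le> \<epsilon>" "\<epsilon> < min e1 (min e2 e3)" "w \<in> {0..real N}" "\<phi>\<^sub>1 \<in> {0..2 * pi}" "\<phi>\<^sub>2 \<in> {0..2 * pi}" "\<sigma> \<in> {1, -1}"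
      for \<epsilon> \<phi>\<^sub>1 \<phi>\<^sub>2 w \<sigma>
      using e2(2)[rule_format, of \<epsilon> "(\<phi>\<^sub>1, \<phi>\<^sub>2, w)"] e3(2)[rule_format, of \<epsilon> "(\<phi>\<^sub>1, \<phi>\<^sub>2, w)"] that by auto
  qed
qed

context rosette_curve
begin

text \<open>At a zero that is an extremum along the line, the derivative in the direction of the
  line vanishes; by Euler's relation so does the derivative in the direction of the point itself.
  These two directions span all \<open>(u, v, w)\<close> on the line.\<close>

lemma tangent_from_local_max:
  fixes \<alpha> h \<tau>\<^sub>0 s :: real
  defines "F \<equiv> \<lambda>\<tau>. hp_eval (2 * m) c (h * cos \<alpha> - \<tau> * sin \<alpha>) (h * sin \<alpha> + \<tau> * cos \<alpha>) (1 :: real)"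
  assumes s: "s \<noteq> 0" and zero: "F \<tau>\<^sub>0 = 0"
    and max: "d > 0" "\<And>\<tau>. \<bar>\<tau> - \<tau>\<^sub>0\<bar> < d \<Longrightarrow> s * F \<tau> \<le> 0"
  shows "tangent_at (2 * m) c (cos \<alpha>, sin \<alpha>, - h)
      (of_real (h * cos \<alpha> - \<tau>\<^sub>0 * sin \<alpha>), of_real (h * sin \<alpha> + \<tau>\<^sub>0 * cos \<alpha>), 1)"
proof -
  define x where "x = h * cos \<alpha> - \<tau>\<^sub>0 * sin \<alpha>"
  define y where "y = h * sin \<alpha> + \<tau>\<^sub>0 * cos \<alpha>"
  let ?gx = "hp_dx (2 * m) c (of_real x) (of_real y) 1"
  let ?gy = "hp_dy (2 * m) c (of_real x) (of_real y) 1"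
  let ?gz = "hp_dz (2 * m) c (of_real x) (of_real y) 1"
  define D where "D = ?gx * (- of_real (sin \<alpha>)) + ?gy * of_real (cos \<alpha>) + ?gz * 0"
  have 1: "((\<lambda>t. hp_eval (2 * m) c (of_real x + t * (- of_real (sin \<alpha>))) (of_real y + t * of_real (cos \<alpha>)) (1 + t * 0))
     has_field_derivative D) (at (of_real 0))"
    using hp_eval_directional[of "2 * m" c "of_real x" "- of_real (sin \<alpha>)" "of_real y" "of_real (cos \<alpha>)" 1 0 0]
    by (simp add: D_def)
  have Fe: "hp_eval (2 * m) c (of_real x + of_real t * (- of_real (sin \<alpha>))) (of_real y + of_real t * of_real (cos \<alpha>)) (1 + of_real t * 0)
      = complex_of_real (F (\<tau>\<^sub>0 + t))" for t
    unfolding F_def hp_eval_of_real by (simp add: x_def y_def algebra_simps)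
  have 2: "((\<lambda>t. complex_of_real (F (\<tau>\<^sub>0 + t))) has_vector_derivative D) (at 0)"
    using has_vector_derivative_real_field[OF 1] unfolding Fe .
  have re: "((\<lambda>t. F (\<tau>\<^sub>0 + t)) has_real_derivative Re D) (at 0)"
    using bounded_linear.has_vector_derivative[OF bounded_linear_Re 2]
    by (simp add: has_real_derivative_iff_has_vector_derivative)
  \<comment> \<open>The form is real along the line, so the imaginary part of \<open>D\<close> is
    the derivative of 0.\<close>
  have im: "((\<lambda>t::real. 0::real) has_real_derivative Im D) (at 0)"
    using bounded_linear.has_vector_derivative[OF bounded_linear_Im 2]
    by (simp add: has_real_derivative_iff_has_vector_derivative)
  have "Im D = 0" using DERIV_unique[OF im DERIV_const] by simp
  moreover have "Re D = 0"
  proof -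
    have "((\<lambda>t. s * F (\<tau>\<^sub>0 + t)) has_real_derivative s * Re D) (at 0)" by (rule DERIV_cmult[OF re])
    moreover have "\<forall>t. \<bar>0 - t\<bar> < d \<longrightarrow> s * F (\<tau>\<^sub>0 + t) \<le> s * F (\<tau>\<^sub>0 + 0)"
      using max(2) zero by simp
    ultimately have "s * Re D = 0" by (rule DERIV_local_max[OF _ max(1)])
    thus ?thesis using s by simp
  qed
  ultimately have D0: "D = 0" by (simp add: complex_eq_iff)
  have on: "hp_eval (2 * m) c (of_real x) (of_real y) (1 :: complex) = 0"
    using zero hp_eval_of_real[of "2 * m" c x y 1] by (simp add: F_def x_def y_def)
  have euler: "?gx * of_real x + ?gy * of_real y + ?gz * 1 = 0"
    unfolding eval_diff rosette_euler using on eval by simp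
  have xy: "cos \<alpha> * x + sin \<alpha> * y = h"
  proof -
    have "p * (h * p - \<tau>\<^sub>0 * q) + q * (h * q + \<tau>\<^sub>0 * p) = h * (q\<^sup>2 + p\<^sup>2)" for p q :: real
      by (simp add: power2_eq_square algebra_simps)
    hence "cos \<alpha> * x + sin \<alpha> * y = h * ((sin \<alpha>)\<^sup>2 + (cos \<alpha>)\<^sup>2)" unfolding x_def y_def .
    thus ?thesis by (simp only: sin_cos_squared_add mult_1_right)
  qed
  have "?gx * u + ?gy * v + ?gz * w = 0"
    if l: "of_real (cos \<alpha>) * u + of_real (sin \<alpha>) * v + of_real (- h) * w = 0" for u v w :: complex
  proof -
    define U where "U = u - w * of_real x"
    define V where "V = v - w * of_real y"
    define \<mu> where "\<mu> = V * of_real (cos \<alpha>) - U * of_real (sin \<alpha>)"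
    have cs: "of_real (sin \<alpha>) * of_real (sin \<alpha>) + of_real (cos \<alpha>) * of_real (cos \<alpha>) = (1 :: complex)"
      by (metis of_real_1 of_real_add of_real_mult power2_eq_square sin_cos_squared_add)
    have "of_real h = of_real (cos \<alpha>) * of_real x + of_real (sin \<alpha>) * (of_real y :: complex)"
      by (simp flip: of_real_mult of_real_add add: xy)
    hence z: "of_real (cos \<alpha>) * U + of_real (sin \<alpha>) * V = 0" using l by (simp add: U_def V_def algebra_simps)
    have "U = (of_real (sin \<alpha>) * of_real (sin \<alpha>) + of_real (cos \<alpha>) * of_real (cos \<alpha>)) * U" by (simp only: cs mult_1)
    also have "\<dots> = of_real (cos \<alpha>) * (of_real (cos \<alpha>) * U + of_real (sin \<alpha>) * V) - of_real (sin \<alpha>) * \<mu>"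
      by (simp add: \<mu>_def algebra_simps)
    finally have U: "U = - of_real (sin \<alpha>) * \<mu>" unfolding z by simp
    have "V = (of_real (sin \<alpha>) * of_real (sin \<alpha>) + of_real (cos \<alpha>) * of_real (cos \<alpha>)) * V" by (simp only: cs mult_1)
    also have "\<dots> = of_real (sin \<alpha>) * (of_real (cos \<alpha>) * U + of_real (sin \<alpha>) * V) + of_real (cos \<alpha>) * \<mu>"
      by (simp add: \<mu>_def algebra_simps)
    finally have V: "V = of_real (cos \<alpha>) * \<mu>" unfolding z by simp
    have "?gx * u + ?gy * v + ?gz * w = w * (?gx * of_real x + ?gy * of_real y + ?gz * 1) + (?gx * U + ?gy * V)"
      by (simp add: U_def V_def algebra_simps)
    also have "?gx * U + ?gy * V = \<mu> * D" unfolding U V D_def by (simp add: algebra_simps)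
    finally show ?thesis unfolding euler D0 by simp
  qed
  moreover have "of_real (cos \<alpha>) * of_real x + of_real (sin \<alpha>) * of_real y + of_real (- h) * (1 :: complex) = 0"
    by (simp flip: of_real_mult of_real_add add: xy)
  ultimately show ?thesis
    unfolding tangent_at_def prod.case x_def[symmetric] y_def[symmetric] using on by simp
qed

end

section \<open>Curves in a thin ring\<close>

text \<open>On the ring \<open>q\<close> has size \<open>\<epsilon>^N\<close>, so \<open>A\<close>
  is scaled in the same way and \<open>B\<close> keeps its size while the ring shrinks. For
  \<open>e = 1\<close> the additional conic is \<open>z^2 + x^2 + y^2 = 0\<close>.\<close>

locale ring_curve = rosette_curve m a A c
  for m a A c +
  fixes N e :: nat and \<epsilon> B :: real
  assumes N: "odd N" and e: "e \<le> 1" and m_eq: "m = N + e" and eps: "\<epsilon> > 0"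
    and a_eq: "\<And>i. a i = (if i < N then 1 + \<epsilon> * real i else -1)"
    and A_eq: "A = \<epsilon> ^ N * B"
begin

text \<open>The origin of \<open>height\<close>: here \<open>s\<close> is
  \<open>1 + \<epsilon> w\<close>, the factor \<open>2 + \<epsilon> w\<close> is
  \<open>s + 1\<close> from the conic without real points, and the denominator \<open>s^m\<close>
  comes from the normalisation \<open>z = 1\<close>.\<close>

lemma ring_eval:
  assumes w: "w \<ge> 0" and \<zeta>: "(cmod \<zeta>)\<^sup>2 = 1 / (1 + \<epsilon> * w)"
  shows "hp_eval (2 * m) c (Re \<zeta>) (Im \<zeta>) 1 = \<epsilon> ^ N * (height N e \<epsilon> w - B * Re (\<zeta> ^ (2 * m)))"
proof -
  define r where "r = 1 + \<epsilon> * w"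
  have r: "r > 0" using w eps by (simp add: r_def add_pos_nonneg)
  have rr: "(Re \<zeta>)\<^sup>2 + (Im \<zeta>)\<^sup>2 = 1 / r" using \<zeta> by (simp add: cmod_power2 r_def)
  have 1: "1\<^sup>2 - a i * (1 / r) = (\<epsilon> * (w - real i)) / r" if "i < N" for i
    using that r by (simp add: a_eq field_simps r_def)
  have 2: "1\<^sup>2 - a i * (1 / r) = (2 + \<epsilon> * w) / r" if "i \<ge> N" for i
    using that r by (simp add: a_eq field_simps r_def)
  have "(\<Prod>i<m. 1\<^sup>2 - a i * (1 / r)) = (\<Prod>i<N. 1\<^sup>2 - a i * (1 / r)) * (\<Prod>i=N..<N + e. 1\<^sup>2 - a i * (1 / r))"
    unfolding m_eq by (subst prod.union_disjoint[symmetric]) (auto intro!: prod.cong)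
  also have "(\<Prod>i<N. 1\<^sup>2 - a i * (1 / r)) = (\<Prod>i<N. (\<epsilon> * (w - real i)) / r)"
    by (intro prod.cong refl 1) simp
  also have "\<dots> = \<epsilon> ^ N * fallprod N w / r ^ N"
    by (simp only: prod_dividef prod.distrib prod_constant card_lessThan fallprod_def)
  also have "(\<Prod>i=N..<N + e. 1\<^sup>2 - a i * (1 / r)) = (\<Prod>i=N..<N + e. (2 + \<epsilon> * w) / r)"
    by (intro prod.cong refl 2) simp
  also have "\<dots> = (2 + \<epsilon> * w) ^ e / r ^ e" by (simp add: power_divide)
  finally have "(\<Prod>i<m. 1\<^sup>2 - a i * (1 / r)) = \<epsilon> ^ N * height N e \<epsilon> w"
    by (simp add: height_def r_def power_add)
  thus ?thesis unfolding real_eval rr A_eq by (simp add: algebra_simps)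
qed

text \<open>The window parameter \<open>w\<close> is exchanged for the arc length
  \<open>\<tau>\<close> along the line, with inverse \<open>W\<close> on the side given by
  \<open>\<sigma>\<close>; a maximum over the window is then a local maximum in
  \<open>\<tau>\<close>. By \<open>rad\<close> the circles of the window meet the line
  transversally, so the two sides stay apart.\<close>

lemma chord_tangent:
  fixes \<phi>\<^sub>1 \<phi>\<^sub>2 \<sigma> s w\<^sub>0 lo hi :: real
  assumes \<sigma>: "\<sigma> \<in> {1, -1}" and s: "s \<noteq> 0" and lo: "0 \<le> lo" and w0: "lo < w\<^sub>0" "w\<^sub>0 < hi"
    and rad: "\<And>w. w \<in> {lo..hi} \<Longrightarrow> (cos ((\<phi>\<^sub>2 - \<phi>\<^sub>1) / 2))\<^sup>2 < 1 / (1 + \<epsilon> * w)"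
    and max: "\<And>w. w \<in> {lo..hi} \<Longrightarrow> s * (height N e \<epsilon> w - B * Re (chord_point \<sigma> \<epsilon> \<phi>\<^sub>1 \<phi>\<^sub>2 w ^ (2 * m))) \<le> 0"
    and zero: "height N e \<epsilon> w\<^sub>0 - B * Re (chord_point \<sigma> \<epsilon> \<phi>\<^sub>1 \<phi>\<^sub>2 w\<^sub>0 ^ (2 * m)) = 0"
  shows "tangent_at (2 * m) c (cos ((\<phi>\<^sub>1 + \<phi>\<^sub>2) / 2), sin ((\<phi>\<^sub>1 + \<phi>\<^sub>2) / 2), - cos ((\<phi>\<^sub>2 - \<phi>\<^sub>1) / 2))
     (of_real (Re (chord_point \<sigma> \<epsilon> \<phi>\<^sub>1 \<phi>\<^sub>2 w\<^sub>0)), of_real (Im (chord_point \<sigma> \<epsilon> \<phi>\<^sub>1 \<phi>\<^sub>2 w\<^sub>0)), 1)"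
proof -
  define \<alpha> where "\<alpha> = (\<phi>\<^sub>1 + \<phi>\<^sub>2) / 2"
  define h where "h = cos ((\<phi>\<^sub>2 - \<phi>\<^sub>1) / 2)"
  define t where "t w = \<sigma> * sqrt (1 / (1 + \<epsilon> * w) - h\<^sup>2)" for w
  define F where "F \<tau> = hp_eval (2 * m) c (h * cos \<alpha> - \<tau> * sin \<alpha>) (h * sin \<alpha> + \<tau> * cos \<alpha>) (1 :: real)" for \<tau>
  have P: "Re (chord_point \<sigma> \<epsilon> \<phi>\<^sub>1 \<phi>\<^sub>2 w) = h * cos \<alpha> - t w * sin \<alpha>"
    "Im (chord_point \<sigma> \<epsilon> \<phi>\<^sub>1 \<phi>\<^sub>2 w) = h * sin \<alpha> + t w * cos \<alpha>" for w
    unfolding chord_point_def \<alpha>_def[symmetric] h_def[symmetric] t_def by (simp_all add: algebra_simps)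
  have \<sigma>2: "\<sigma>\<^sup>2 = 1" using \<sigma> by auto
  have Ft: "F (t w) = \<epsilon> ^ N * (height N e \<epsilon> w - B * Re (chord_point \<sigma> \<epsilon> \<phi>\<^sub>1 \<phi>\<^sub>2 w ^ (2 * m)))" if "w \<in> {lo..hi}" for w
    unfolding F_def P[symmetric] using that lo rad[OF that]
    by (intro ring_eval norm_chord_point \<sigma>2) auto
  have w0': "w\<^sub>0 \<in> {lo..hi}" using w0 by simp
  define t0 where "t0 = t w\<^sub>0"
  have pos: "1 / (1 + \<epsilon> * w\<^sub>0) - h\<^sup>2 > 0" using rad[OF w0'] by (simp add: h_def)
  have "t0\<^sup>2 = 1 / (1 + \<epsilon> * w\<^sub>0) - h\<^sup>2" unfolding t0_def t_def power_mult_distrib \<sigma>2 using pos by simp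
  moreover have "\<sigma> * t0 = \<sigma>\<^sup>2 * sqrt (1 / (1 + \<epsilon> * w\<^sub>0) - h\<^sup>2)" by (simp add: t0_def t_def power2_eq_square)
  ultimately have t0: "\<sigma> * t0 > 0" "h\<^sup>2 + t0\<^sup>2 = 1 / (1 + \<epsilon> * w\<^sub>0)" using pos \<sigma>2 by simp_all
  define W where "W \<tau> = (1 / (h\<^sup>2 + \<tau>\<^sup>2) - 1) / \<epsilon>" for \<tau>
  have W0: "W t0 = w\<^sub>0" unfolding W_def t0(2) using eps by simp
  have "h\<^sup>2 + t0\<^sup>2 \<noteq> 0" using t0(1) by (auto simp: sum_power2_eq_zero_iff)
  hence "isCont W t0" unfolding W_def using eps by (intro continuous_intros) auto
  hence "eventually (\<lambda>\<tau>. W \<tau> \<in> {lo<..<hi}) (at t0)"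
    unfolding isCont_def W0 by (rule topological_tendstoD) (use w0 in auto)
  moreover have "eventually (\<lambda>\<tau>. \<sigma> * \<tau> > 0) (at t0)"
    by (rule order_tendstoD(1)[OF _ t0(1)]) (auto intro!: tendsto_intros)
  ultimately have "eventually (\<lambda>\<tau>. W \<tau> \<in> {lo<..<hi} \<and> \<sigma> * \<tau> > 0) (at t0)" by (rule eventually_conj)
  then obtain d where d: "d > 0" "\<And>\<tau>. \<tau> \<noteq> t0 \<Longrightarrow> dist \<tau> t0 < d \<Longrightarrow> W \<tau> \<in> {lo<..<hi} \<and> \<sigma> * \<tau> > 0"
    unfolding eventually_at by auto
  have "s * F \<tau> \<le> 0" if "\<bar>\<tau> - t0\<bar> < d" for \<tau>
  proof -
    have W: "W \<tau> \<in> {lo<..<hi}" "\<sigma> * \<tau> > 0"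
      using d(2)[of \<tau>] that W0 w0 t0(1) by (cases "\<tau> = t0"; auto simp: dist_real_def)+
    have hp: "h\<^sup>2 + \<tau>\<^sup>2 > 0" using W(2) by (auto simp: sum_power2_gt_zero_iff)
    have "1 / (1 + \<epsilon> * W \<tau>) = h\<^sup>2 + \<tau>\<^sup>2" using eps hp by (simp add: W_def)
    hence "t (W \<tau>) = \<sigma> * \<bar>\<tau>\<bar>" by (simp add: t_def)
    also have "\<dots> = \<tau>" using \<sigma> W(2) by auto
    finally have "F \<tau> = \<epsilon> ^ N * (height N e \<epsilon> (W \<tau>) - B * Re (chord_point \<sigma> \<epsilon> \<phi>\<^sub>1 \<phi>\<^sub>2 (W \<tau>) ^ (2 * m)))"
      using Ft[of "W \<tau>"] W(1) by simp
    hence "s * F \<tau> = \<epsilon> ^ N * (s * (height N e \<epsilon> (W \<tau>) - B * Re (chord_point \<sigma> \<epsilon> \<phi>\<^sub>1 \<phi>\<^sub>2 (W \<tau>) ^ (2 * m))))"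
      by (simp add: mult_ac)
    also have "\<dots> \<le> 0" using W(1) eps by (intro mult_nonneg_nonpos[OF _ max]) auto
    finally show ?thesis .
  qed
  moreover have "F t0 = 0" using Ft[OF w0'] zero by (simp add: t0_def)
  ultimately have "tangent_at (2 * m) c (cos \<alpha>, sin \<alpha>, - h)
      (of_real (h * cos \<alpha> - t0 * sin \<alpha>), of_real (h * sin \<alpha> + t0 * cos \<alpha>), 1)"
    unfolding F_def using s d(1) by (intro tangent_from_local_max[of s h \<alpha> t0 d]) auto
  thus ?thesis unfolding P t0_def \<alpha>_def h_def .
qed

end

section \<open>Constructing bitangents\<close>

text \<open>The first hypothesis says that \<open>cis x\<close> lies on the line through
  \<open>cis \<phi>\<^sub>1\<close> and \<open>cis \<phi>\<^sub>2\<close>, that is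
  \<open>cos (x - M) = cos H\<close>. This is how the two angles are recovered from a line.\<close>

lemma chord_endpoints:
  fixes \<phi>\<^sub>1 \<phi>\<^sub>2 x :: real
  assumes "cos ((\<phi>\<^sub>1 + \<phi>\<^sub>2) / 2) * cos x + sin ((\<phi>\<^sub>1 + \<phi>\<^sub>2) / 2) * sin x = cos ((\<phi>\<^sub>2 - \<phi>\<^sub>1) / 2)"
    and "\<bar>x - \<phi>\<^sub>1\<bar> < 2 * pi" "\<bar>x - \<phi>\<^sub>2\<bar> < 2 * pi"
  shows "x = \<phi>\<^sub>1 \<or> x = \<phi>\<^sub>2"
proof -
  define M where "M = (\<phi>\<^sub>1 + \<phi>\<^sub>2) / 2"
  define H where "H = (\<phi>\<^sub>2 - \<phi>\<^sub>1) / 2"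
  have MH: "\<phi>\<^sub>1 = M - H" "\<phi>\<^sub>2 = M + H" by (simp_all add: M_def H_def field_simps)
  have "cos (x - M) - cos H = 0"
    using assms(1) unfolding M_def[symmetric] H_def[symmetric] cos_diff by (simp add: mult.commute)
  hence "sin ((x - M + H) / 2) = 0 \<or> sin ((H - (x - M)) / 2) = 0"
    using cos_diff_cos[of "x - M" H] by simp
  moreover have "- pi < (x - M + H) / 2" "(x - M + H) / 2 < pi" "- pi < (H - (x - M)) / 2" "(H - (x - M)) / 2 < pi"
    using assms(2,3) unfolding MH by (simp_all add: abs_less_iff)
  ultimately have "(x - M + H) / 2 = 0 \<or> (H - (x - M)) / 2 = 0"
    using sin_eq_0_pi by blast
  hence "x = M - H \<or> x = M + H" by (elim disjE) (rule disjI1, simp, rule disjI2, simp)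
  thus ?thesis unfolding MH .
qed

text \<open>On a zone \<open>cos (n \<phi>)\<close> runs monotonically between 1 and -1; for
  \<open>n = 2 m\<close> there are \<open>4 m\<close> zones in a full turn.\<close>

definition zone :: "nat \<Rightarrow> nat \<Rightarrow> real set" where
  "zone n l = {pi * real l / real n..pi * real (Suc l) / real n}"

lemma cos_zone_end: "n > 0 \<Longrightarrow> cos (real n * (pi * real l / real n)) = (-1) ^ l"
  by (simp add: cos_npi2)

text \<open>Distinct zones share at most an end, and there the cosine is 1 or -1.\<close>

lemma zone_unique:
  assumes "n > 0" "\<phi> \<in> zone n l" "\<phi> \<in> zone n l'" "\<bar>cos (real n * \<phi>)\<bar> < 1"
  shows "l = l'"
proof -
  have *: "\<not> l < l'" if "\<phi> \<in> zone n l" "\<phi> \<in> zone n l'" for l l'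
  proof
    assume "l < l'"
    hence "real (Suc l) \<le> real l'" by (simp only: of_nat_le_iff Suc_le_eq)
    hence "pi * real (Suc l) / real n \<le> pi * real l' / real n" by (intro divide_right_mono mult_left_mono) auto
    hence "\<phi> = pi * real (Suc l) / real n" using that by (simp add: zone_def)
    hence "\<bar>cos (real n * \<phi>)\<bar> = 1" using cos_zone_end[OF assms(1), of "Suc l"] by (simp only: power_abs abs_minus_cancel abs_one power_one)
    thus False using assms(4) by simp
  qed
  show ?thesis using *[of l l'] *[of l' l] assms(2,3) by (cases l l' rule: linorder_cases) auto
qed

context ring_curve
begin

text \<open>
  Along a chord the equation of the curve is a nonzero multiple of the \<open>excess\<close>, so a zero maximum
  of the \<open>excess\<close> in the interior of a window \<open>[j, j+1]\<close> is a tangency.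
\<close>

definition excess :: "real \<Rightarrow> nat \<Rightarrow> real \<times> real \<Rightarrow> real \<Rightarrow> real" where
  "excess \<sigma> j p w = (-1) ^ j * (height N e \<epsilon> w - B * Re (chord_point \<sigma> \<epsilon> (fst p) (snd p) w ^ (2 * m)))"

definition max_excess :: "real \<Rightarrow> nat \<Rightarrow> real \<times> real \<Rightarrow> real" where
  "max_excess \<sigma> j p = (SUP w\<in>{real j..real (Suc j)}. excess \<sigma> j p w)"

lemma one_plus_ne_0: "w \<ge> 0 \<Longrightarrow> 1 + \<epsilon> * w \<noteq> 0"
  using eps mult_nonneg_nonneg[of \<epsilon> w] by linarith

lemma continuous_on_excess:
  assumes "W \<subseteq> {0..}"
  shows "continuous_on (X \<times> W) (\<lambda>q. excess \<sigma> j (fst q) (snd q))"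
  unfolding excess_def using assms
  by (intro continuous_intros continuous_on_height continuous_on_chord_point)
    (auto simp: one_plus_ne_0 subset_iff)

lemma max_excess_attained:
  obtains w where "w \<in> {real j..real (Suc j)}" "max_excess \<sigma> j p = excess \<sigma> j p w"
    "\<And>v. v \<in> {real j..real (Suc j)} \<Longrightarrow> excess \<sigma> j p v \<le> excess \<sigma> j p w"
proof -
  have "continuous_on {real j..real (Suc j)} (excess \<sigma> j p)"
    by (rule continuous_on_compose2[OF continuous_on_excess[of "{real j..real (Suc j)}" "{p}" \<sigma> j], of _ "\<lambda>w. (p, w)", simplified])
      (auto intro!: continuous_intros)
  from SUP_attained[OF compact_Icc _ this] obtain w where
    "w \<in> {real j..real (Suc j)}" "(SUP w\<in>{real j..real (Suc j)}. excess \<sigma> j p w) = excess \<sigma> j p w"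
    "\<And>v. v \<in> {real j..real (Suc j)} \<Longrightarrow> excess \<sigma> j p v \<le> excess \<sigma> j p w" by auto
  thus ?thesis by (intro that) (auto simp: max_excess_def)
qed

lemma continuous_on_max_excess:
  assumes "compact X"
  shows "continuous_on X (max_excess \<sigma> j)"
proof -
  have "continuous_on (X \<times> {real j..real (Suc j)}) (\<lambda>q. excess \<sigma> j (fst q) (snd q))"
    by (rule continuous_on_excess) auto
  from continuous_on_SUP[OF assms compact_Icc _ this] show ?thesis
    unfolding max_excess_def[abs_def] by simp
qed

end

text \<open>The error in \<open>max_excess\<close>, when the ring is replaced by the unit circle, is
  at most \<open>\<delta> * (1 + B)\<close>. It must be small against the peaks and against the gaps
  between signed peaks; the factor 2 allows for two such errors. \<open>B_large\<close> keeps the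
  signed peaks strictly inside the range of \<open>B cos\<close>, and the angle in
  \<open>thin\<close> is half the length of a zone.\<close>

locale thin_ring_curve = ring_curve +
  fixes \<delta> :: real
  assumes B_large: "Suc j < N \<Longrightarrow> 2 ^ e * peak N j + 1 \<le> B"
    and B_pos: "B > 0" and \<delta>: "\<delta> > 0" "\<delta> * (1 + B) < 1"
    and \<delta>_peak: "Suc j < N \<Longrightarrow> 2 * (\<delta> * (1 + B)) < 2 ^ e * peak N j"
    and \<delta>_gap: "Suc j < N \<Longrightarrow> Suc j' < N \<Longrightarrow> j \<noteq> j' \<Longrightarrow>
        2 * (\<delta> * (1 + B)) < \<bar>2 ^ e * ((-1) ^ j * peak N j) - 2 ^ e * ((-1) ^ j' * peak N j')\<bar>"
    and close_height: "w \<in> {0..real N} \<Longrightarrow> \<bar>height N e \<epsilon> w - height N e 0 w\<bar> < \<delta>"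
    and close_point: "w \<in> {0..real N} \<Longrightarrow> \<phi>\<^sub>1 \<in> {0..2 * pi} \<Longrightarrow> \<phi>\<^sub>2 \<in> {0..2 * pi} \<Longrightarrow> \<sigma> \<in> {1, -1} \<Longrightarrow>
       \<bar>Re (chord_point \<sigma> \<epsilon> \<phi>\<^sub>1 \<phi>\<^sub>2 w ^ (2 * m)) - Re (chord_point \<sigma> 0 \<phi>\<^sub>1 \<phi>\<^sub>2 w ^ (2 * m))\<bar> < \<delta>"
    and thin: "\<epsilon> * real N < (sin (pi / real (4 * m)))\<^sup>2"
begin

definition end_angle :: "real \<Rightarrow> real \<times> real \<Rightarrow> real" where
  "end_angle \<sigma> p = (if \<sigma> = 1 then snd p else fst p)"

lemma chord_power_0:
  assumes "p \<in> {0..2 * pi} \<times> {0..2 * pi}" "fst p \<le> snd p" "\<sigma> \<in> {1, -1}"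
  shows "Re (chord_point \<sigma> 0 (fst p) (snd p) w ^ (2 * m)) = cos (real (2 * m) * end_angle \<sigma> p)"
proof -
  have "chord_point \<sigma> 0 (fst p) (snd p) w = cis (end_angle \<sigma> p)"
  proof -
    have "0 \<le> snd p - fst p" "snd p - fst p \<le> 2 * pi" using assms(1,2) by (auto simp: mem_Times_iff)
    from chord_point_0[OF this] show ?thesis using assms(3) by (auto simp: end_angle_def)
  qed
  thus ?thesis by (simp only: Complex.DeMoivre cis.sel)
qed

text \<open>For the collapsed ring the cosine term does not depend on \<open>w\<close>, so the
  supremum is the peak minus that term. The error is \<open>\<delta>\<close> from
  \<open>height\<close> plus \<open>B \<delta>\<close> from the chord point.\<close>

lemma max_excess_close:
  assumes p: "p \<in> {0..2 * pi} \<times> {0..2 * pi}" "fst p \<le> snd p" and \<sigma>: "\<sigma> \<in> {1, -1}" and j: "Suc j < N"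
  shows "\<bar>max_excess \<sigma> j p - (2 ^ e * peak N j - (-1) ^ j * B * cos (real (2 * m) * end_angle \<sigma> p))\<bar> \<le> \<delta> * (1 + B)"
proof -
  let ?W = "{real j..real (Suc j)}"
  define C where "C = (-1) ^ j * B * cos (real (2 * m) * end_angle \<sigma> p)"
  define g where "g w = 2 ^ e * \<bar>fallprod N w\<bar> - C" for w
  obtain w where w: "w \<in> ?W" "peak N j = \<bar>fallprod N w\<bar>" "\<And>v. v \<in> ?W \<Longrightarrow> \<bar>fallprod N v\<bar> \<le> \<bar>fallprod N w\<bar>"
    using peak_attained[of j N] by metis
  have g_le: "g v \<le> g w" if "v \<in> ?W" for v unfolding g_def using w(3)[OF that] by simp
  have g: "(SUP w\<in>?W. g w) = 2 ^ e * peak N j - C"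
    unfolding w(2) g_def[symmetric] by (rule cSup_eq_maximum) (use w(1) g_le in auto)
  obtain u where u: "\<And>v. v \<in> ?W \<Longrightarrow> excess \<sigma> j p v \<le> excess \<sigma> j p u"
    using max_excess_attained[of j \<sigma> p] by metis
  have diff: "\<bar>excess \<sigma> j p v - g v\<bar> \<le> \<delta> * (1 + B)" if v: "v \<in> ?W" for v
  proof -
    have "real (Suc j) \<le> real N" using j by (simp only: of_nat_le_iff less_imp_le)
    hence vN: "v \<in> {0..real N}" using v by auto
    define x where "x = height N e \<epsilon> v - height N e 0 v"
    define y where "y = Re (chord_point \<sigma> \<epsilon> (fst p) (snd p) v ^ (2 * m)) - Re (chord_point \<sigma> 0 (fst p) (snd p) v ^ (2 * m))"
    have h0: "(-1) ^ j * height N e 0 v = 2 ^ e * \<bar>fallprod N v\<bar>"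
      unfolding fallprod_sign[OF N j v, symmetric] by (simp add: height_def)
    have "excess \<sigma> j p v - g v = (-1) ^ j * (x - B * y)"
      unfolding g_def h0[symmetric] C_def chord_power_0[OF p \<sigma>, of v, symmetric] excess_def x_def y_def
      by (simp add: algebra_simps)
    hence "\<bar>excess \<sigma> j p v - g v\<bar> = \<bar>x - B * y\<bar>" by (simp add: abs_mult power_abs)
    also have "\<dots> \<le> \<bar>x\<bar> + B * \<bar>y\<bar>" using abs_triangle_ineq4[of x "B * y"] B_pos by (simp add: abs_mult)
    also have "\<dots> \<le> \<delta> + B * \<delta>"
      using close_height[OF vN] close_point[OF vN _ _ \<sigma>, of "fst p" "snd p"] p(1) B_pos
      unfolding x_def y_def by (intro add_mono mult_left_mono) (auto simp: mem_Times_iff)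
    finally show ?thesis by (simp add: algebra_simps)
  qed
  have "\<bar>(SUP w\<in>?W. excess \<sigma> j p w) - (SUP w\<in>?W. g w)\<bar> \<le> \<delta> * (1 + B)"
  proof (rule SUP_close)
    show "bdd_above (excess \<sigma> j p ` ?W)" "bdd_above (g ` ?W)" 
      using u g_le bdd_aboveI2[of ?W "excess \<sigma> j p" "excess \<sigma> j p u"] bdd_aboveI2[of ?W g "g w"] by simp_all
  qed (use diff in auto)
  thus ?thesis unfolding g C_def max_excess_def .
qed

text \<open>One zone is left free between the two, and so is zone 0, the cyclic neighbour of the
  last zone. Hence the half angle stays between \<open>pi / (4 m)\<close> and
  \<open>pi - pi / (4 m)\<close>, and the line is closer to the centre than every circle of the
  ring.\<close>

lemma thin_chord:
  assumes "l\<^sub>1 \<ge> 1" "l\<^sub>1 + 2 \<le> l\<^sub>2" "l\<^sub>2 < 4 * m" "\<phi>\<^sub>1 \<in> zone (2 * m) l\<^sub>1" "\<phi>\<^sub>2 \<in> zone (2 * m) l\<^sub>2"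
  shows "0 < \<phi>\<^sub>1" "\<phi>\<^sub>1 < \<phi>\<^sub>2" "\<phi>\<^sub>2 \<le> 2 * pi"
    and "\<And>w. w \<in> {0..real N} \<Longrightarrow> (cos ((\<phi>\<^sub>2 - \<phi>\<^sub>1) / 2))\<^sup>2 < 1 / (1 + \<epsilon> * w)"
proof -
  define \<gamma> where "\<gamma> = pi / real (4 * m)"
  have m': "real m \<ge> 1" using m by simp
  have \<gamma>: "\<gamma> > 0" "\<gamma> \<le> pi / 4" using m' by (auto simp: \<gamma>_def field_simps)
  have z: "2 * \<gamma> * real l\<^sub>1 \<le> \<phi>\<^sub>1" "\<phi>\<^sub>1 \<le> 2 * \<gamma> * real (Suc l\<^sub>1)" "2 * \<gamma> * real l\<^sub>2 \<le> \<phi>\<^sub>2" "\<phi>\<^sub>2 \<le> 2 * \<gamma> * real (Suc l\<^sub>2)"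
    using assms(4,5) by (simp_all add: zone_def \<gamma>_def)
  have l1: "2 * \<gamma> * 1 \<le> 2 * \<gamma> * real l\<^sub>1" using assms(1) \<gamma> by (intro mult_left_mono) auto
  have l12: "2 * \<gamma> * (real (Suc l\<^sub>1) + 1) \<le> 2 * \<gamma> * real l\<^sub>2" using assms(2) \<gamma> by (intro mult_left_mono) auto
  have l2: "2 * \<gamma> * real (Suc l\<^sub>2) \<le> 2 * \<gamma> * real (4 * m)"
  proof (rule mult_left_mono)
    show "real (Suc l\<^sub>2) \<le> real (4 * m)" using assms(3) by (simp only: of_nat_le_iff Suc_le_eq)
  qed (use \<gamma> in simp)
  have top: "2 * \<gamma> * real (4 * m) = 2 * pi" using m' by (simp add: \<gamma>_def)
  show "0 < \<phi>\<^sub>1" using z(1) l1 \<gamma>(1) by linarith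
  show "\<phi>\<^sub>1 < \<phi>\<^sub>2" using z l12 \<gamma>(1) by (simp add: algebra_simps)
  show "\<phi>\<^sub>2 \<le> 2 * pi" using z l2 top by linarith
  define \<beta> where "\<beta> = (\<phi>\<^sub>2 - \<phi>\<^sub>1) / 2"
  have "\<phi>\<^sub>2 \<le> 2 * pi" "2 * \<gamma> \<le> \<phi>\<^sub>1" using z l1 l2 top by linarith+
  moreover have "2 * \<gamma> \<le> \<phi>\<^sub>2 - \<phi>\<^sub>1" using z l12 by (simp add: algebra_simps)
  ultimately have \<beta>: "\<gamma> \<le> \<beta>" "\<beta> \<le> pi - \<gamma>" by (simp_all add: \<beta>_def field_simps)
  have "sin \<gamma> \<le> sin \<beta>"
  proof (cases "\<beta> \<le> pi / 2")
    case True
    show ?thesis using \<beta> True \<gamma> by (intro sin_monotone_2pi_le) auto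
  next
    case False
    have "sin \<gamma> \<le> sin (pi - \<beta>)" using \<beta> False \<gamma> by (intro sin_monotone_2pi_le) auto
    thus ?thesis by simp
  qed
  moreover have "sin \<gamma> > 0" using \<gamma> pi_gt_zero by (intro sin_gt_zero) linarith+
  ultimately have sq: "(sin \<gamma>)\<^sup>2 \<le> (sin \<beta>)\<^sup>2" by (intro power_mono) auto
  fix w assume w: "w \<in> {0..real N}"
  have ew: "0 \<le> \<epsilon> * w" "\<epsilon> * w \<le> \<epsilon> * real N" using w eps by auto
  have "(cos \<beta>)\<^sup>2 = 1 - (sin \<beta>)\<^sup>2" by (simp add: cos_squared_eq)
  also have "\<dots> < 1 - \<epsilon> * w" using sq thin ew by (simp add: \<gamma>_def)
  also have "1 - \<epsilon> * w \<le> 1 / (1 + \<epsilon> * w)"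
  proof -
    have "(1 - \<epsilon> * w) * (1 + \<epsilon> * w) \<le> 1" using eps w by (simp add: algebra_simps)
    thus ?thesis using ew by (simp add: pos_le_divide_eq)
  qed
  finally show "(cos ((\<phi>\<^sub>2 - \<phi>\<^sub>1) / 2))\<^sup>2 < 1 / (1 + \<epsilon> * w)" by (simp add: \<beta>_def)
qed

text \<open>A zero of \<open>max_excess\<close> puts the cosine of the end angle close to a signed
  peak; \<open>j\<close> is recovered from this later.\<close>

lemma near_critical:
  assumes "p \<in> {0..2 * pi} \<times> {0..2 * pi}" "fst p \<le> snd p" "\<sigma> \<in> {1, -1}" "Suc j < N" "max_excess \<sigma> j p = 0"
  shows "\<bar>2 ^ e * ((-1) ^ j * peak N j) - B * cos (real (2 * m) * end_angle \<sigma> p)\<bar> \<le> \<delta> * (1 + B)"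
proof -
  have "\<bar>2 ^ e * peak N j - (-1) ^ j * B * cos (real (2 * m) * end_angle \<sigma> p)\<bar> \<le> \<delta> * (1 + B)"
    using max_excess_close[OF assms(1-4)] assms(5) by (simp add: abs_minus_commute)
  moreover have "2 ^ e * peak N j - (-1) ^ j * B * cos (real (2 * m) * end_angle \<sigma> p) =
     (-1) ^ j * (2 ^ e * ((-1) ^ j * peak N j) - B * cos (real (2 * m) * end_angle \<sigma> p))"
  proof -
    have "E * P - u * B * C = u * (E * (u * P) - B * C)" if "u * u = 1" for u E P C :: real
    proof -
      have "u * (E * (u * P) - B * C) = (u * u) * (E * P) - u * B * C" by (simp add: algebra_simps)
      thus ?thesis using that by simp
    qed
    thus ?thesis by (simp flip: power_mult_distrib)
  qed
  ultimately show ?thesis by (simp add: abs_mult power_abs)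
qed

lemma tangency:
  assumes zones: "l\<^sub>1 \<ge> 1" "l\<^sub>1 + 2 \<le> l\<^sub>2" "l\<^sub>2 < 4 * m" "\<phi>\<^sub>1 \<in> zone (2 * m) l\<^sub>1" "\<phi>\<^sub>2 \<in> zone (2 * m) l\<^sub>2"
    and \<sigma>: "\<sigma> \<in> {1, -1}" and j: "Suc j < N" and zero: "max_excess \<sigma> j (\<phi>\<^sub>1, \<phi>\<^sub>2) = 0"
  obtains w where "w \<in> {0..real N}"
    "tangent_at (2 * m) c (cos ((\<phi>\<^sub>1 + \<phi>\<^sub>2) / 2), sin ((\<phi>\<^sub>1 + \<phi>\<^sub>2) / 2), - cos ((\<phi>\<^sub>2 - \<phi>\<^sub>1) / 2))
     (of_real (Re (chord_point \<sigma> \<epsilon> \<phi>\<^sub>1 \<phi>\<^sub>2 w)), of_real (Im (chord_point \<sigma> \<epsilon> \<phi>\<^sub>1 \<phi>\<^sub>2 w)), 1)"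
proof -
  note t = thin_chord[OF zones]
  have p: "(\<phi>\<^sub>1, \<phi>\<^sub>2) \<in> {0..2 * pi} \<times> {0..2 * pi}" "fst (\<phi>\<^sub>1, \<phi>\<^sub>2) \<le> snd (\<phi>\<^sub>1, \<phi>\<^sub>2)" using t by auto
  have jN: "real (Suc j) < real N" using j by (simp only: of_nat_less_iff)
  obtain w where w: "w \<in> {real j..real (Suc j)}" "max_excess \<sigma> j (\<phi>\<^sub>1, \<phi>\<^sub>2) = excess \<sigma> j (\<phi>\<^sub>1, \<phi>\<^sub>2) w"
    "\<And>v. v \<in> {real j..real (Suc j)} \<Longrightarrow> excess \<sigma> j (\<phi>\<^sub>1, \<phi>\<^sub>2) v \<le> excess \<sigma> j (\<phi>\<^sub>1, \<phi>\<^sub>2) w"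
    using max_excess_attained[of j \<sigma> "(\<phi>\<^sub>1, \<phi>\<^sub>2)"] by metis
  define C where "C = cos (real (2 * m) * end_angle \<sigma> (\<phi>\<^sub>1, \<phi>\<^sub>2))"
  have near: "\<bar>2 ^ e * peak N j - (-1) ^ j * B * C\<bar> \<le> \<delta> * (1 + B)"
    using max_excess_close[OF p \<sigma> j] zero by (simp add: C_def abs_minus_commute)
  \<comment> \<open>At the window ends \<open>fallprod\<close> vanishes, so the excess there is
    about minus the peak; a zero maximum is therefore attained in the interior.\<close>
  have ends: "excess \<sigma> j (\<phi>\<^sub>1, \<phi>\<^sub>2) (real i) < 0" if i: "i = j \<or> i = Suc j" for i
  proof -
    have iN: "i < N" using i j by auto
    define y where "y = Re (chord_point \<sigma> \<epsilon> \<phi>\<^sub>1 \<phi>\<^sub>2 (real i) ^ (2 * m))"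
    have "\<bar>y - C\<bar> < \<delta>"
      using close_point[of "real i" \<phi>\<^sub>1 \<phi>\<^sub>2 \<sigma>] chord_power_0[OF p \<sigma>, of "real i"] iN p \<sigma>
      by (simp add: y_def C_def)
    hence "B * \<bar>y - C\<bar> \<le> B * \<delta>" using B_pos by (intro mult_left_mono) auto
    hence "\<bar>(-1) ^ j * B * C - (-1) ^ j * B * y\<bar> \<le> B * \<delta>"
      using B_pos by (simp add: abs_mult power_abs abs_minus_commute flip: right_diff_distrib)
    moreover have "excess \<sigma> j (\<phi>\<^sub>1, \<phi>\<^sub>2) (real i) = - ((-1) ^ j * B * y)"
      using fallprod_zero[OF iN] by (simp add: excess_def height_def y_def)
    ultimately have "excess \<sigma> j (\<phi>\<^sub>1, \<phi>\<^sub>2) (real i) \<le> - (2 ^ e * peak N j) + \<delta> * (1 + B) + B * \<delta>"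
      using near by linarith
    also have "\<dots> < 0" using \<delta>_peak[OF j] \<delta>(1) by (simp add: algebra_simps)
    finally show ?thesis .
  qed
  have w0: "real j < w" "w < real (Suc j)"
    using ends[of j] ends[of "Suc j"] w(1,2) zero by (auto simp: order.order_iff_strict)
  have sub: "v \<in> {0..real N}" if "v \<in> {real j..real (Suc j)}" for v using that jN by auto
  have "tangent_at (2 * m) c (cos ((\<phi>\<^sub>1 + \<phi>\<^sub>2) / 2), sin ((\<phi>\<^sub>1 + \<phi>\<^sub>2) / 2), - cos ((\<phi>\<^sub>2 - \<phi>\<^sub>1) / 2))
     (of_real (Re (chord_point \<sigma> \<epsilon> \<phi>\<^sub>1 \<phi>\<^sub>2 w)), of_real (Im (chord_point \<sigma> \<epsilon> \<phi>\<^sub>1 \<phi>\<^sub>2 w)), 1)"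
  proof (rule chord_tangent[OF \<sigma>, of "(-1) ^ j" "real j" w "real (Suc j)"])
    show "(-1) ^ j * (height N e \<epsilon> v - B * Re (chord_point \<sigma> \<epsilon> \<phi>\<^sub>1 \<phi>\<^sub>2 v ^ (2 * m))) \<le> 0"
      if "v \<in> {real j..real (Suc j)}" for v
      using w(3)[OF that] w(2) zero by (simp add: excess_def)
    show "height N e \<epsilon> w - B * Re (chord_point \<sigma> \<epsilon> \<phi>\<^sub>1 \<phi>\<^sub>2 w ^ (2 * m)) = 0"
      using w(2) zero by (simp add: excess_def)
  qed (use w0 t(4) sub in auto)
  thus ?thesis using that sub[OF w(1)] by blast
qed

text \<open>Up to the error each \<open>max_excess\<close> depends only on its own end angle. At the
  ends of a zone the cosine is 1 or -1 and \<open>B\<close> exceeds the peak, so the sign changes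
  from one end to the other, and Poincare-Miranda applies to the product of the two zones.\<close>

lemma index_bitangent:
  assumes zones: "l\<^sub>1 \<ge> 1" "l\<^sub>1 + 2 \<le> l\<^sub>2" "l\<^sub>2 < 4 * m" and j: "Suc j\<^sub>1 < N" "Suc j\<^sub>2 < N"
  obtains \<phi>\<^sub>1 \<phi>\<^sub>2 where "\<phi>\<^sub>1 \<in> zone (2 * m) l\<^sub>1" "\<phi>\<^sub>2 \<in> zone (2 * m) l\<^sub>2"
    "\<bar>2 ^ e * ((-1) ^ j\<^sub>1 * peak N j\<^sub>1) - B * cos (real (2 * m) * \<phi>\<^sub>1)\<bar> \<le> \<delta> * (1 + B)"
    "\<bar>2 ^ e * ((-1) ^ j\<^sub>2 * peak N j\<^sub>2) - B * cos (real (2 * m) * \<phi>\<^sub>2)\<bar> \<le> \<delta> * (1 + B)"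
    "real_bitangent (2 * m) c (cos ((\<phi>\<^sub>1 + \<phi>\<^sub>2) / 2), sin ((\<phi>\<^sub>1 + \<phi>\<^sub>2) / 2), - cos ((\<phi>\<^sub>2 - \<phi>\<^sub>1) / 2))"
proof -
  let ?n = "2 * m"
  let ?Z = "zone ?n l\<^sub>1 \<times> zone ?n l\<^sub>2"
  have n: "?n > 0" using m by simp
  have box: "p \<in> {0..2 * pi} \<times> {0..2 * pi}" "fst p \<le> snd p" if "p \<in> ?Z" for p
    using that thin_chord[OF zones, of "fst p" "snd p"] by (auto simp: mem_Times_iff)
  have "compact ?Z" by (intro compact_Times) (auto simp: zone_def)
  note cont = continuous_on_max_excess[OF this]
  have left: "(-1) ^ (j + l) * max_excess \<sigma> j p \<le> 0"
    if "p \<in> ?Z" "\<sigma> \<in> {1, -1}" "Suc j < N" "end_angle \<sigma> p = pi * real l / real ?n" for p \<sigma> j l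
  proof -
    define x where "x = max_excess \<sigma> j p - (2 ^ e * peak N j - (-1) ^ j * B * (-1) ^ l)"
    have x: "\<bar>x\<bar> \<le> \<delta> * (1 + B)"
      using max_excess_close[OF box[OF that(1)] that(2,3)] unfolding that(4) cos_zone_end[OF n] x_def .
    have "(-1) ^ (j + l) * max_excess \<sigma> j p = (-1) ^ (j + l) * x + (-1) ^ (j + l) * (2 ^ e * peak N j) - ((-1) ^ (j + l) * (-1) ^ (j + l)) * B"
      by (simp add: x_def power_add algebra_simps)
    also have "((-1) ^ (j + l) * (-1) ^ (j + l)) = (1::real)" by (simp flip: power_mult_distrib)
    also have "(-1) ^ (j + l) * x \<le> \<bar>x\<bar>" by (cases "even (j + l)") auto
    also have "(-1) ^ (j + l) * (2 ^ e * peak N j) \<le> 2 ^ e * peak N j"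
      using peak_pos[OF that(3)] by (cases "even (j + l)") auto
    finally show ?thesis using x B_large[OF that(3)] \<delta>(2) by linarith
  qed
  \<comment> \<open>The right end of zone \<open>l\<close> is the left end of zone
    \<open>Suc l\<close>, which flips the sign.\<close>
  have right: "(-1) ^ (j + l) * max_excess \<sigma> j p \<ge> 0"
    if "p \<in> ?Z" "\<sigma> \<in> {1, -1}" "Suc j < N" "end_angle \<sigma> p = pi * real (Suc l) / real ?n" for p \<sigma> j l
    using left[OF that] by simp
  have zl: "pi * real l / real ?n \<le> pi * real (Suc l) / real ?n" for l
    by (intro divide_right_mono mult_left_mono) auto
  define f where "f p = (-1) ^ (j\<^sub>1 + l\<^sub>1) * max_excess (-1) j\<^sub>1 p" for p
  define g where "g p = (-1) ^ (j\<^sub>2 + l\<^sub>2) * max_excess 1 j\<^sub>2 p" for p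
  obtain \<phi>\<^sub>1 \<phi>\<^sub>2 where \<phi>: "\<phi>\<^sub>1 \<in> zone ?n l\<^sub>1" "\<phi>\<^sub>2 \<in> zone ?n l\<^sub>2" "f (\<phi>\<^sub>1, \<phi>\<^sub>2) = 0" "g (\<phi>\<^sub>1, \<phi>\<^sub>2) = 0"
  proof (rule poincare_miranda[of "pi * real l\<^sub>1 / real ?n" "pi * real (Suc l\<^sub>1) / real ?n"
        "pi * real l\<^sub>2 / real ?n" "pi * real (Suc l\<^sub>2) / real ?n" f g, folded zone_def])
    show "continuous_on ?Z f" "continuous_on ?Z g" unfolding f_def g_def by (intro continuous_intros cont)+
    show "f (pi * real l\<^sub>1 / real ?n, y) \<le> 0" if "y \<in> zone ?n l\<^sub>2" for y
      unfolding f_def by (rule left) (use that j zl in \<open>auto simp: end_angle_def zone_def\<close>)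
    show "f (pi * real (Suc l\<^sub>1) / real ?n, y) \<ge> 0" if "y \<in> zone ?n l\<^sub>2" for y
      unfolding f_def by (rule right) (use that j zl in \<open>auto simp: end_angle_def zone_def\<close>)
    show "g (x, pi * real l\<^sub>2 / real ?n) \<le> 0" if "x \<in> zone ?n l\<^sub>1" for x
      unfolding g_def by (rule left) (use that j zl in \<open>auto simp: end_angle_def zone_def\<close>)
    show "g (x, pi * real (Suc l\<^sub>2) / real ?n) \<ge> 0" if "x \<in> zone ?n l\<^sub>1" for x
      unfolding g_def by (rule right) (use that j zl in \<open>auto simp: end_angle_def zone_def\<close>)
  qed (use zl in auto)
  have z: "max_excess (-1) j\<^sub>1 (\<phi>\<^sub>1, \<phi>\<^sub>2) = 0" "max_excess 1 j\<^sub>2 (\<phi>\<^sub>1, \<phi>\<^sub>2) = 0"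
    using \<phi>(3,4) by (auto simp: f_def g_def)
  have pZ: "(\<phi>\<^sub>1, \<phi>\<^sub>2) \<in> ?Z" using \<phi> by simp
  let ?l = "(cos ((\<phi>\<^sub>1 + \<phi>\<^sub>2) / 2), sin ((\<phi>\<^sub>1 + \<phi>\<^sub>2) / 2), - cos ((\<phi>\<^sub>2 - \<phi>\<^sub>1) / 2))"
  obtain v where v: "v \<in> {0..real N}" "tangent_at ?n c ?l
     (of_real (Re (chord_point (-1) \<epsilon> \<phi>\<^sub>1 \<phi>\<^sub>2 v)), of_real (Im (chord_point (-1) \<epsilon> \<phi>\<^sub>1 \<phi>\<^sub>2 v)), 1)"
    by (rule tangency[OF zones \<phi>(1,2) _ j(1) z(1)]) auto
  obtain w where w: "w \<in> {0..real N}" "tangent_at ?n c ?l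
     (of_real (Re (chord_point 1 \<epsilon> \<phi>\<^sub>1 \<phi>\<^sub>2 w)), of_real (Im (chord_point 1 \<epsilon> \<phi>\<^sub>1 \<phi>\<^sub>2 w)), 1)"
    by (rule tangency[OF zones \<phi>(1,2) _ j(2) z(2)]) auto
  note rad = thin_chord(4)[OF zones \<phi>(1,2)]
  have ne: "chord_point (-1) \<epsilon> \<phi>\<^sub>1 \<phi>\<^sub>2 v \<noteq> chord_point 1 \<epsilon> \<phi>\<^sub>1 \<phi>\<^sub>2 w"
  proof
    assume "chord_point (-1) \<epsilon> \<phi>\<^sub>1 \<phi>\<^sub>2 v = chord_point 1 \<epsilon> \<phi>\<^sub>1 \<phi>\<^sub>2 w"
    hence "- sqrt (1 / (1 + \<epsilon> * v) - (cos ((\<phi>\<^sub>2 - \<phi>\<^sub>1) / 2))\<^sup>2) = sqrt (1 / (1 + \<epsilon> * w) - (cos ((\<phi>\<^sub>2 - \<phi>\<^sub>1) / 2))\<^sup>2)"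
      by (simp add: chord_point_def)
    moreover have "sqrt (1 / (1 + \<epsilon> * v) - (cos ((\<phi>\<^sub>2 - \<phi>\<^sub>1) / 2))\<^sup>2) > 0" "sqrt (1 / (1 + \<epsilon> * w) - (cos ((\<phi>\<^sub>2 - \<phi>\<^sub>1) / 2))\<^sup>2) > 0"
      using rad[OF v(1)] rad[OF w(1)] by simp_all
    ultimately show False by linarith
  qed
  have "real_bitangent ?n c ?l"
    unfolding real_bitangent_def
  proof (intro conjI exI)
    show "?l \<noteq> (0, 0, 0)" using sin_zero_abs_cos_one[of "(\<phi>\<^sub>1 + \<phi>\<^sub>2) / 2"] by auto
    show "proj_distinct (of_real (Re (chord_point (-1) \<epsilon> \<phi>\<^sub>1 \<phi>\<^sub>2 v)), of_real (Im (chord_point (-1) \<epsilon> \<phi>\<^sub>1 \<phi>\<^sub>2 v)), 1)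
       (of_real (Re (chord_point 1 \<epsilon> \<phi>\<^sub>1 \<phi>\<^sub>2 w)), of_real (Im (chord_point 1 \<epsilon> \<phi>\<^sub>1 \<phi>\<^sub>2 w)), 1)"
      using ne by (auto simp: proj_distinct_def complex_eq_iff)
  qed (use v w in auto)
  moreover note near_critical[OF box[OF pZ] _ j(1) z(1)] near_critical[OF box[OF pZ] _ j(2) z(2)]
  ultimately show ?thesis using that \<phi>(1,2) by (simp add: end_angle_def)
qed

text \<open>Injectivity of the index: the line determines both angles by
  \<open>chord_endpoints\<close>; their cosines are less than 1 in absolute value, so the angles
  determine the zones; the cosines themselves determine the windows by
  \<open>\<delta>_gap\<close>.\<close>

lemma many_bitangents:
  assumes fin: "finite (real_bitangents (2 * m) c)"
  shows "card {(l\<^sub>1, l\<^sub>2). 1 \<le> l\<^sub>1 \<and> l\<^sub>1 + 2 \<le> l\<^sub>2 \<and> l\<^sub>2 < 4 * m} * (N - 1)\<^sup>2 \<le> card (real_bitangents (2 * m) c)"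
proof -
  let ?n = "2 * m"
  have n: "?n > 0" using m by simp
  define P where "P = {(l\<^sub>1 :: nat, l\<^sub>2). 1 \<le> l\<^sub>1 \<and> l\<^sub>1 + 2 \<le> l\<^sub>2 \<and> l\<^sub>2 < 4 * m}"
  define I where "I = P \<times> ({..<N - 1} \<times> {..<N - 1})"
  define line where "line p = (cos ((fst p + snd p) / 2), sin ((fst p + snd p) / 2), - cos ((snd p - fst p) / 2))" for p :: "real \<times> real"
  define good where "good i p \<longleftrightarrow> fst p \<in> zone ?n (fst (fst i)) \<and> snd p \<in> zone ?n (snd (fst i)) \<and>
    \<bar>2 ^ e * ((-1) ^ fst (snd i) * peak N (fst (snd i))) - B * cos (real ?n * fst p)\<bar> \<le> \<delta> * (1 + B) \<and>
    \<bar>2 ^ e * ((-1) ^ snd (snd i) * peak N (snd (snd i))) - B * cos (real ?n * snd p)\<bar> \<le> \<delta> * (1 + B) \<and>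
    real_bitangent ?n c (line p)" for i :: "(nat \<times> nat) \<times> (nat \<times> nat)" and p
  define \<Phi> where "\<Phi> i = (SOME p. good i p)" for i
  have good: "good i (\<Phi> i)" if "i \<in> I" for i
  proof -
    obtain l1 l2 j1 j2 where i: "i = ((l1, l2), (j1, j2))" by (metis surj_pair)
    have "1 \<le> l1" "l1 + 2 \<le> l2" "l2 < 4 * m" "Suc j1 < N" "Suc j2 < N" using that by (auto simp: i I_def P_def)
    from index_bitangent[OF this] obtain x y where "good i (x, y)"
      unfolding good_def line_def i fst_conv snd_conv by metis
    thus ?thesis unfolding \<Phi>_def by (rule someI)
  qed
  define L where "L i = {t *\<^sub>R line (\<Phi> i) | t. t \<noteq> 0}" for i
  have "inj_on L I"
  proof (rule inj_onI)
    fix i i' assume ii: "i \<in> I" "i' \<in> I" "L i = L i'"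
    obtain l1 l2 j1 j2 where i: "i = ((l1, l2), (j1, j2))" by (metis surj_pair)
    obtain l1' l2' j1' j2' where i': "i' = ((l1', l2'), (j1', j2'))" by (metis surj_pair)
    obtain x y where xy: "\<Phi> i = (x, y)" by (cases "\<Phi> i")
    obtain x' y' where xy': "\<Phi> i' = (x', y')" by (cases "\<Phi> i'")
    have idx: "1 \<le> l1" "l1 + 2 \<le> l2" "l2 < 4 * m" "Suc j1 < N" "Suc j2 < N" using ii(1) by (auto simp: i I_def P_def)
    have idx': "1 \<le> l1'" "l1' + 2 \<le> l2'" "l2' < 4 * m" "Suc j1' < N" "Suc j2' < N" using ii(2) by (auto simp: i' I_def P_def)
    note g0 = good[OF ii(1), unfolded good_def xy, unfolded i fst_conv snd_conv]
    note g0' = good[OF ii(2), unfolded good_def xy', unfolded i' fst_conv snd_conv]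
    have g: "x \<in> zone ?n l1" "y \<in> zone ?n l2"
      "\<bar>2 ^ e * ((-1) ^ j1 * peak N j1) - B * cos (real ?n * x)\<bar> \<le> \<delta> * (1 + B)"
      "\<bar>2 ^ e * ((-1) ^ j2 * peak N j2) - B * cos (real ?n * y)\<bar> \<le> \<delta> * (1 + B)"
      by (simp_all only: g0)
    have g': "x' \<in> zone ?n l1'" "y' \<in> zone ?n l2'"
      "\<bar>2 ^ e * ((-1) ^ j1' * peak N j1') - B * cos (real ?n * x')\<bar> \<le> \<delta> * (1 + B)"
      "\<bar>2 ^ e * ((-1) ^ j2' * peak N j2') - B * cos (real ?n * y')\<bar> \<le> \<delta> * (1 + B)"
      by (simp_all only: g0')
    note xyb = thin_chord(1-3)[OF idx(1-3) g(1,2)] thin_chord(1-3)[OF idx'(1-3) g'(1,2)]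
    have "line (x', y') \<in> L i'" unfolding L_def xy' by (rule CollectI, rule exI[of _ 1]) simp
    hence "line (x', y') \<in> L i" using ii(3) by simp
    then obtain r where r: "line (x', y') = r *\<^sub>R line (x, y)" "r \<noteq> 0" unfolding L_def xy by blast
    have on: "\<theta> = x \<or> \<theta> = y"
      if "cos ((x' + y') / 2) * cos \<theta> + sin ((x' + y') / 2) * sin \<theta> = cos ((y' - x') / 2)" "0 < \<theta>" "\<theta> \<le> 2 * pi" for \<theta>
    proof (rule chord_endpoints)
      have "r * (cos ((x + y) / 2) * cos \<theta> + sin ((x + y) / 2) * sin \<theta>) = r * cos ((y - x) / 2)"
        using that(1) r(1) by (simp add: line_def algebra_simps)
      thus "cos ((x + y) / 2) * cos \<theta> + sin ((x + y) / 2) * sin \<theta> = cos ((y - x) / 2)" using r(2) by simp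
    qed (use that xyb in auto)
    have mid: "(x' + y') / 2 - x' = (y' - x') / 2" "y' - (x' + y') / 2 = (y' - x') / 2" by (simp_all add: field_simps)
    have "cos ((x' + y') / 2) * cos x' + sin ((x' + y') / 2) * sin x' = cos ((y' - x') / 2)"
      by (simp only: mid(1)[symmetric] cos_diff)
    hence "x' = x \<or> x' = y" by (rule on) (use xyb in auto)
    moreover have "cos ((x' + y') / 2) * cos y' + sin ((x' + y') / 2) * sin y' = cos ((y' - x') / 2)"
      by (simp only: mid(2)[symmetric] cos_diff mult.commute)
    hence "y' = x \<or> y' = y" by (rule on) (use xyb in auto)
    ultimately have "x' = x \<and> y' = y" using xyb by auto
    hence eq: "x' = x" "y' = y" by simp_all
    have inner: "\<bar>cos (real ?n * \<theta>)\<bar> < 1"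
      if "Suc j < N" "\<bar>2 ^ e * ((-1) ^ j * peak N j) - B * cos (real ?n * \<theta>)\<bar> \<le> \<delta> * (1 + B)" for j \<theta>
    proof -
      have "\<bar>2 ^ e * ((-1) ^ j * peak N j)\<bar> = 2 ^ e * peak N j" using peak_pos[OF that(1)] by (simp add: abs_mult power_abs)
      moreover have "\<bar>B * cos (real ?n * \<theta>)\<bar> = B * \<bar>cos (real ?n * \<theta>)\<bar>" using B_pos by (simp add: abs_mult)
      ultimately have "B * \<bar>cos (real ?n * \<theta>)\<bar> < B * 1"
        using that(2) B_large[OF that(1)] \<delta>(2) by linarith
      thus ?thesis using B_pos by (simp add: mult_less_cancel_left_pos)
    qed
    have jeq: "j = j'"
      if "Suc j < N" "Suc j' < N" "\<bar>2 ^ e * ((-1) ^ j * peak N j) - B * cos (real ?n * \<theta>)\<bar> \<le> \<delta> * (1 + B)"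
        "\<bar>2 ^ e * ((-1) ^ j' * peak N j') - B * cos (real ?n * \<theta>)\<bar> \<le> \<delta> * (1 + B)" for j j' \<theta>
    proof (rule ccontr)
      assume "j \<noteq> j'"
      from \<delta>_gap[OF that(1,2) this] that(3,4) show False by linarith
    qed
    note g'' = g'[unfolded eq]
    have "l1 = l1'" by (rule zone_unique[OF n g(1) g''(1) inner[OF idx(4) g(3)]])
    moreover have "l2 = l2'" by (rule zone_unique[OF n g(2) g''(2) inner[OF idx(5) g(4)]])
    moreover have "j1 = j1'" by (rule jeq[OF idx(4) idx'(4) g(3) g''(3)])
    moreover have "j2 = j2'" by (rule jeq[OF idx(5) idx'(5) g(4) g''(4)])
    ultimately show "i = i'" by (simp add: i i')
  qed
  moreover have "L ` I \<subseteq> real_bitangents ?n c"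
    using good unfolding L_def good_def real_bitangents_def by blast
  ultimately have "card I \<le> card (real_bitangents ?n c)" using fin by (rule card_inj_on_le)
  thus ?thesis by (simp add: I_def P_def card_cartesian_product power2_eq_square)
qed

end

section \<open>The main theorem\<close>

context ring_curve
begin

lemma N_pos: "N \<ge> 1" using N by (cases N) auto

lemma qr_split: "qr s = (\<Prod>i<N. s - (1 + \<epsilon> * real i)) * (s + 1) ^ e"
proof -
  have "qr s = (\<Prod>i<N. s - a i) * (\<Prod>i=N..<N + e. s - a i)"
    unfolding qr_def unfolding m_eq by (subst prod.union_disjoint[symmetric]) (auto intro!: prod.cong)
  also have "(\<Prod>i<N. s - a i) = (\<Prod>i<N. s - (1 + \<epsilon> * real i))" by (intro prod.cong) (simp_all add: a_eq)
  also have "(\<Prod>i=N..<N + e. s - a i) = (\<Prod>i=N..<N + e. s + 1)" by (intro prod.cong) (simp_all add: a_eq)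
  finally show ?thesis by simp
qed

lemma abs_qr: "\<bar>qr s\<bar> = (\<Prod>i<N. \<bar>s - (1 + \<epsilon> * real i)\<bar>) * \<bar>s + 1\<bar> ^ e"
  by (simp add: qr_split abs_mult abs_prod power_abs)

text \<open>Between 0 and 1 the absolute value of \<open>qr\<close> decreases, beyond the ring it
  increases, and on the ring it is at most \<open>3 (\<epsilon> N)^N\<close>, hence below
  \<open>A\<close>. So every point between two points of the set belongs to it. The 3 bounds
  \<open>s + 1\<close> on the ring.\<close>

lemma ring_connected:
  assumes B: "B > 3 * real N ^ N" and A1: "A < 1" and thin: "\<epsilon> * real N \<le> 1"
  shows "real_part_connected (2 * m) c"
proof (rule real_part_connectedI)
  have B0: "B > 0" using B by (intro le_less_trans[OF _ B]) auto
  show Apos: "A > 0" using B0 eps by (simp add: A_eq)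
  have q0: "qr 0 \<le> - 1"
  proof -
    have "qr 0 = (\<Prod>i<N. (-1) * (1 + \<epsilon> * real i))" by (simp add: qr_split)
    also have "\<dots> = - (\<Prod>i<N. 1 + \<epsilon> * real i)" using N by (simp only: prod.distrib prod_constant card_lessThan) simp
    finally have "qr 0 = - (\<Prod>i<N. 1 + \<epsilon> * real i)" .
    moreover have "(\<Prod>i<N. 1 + \<epsilon> * real i) \<ge> 1" using eps by (intro prod_ge_1) auto
    ultimately show ?thesis by simp
  qed
  thus "\<bar>qr 0\<bar> > A" using A1 by simp
  have q1: "qr 1 = 0" using N_pos by (auto simp: qr_split prod_zero_iff)
  have cont: "continuous_on S qr" for S unfolding qr_def[abs_def] by (intro continuous_intros)
  show "\<exists>s>0. qr s = - A"
  proof -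
    obtain s where s: "0 \<le> s" "qr s = - A" using IVT'[of qr 0 "- A" 1] q0 q1 A1 Apos cont by auto
    moreover have "s \<noteq> 0" using s q0 A1 by auto
    ultimately show ?thesis by (intro exI[of _ s]) simp
  qed
  show "\<exists>s>0. qr s = A"
  proof -
    have "1 \<le> (\<Prod>i<N. (2 + \<epsilon> * real N) - (1 + \<epsilon> * real i))"
    proof (rule prod_ge_1)
      fix i assume "i \<in> {..<N}"
      hence "\<epsilon> * real i \<le> \<epsilon> * real N" using eps by (intro mult_left_mono) auto
      thus "1 \<le> (2 + \<epsilon> * real N) - (1 + \<epsilon> * real i)" by simp
    qed
    moreover have "1 \<le> (2 + \<epsilon> * real N + 1) ^ e" using eps by (intro one_le_power) simp
    ultimately have "1 * 1 \<le> qr (2 + \<epsilon> * real N)" unfolding qr_split by (intro mult_mono) auto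
    moreover have "1 \<le> 2 + \<epsilon> * real N" using eps by simp
    ultimately obtain s where "1 \<le> s" "qr s = A" using IVT'[of qr 1 A "2 + \<epsilon> * real N"] q1 A1 Apos cont by auto
    thus ?thesis by (intro exI[of _ s]) simp
  qed
  show "is_interval {s. s > 0 \<and> \<bar>qr s\<bar> \<le> A}"
    unfolding is_interval_1
  proof (intro ballI allI impI)
    fix x y z assume x: "x \<in> {s. s > 0 \<and> \<bar>qr s\<bar> \<le> A}" and y: "y \<in> {s. s > 0 \<and> \<bar>qr s\<bar> \<le> A}" and xzy: "x \<le> z \<and> z \<le> y"
    hence z: "x \<le> z" "z \<le> y" by simp_all
    consider "z \<le> 1" | "1 \<le> z" "z \<le> 1 + \<epsilon> * real N" | "1 + \<epsilon> * real N \<le> z" by linarith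
    hence "\<bar>qr z\<bar> \<le> A"
    proof cases
      case 1
      have split: "{..<N} = insert 0 {1..<N}" using N_pos by auto
      have q: "\<bar>qr s\<bar> = ((1 - s) * (s + 1) ^ e) * (\<Prod>i=1..<N. 1 + \<epsilon> * real i - s)" if "0 < s" "s \<le> 1" for s
      proof -
        have "\<bar>s - (1 + \<epsilon> * real i)\<bar> = 1 + \<epsilon> * real i - s" for i
        proof -
          have "0 \<le> \<epsilon> * real i" using eps by simp
          thus ?thesis using that by linarith
        qed
        thus ?thesis unfolding abs_qr split using that by simp
      qed
      \<comment> \<open>For \<open>e = 1\<close> the growing factor is absorbed by
        \<open>(1 - s) (s + 1) = 1 - s^2\<close>, which decreases.\<close>
      have "(1 - z) * (z + 1) ^ e \<le> (1 - x) * (x + 1) ^ e"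
      proof (cases "e = 0")
        case False
        hence "e = 1" using e by simp
        moreover have "x * x \<le> z * z" using x z by (intro mult_mono) auto
        ultimately show ?thesis by (simp add: algebra_simps)
      qed (use z in simp)
      moreover have "(\<Prod>i=1..<N. 1 + \<epsilon> * real i - z) \<le> (\<Prod>i=1..<N. 1 + \<epsilon> * real i - x)"
        using z 1 eps by (intro prod_mono) (auto intro: order_trans[of _ 1])
      moreover have "0 \<le> (1 - x) * (x + 1) ^ e" using x z 1 by (intro mult_nonneg_nonneg) auto
      moreover have "0 \<le> (\<Prod>i=1..<N. 1 + \<epsilon> * real i - z)"
        using 1 eps by (intro prod_nonneg) (auto intro: order_trans[of _ 1])
      ultimately have "((1 - z) * (z + 1) ^ e) * (\<Prod>i=1..<N. 1 + \<epsilon> * real i - z) \<le>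
          ((1 - x) * (x + 1) ^ e) * (\<Prod>i=1..<N. 1 + \<epsilon> * real i - x)"
        by (rule mult_mono)
      hence "\<bar>qr z\<bar> \<le> \<bar>qr x\<bar>" using q[of z] q[of x] x z 1 by simp
      thus ?thesis using x by simp
    next
      case 2
      have "\<bar>qr z\<bar> \<le> (\<epsilon> * real N) ^ N * 3 ^ e"
        unfolding abs_qr
      proof (rule mult_mono)
        have "(\<Prod>i<N. \<bar>z - (1 + \<epsilon> * real i)\<bar>) \<le> (\<Prod>i<N. \<epsilon> * real N)"
        proof (rule prod_mono, intro conjI)
          fix i assume "i \<in> {..<N}"
          hence "0 \<le> \<epsilon> * real i" "\<epsilon> * real i \<le> \<epsilon> * real N" using eps by (auto intro: mult_left_mono)
          thus "\<bar>z - (1 + \<epsilon> * real i)\<bar> \<le> \<epsilon> * real N" using 2 by linarith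
        qed simp
        thus "(\<Prod>i<N. \<bar>z - (1 + \<epsilon> * real i)\<bar>) \<le> (\<epsilon> * real N) ^ N" by simp
        show "\<bar>z + 1\<bar> ^ e \<le> 3 ^ e" using 2 thin by (intro power_mono) auto
      qed (use eps in auto)
      also have "\<dots> \<le> (\<epsilon> * real N) ^ N * 3"
        using e eps by (intro mult_left_mono) (auto simp: le_Suc_eq)
      also have "\<dots> = \<epsilon> ^ N * (3 * real N ^ N)" by (simp add: power_mult_distrib)
      also have "\<dots> \<le> A" unfolding A_eq using B eps by (intro mult_left_mono) auto
      finally show ?thesis .
    next
      case 3
      have "\<bar>qr z\<bar> \<le> \<bar>qr y\<bar>"
        unfolding abs_qr
      proof (rule mult_mono)
        show "(\<Prod>i<N. \<bar>z - (1 + \<epsilon> * real i)\<bar>) \<le> (\<Prod>i<N. \<bar>y - (1 + \<epsilon> * real i)\<bar>)"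
        proof (rule prod_mono, intro conjI)
          fix i assume "i \<in> {..<N}"
          hence "\<epsilon> * real i \<le> \<epsilon> * real N" using eps by (auto intro: mult_left_mono)
          thus "\<bar>z - (1 + \<epsilon> * real i)\<bar> \<le> \<bar>y - (1 + \<epsilon> * real i)\<bar>" using 3 z by linarith
        qed simp
        show "\<bar>z + 1\<bar> ^ e \<le> \<bar>y + 1\<bar> ^ e" using x z by (intro power_mono) auto
      qed (auto intro: prod_nonneg)
      thus ?thesis using y by simp
    qed
    thus "z \<in> {s. s > 0 \<and> \<bar>qr s\<bar> \<le> A}" using x z by simp
  qed
qed

end

section \<open>Counting and choice of the constants\<close>

lemma card_separated_pairs:
  "2 * card {(k :: nat, l). 1 \<le> k \<and> k + 2 \<le> l \<and> l < M} = (M - 2) * (M - 3) \<and>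
   finite {(k :: nat, l). 1 \<le> k \<and> k + 2 \<le> l \<and> l < M}"
proof (induction M)
  case (Suc M)
  let ?S = "\<lambda>M. {(k :: nat, l). 1 \<le> k \<and> k + 2 \<le> l \<and> l < M}"
  have eq: "?S (Suc M) = ?S M \<union> (\<lambda>k. (k, M)) ` {1..M - 2}" by (auto simp: less_Suc_eq)
  have "card (?S (Suc M)) = card (?S M) + card ((\<lambda>k. (k, M)) ` {1..M - 2})"
    unfolding eq using Suc by (intro card_Un_disjoint) auto
  also have "card ((\<lambda>k. (k, M)) ` {1..M - 2}) = M - 2" by (subst card_image) (auto simp: inj_on_def)
  finally have "2 * card (?S (Suc M)) = (M - 2) * (M - 3) + 2 * (M - 2)" using Suc by simp
  also have "\<dots> = (Suc M - 2) * (Suc M - 3)"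
  proof (cases "M \<ge> 3")
    case True
    then obtain r where "M = r + 3" by (metis le_add_diff_inverse2)
    thus ?thesis by simp
  next
    case False
    hence "M = 0 \<or> M = 1 \<or> M = 2" by auto
    thus ?thesis by auto
  qed
  finally show ?case using Suc unfolding eq by auto
qed simp

text \<open>The count exceeds \<open>t_C\<close> by at most \<open>20 x^3 + 20 x^2\<close> and falls
  short of it by at most \<open>34 x^3 + 70 x\<close>. Both are at most \<open>104 x^3\<close>, and
  13 is \<open>104 / 8\<close>.\<close>

lemma bitangent_count_bounds:
  fixes m N n P :: nat
  assumes m: "m \<ge> 1" and N: "m \<le> N + 1" and P: "2 * P = (4 * m - 2) * (4 * m - 3)"
    and low: "P * (N - 1)\<^sup>2 \<le> n" and up: "2 * n \<le> 12 * m + (m + (4 * m ^ 3 + 6 * m ^ 2)) * (4 * m)"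
  shows "\<bar>real n - t_C (2 * m)\<bar> \<le> 13 * real (2 * m) ^ 3"
proof -
  define x where "x = real m"
  have x: "x \<ge> 1" using m by (simp add: x_def)
  have t: "t_C (2 * m) = 8 * x ^ 4 - 8 * x ^ 3 - 18 * x ^ 2 + 18 * x"
    by (simp add: t_C_def x_def field_simps power2_eq_square power3_eq_cube power4_eq_xxxx)
  have "real (2 * n) \<le> real (12 * m + (m + (4 * m ^ 3 + 6 * m ^ 2)) * (4 * m))" using up by (simp only: of_nat_le_iff)
  hence "2 * real n \<le> 12 * x + (x + (4 * x ^ 3 + 6 * x ^ 2)) * (4 * x)" by (simp add: x_def)
  hence u: "real n \<le> 8 * x ^ 4 + 12 * x ^ 3 + 2 * x ^ 2 + 6 * x"
    by (simp add: algebra_simps power2_eq_square power3_eq_cube power4_eq_xxxx)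
  have pw: "x \<le> x ^ 3" "x ^ 2 \<le> x ^ 3" "0 \<le> x ^ 2" "0 \<le> x"
    using x power_increasing[of 1 3 x] power_increasing[of 2 3 x] by simp_all
  have "real n - t_C (2 * m) \<le> 13 * (8 * x ^ 3)" unfolding t using u pw by linarith
  moreover have "t_C (2 * m) - real n \<le> 13 * (8 * x ^ 3)"
  proof (cases "m = 1")
    \<comment> \<open>Here \<open>t_C\<close> is 0; the comparison of squares in the other case
      needs \<open>x - 2\<close> to be nonnegative.\<close>
    case True
    thus ?thesis by (simp add: t_C_def x_def)
  next
    case False
    hence m2: "m \<ge> 2" using m by simp
    have "real (2 * P) = real ((4 * m - 2) * (4 * m - 3))" using P by (simp only:)
    hence P': "2 * real P = (4 * x - 2) * (4 * x - 3)" using m by (simp add: x_def of_nat_diff)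
    have "real (m - 2) \<le> real (N - 1)" using N by (simp only: of_nat_le_iff)
    hence Nx: "x - 2 \<le> real (N - 1)" "0 \<le> x - 2" using m2 by (simp_all add: x_def of_nat_diff)
    have "real P * (x - 2)\<^sup>2 \<le> real P * (real (N - 1))\<^sup>2" using Nx by (intro mult_left_mono power_mono) auto
    also have "\<dots> = real (P * (N - 1)\<^sup>2)" by simp
    also have "\<dots> \<le> real n" using low by (simp only: of_nat_le_iff)
    finally have "2 * real n \<ge> (2 * real P) * (x - 2)\<^sup>2" by simp
    hence "2 * real n \<ge> (4 * x - 2) * (4 * x - 3) * (x - 2)\<^sup>2" unfolding P' .
    hence "real n \<ge> 8 * x ^ 4 - 42 * x ^ 3 + 75 * x ^ 2 - 52 * x + 12"
      by (simp add: algebra_simps power2_eq_square power3_eq_cube power4_eq_xxxx)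
    thus ?thesis unfolding t using pw by linarith
  qed
  moreover have "real (2 * m) ^ 3 = 8 * x ^ 3" by (simp add: x_def)
  ultimately show ?thesis by linarith
qed

lemma exists_small_margin:
  assumes "odd N"
  obtains \<mu> where "\<mu> > 0" "\<mu> \<le> 1" "\<And>j. Suc j < N \<Longrightarrow> 2 * \<mu> \<le> 2 ^ e * peak N j"
    "\<And>j j'. Suc j < N \<Longrightarrow> Suc j' < N \<Longrightarrow> j \<noteq> j' \<Longrightarrow>
       2 * \<mu> \<le> \<bar>2 ^ e * ((-1) ^ j * peak N j) - 2 ^ e * ((-1) ^ j' * peak N j')\<bar>"
proof -
  define J where "J = {j. Suc j < N}"
  define D where "D p = \<bar>2 ^ e * ((-1) ^ fst p * peak N (fst p)) - 2 ^ e * ((-1) ^ snd p * peak N (snd p))\<bar> / 2" for p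
  \<comment> \<open>The element 1 bounds the margin and keeps the set nonempty for
    \<open>N = 1\<close>, where there are no windows.\<close>
  define X where "X = insert 1 ((\<lambda>j. 2 ^ e * peak N j / 2) ` J \<union> D ` {p \<in> J \<times> J. fst p \<noteq> snd p})"
  have "J \<subseteq> {..<N}" by (auto simp: J_def)
  hence "finite J" by (rule finite_subset) simp
  hence fin: "finite X" "X \<noteq> {}" by (auto simp: X_def)
  have "x > 0" if "x \<in> X" for x
  proof -
    have "D p > 0" if "p \<in> J \<times> J" "fst p \<noteq> snd p" for p
    proof -
      have "(-1) ^ fst p * peak N (fst p) \<noteq> (-1) ^ snd p * peak N (snd p)"
        using signed_peaks_distinct[OF assms, of "fst p" "snd p"] that by (auto simp: J_def)
      thus ?thesis by (simp add: D_def flip: right_diff_distrib)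
    qed
    moreover have "2 ^ e * peak N j / 2 > 0" if "j \<in> J" for j
      using peak_pos[of j N] that by (simp add: J_def)
    ultimately show ?thesis using that by (auto simp: X_def)
  qed
  hence "Min X > 0" using fin by simp
  moreover have "Min X \<le> 1" by (rule Min_le[OF fin(1)]) (simp add: X_def)
  moreover have "2 * Min X \<le> 2 ^ e * peak N j" if "Suc j < N" for j
  proof -
    have "Min X \<le> 2 ^ e * peak N j / 2" by (rule Min_le[OF fin(1)]) (use that in \<open>auto simp: X_def J_def\<close>)
    thus ?thesis by simp
  qed
  moreover have "2 * Min X \<le> \<bar>2 ^ e * ((-1) ^ j * peak N j) - 2 ^ e * ((-1) ^ j' * peak N j')\<bar>"
    if "Suc j < N" "Suc j' < N" "j \<noteq> j'" for j j'
  proof -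
    have "Min X \<le> D (j, j')" by (rule Min_le[OF fin(1)]) (use that in \<open>auto simp: X_def J_def\<close>)
    thus ?thesis by (simp add: D_def)
  qed
  ultimately show ?thesis by (rule that)
qed

text \<open>The order of the choices matters: the margin \<open>\<mu>\<close> depends only on
  \<open>N\<close> and \<open>e\<close>, then \<open>\<delta>\<close> is made to work for all
  \<open>B\<close> below \<open>S + 1\<close>, then \<open>\<epsilon>\<close> is chosen, and
  \<open>B\<close> comes last because the excluded values depend on
  \<open>\<epsilon>\<close>.\<close>

lemma exists_curve:
  assumes m: "m \<ge> 1"
  shows "\<exists>c. nonsingular_curve (2 * m) c \<and> real_part_connected (2 * m) c \<and>
     finite (real_bitangents (2 * m) c) \<and>
     \<bar>real (card (real_bitangents (2 * m) c)) - t_C (2 * m)\<bar> \<le> 13 * real (2 * m) ^ 3"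
proof -
  define e :: nat where "e = (if odd m then 0 else 1)"
  define N where "N = m - e"
  have N: "odd N" "m = N + e" "e \<le> 1" using m by (auto simp: N_def e_def)
  have mN: "m \<le> N + 1" using N(2,3) by linarith
  have N1: "N \<ge> 1" using N(1) by (cases N) auto
  \<comment> \<open>\<open>3 N^N\<close> is at least \<open>2^e\<close> times every peak and is the
    bound in \<open>ring_connected\<close>; the summand 1 is the one in
    \<open>B_large\<close>.\<close>
  define S where "S = 3 * real N ^ N + 1"
  have N1': "1 \<le> real N" using N1 by simp
  have "real N ^ 1 \<le> real N ^ N" using N1 N1' by (rule power_increasing)
  with N1' have S: "S > 1" "real N \<le> S" unfolding S_def power_one_right by linarith+
  obtain \<mu> where \<mu>: "\<mu> > 0" "\<mu> \<le> 1" "\<And>j. Suc j < N \<Longrightarrow> 2 * \<mu> \<le> 2 ^ e * peak N j"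
    "\<And>j j'. Suc j < N \<Longrightarrow> Suc j' < N \<Longrightarrow> j \<noteq> j' \<Longrightarrow>
       2 * \<mu> \<le> \<bar>2 ^ e * ((-1) ^ j * peak N j) - 2 ^ e * ((-1) ^ j' * peak N j')\<bar>"
    using exists_small_margin[OF N(1)] by metis
  \<comment> \<open>Since \<open>1 + B < 2 + S\<close>, the error \<open>\<delta> * (1 + B)\<close>
    stays below \<open>\<mu> / 2\<close>.\<close>
  define \<delta> where "\<delta> = \<mu> / (2 * (2 + S))"
  have \<delta>: "\<delta> > 0" using \<mu>(1) S by (simp add: \<delta>_def)
  obtain \<epsilon>\<^sub>0 where \<epsilon>0: "\<epsilon>\<^sub>0 > 0"
    "\<And>\<epsilon> w. 0 \<le> \<epsilon> \<Longrightarrow> \<epsilon> < \<epsilon>\<^sub>0 \<Longrightarrow> w \<in> {0..real N} \<Longrightarrow> \<bar>height N e \<epsilon> w - height N e 0 w\<bar> < \<delta>"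
    "\<And>\<epsilon> \<phi>\<^sub>1 \<phi>\<^sub>2 w \<sigma>. 0 \<le> \<epsilon> \<Longrightarrow> \<epsilon> < \<epsilon>\<^sub>0 \<Longrightarrow> w \<in> {0..real N} \<Longrightarrow> \<phi>\<^sub>1 \<in> {0..2 * pi} \<Longrightarrow> \<phi>\<^sub>2 \<in> {0..2 * pi} \<Longrightarrow>
       \<sigma> \<in> {1, -1} \<Longrightarrow> \<bar>Re (chord_point \<sigma> \<epsilon> \<phi>\<^sub>1 \<phi>\<^sub>2 w ^ (2 * m)) - Re (chord_point \<sigma> 0 \<phi>\<^sub>1 \<phi>\<^sub>2 w ^ (2 * m))\<bar> < \<delta>"
    using chord_limit[OF \<delta>, of N e "2 * m"] by metis
  have sin0: "sin (pi / real (4 * m)) > 0"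
    using m by (intro sin_gt_zero) (auto simp: field_simps)
  \<comment> \<open>The second bound yields \<open>thin\<close>, the third \<open>A < 1\<close> and
    \<open>\<epsilon> * real N \<le> 1\<close>.\<close>
  define \<epsilon> where "\<epsilon> = min (\<epsilon>\<^sub>0 / 2) (min ((sin (pi / real (4 * m)))\<^sup>2 / (2 * S)) (1 / (2 + S)))"
  have eps: "\<epsilon> > 0" "\<epsilon> < \<epsilon>\<^sub>0" "\<epsilon> \<le> (sin (pi / real (4 * m)))\<^sup>2 / (2 * S)" "\<epsilon> \<le> 1 / (2 + S)"
    using \<epsilon>0(1) sin0 S(1) by (auto simp: \<epsilon>_def)
  have epsS: "\<epsilon> * (2 + S) \<le> 1" using eps(4) S(1) by (simp add: field_simps)
  have eps1: "\<epsilon> \<le> 1"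
  proof -
    have "\<epsilon> * 1 \<le> \<epsilon> * (2 + S)" using eps(1) S(1) by (intro mult_left_mono) auto
    thus ?thesis using epsS by simp
  qed
  have epsN: "\<epsilon> * real N \<le> \<epsilon> * S" using eps(1) S(2) by (intro mult_left_mono) auto
  have thin: "\<epsilon> * real N < (sin (pi / real (4 * m)))\<^sup>2"
  proof -
    have "\<epsilon> * S \<le> (sin (pi / real (4 * m)))\<^sup>2 / 2" using eps(3) S(1) by (simp add: field_simps)
    moreover have "(sin (pi / real (4 * m)))\<^sup>2 > 0" using sin0 by simp
    ultimately show ?thesis using epsN by linarith
  qed
  define a where "a i = (if i < N then 1 + \<epsilon> * real i else -1)" for i
  define aa where "aa i = complex_of_real (a i)" for i
  have a_pos: "a i \<ge> 1" if "i < N" for i using that eps(1) by (simp add: a_def)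
  have a0: "a i \<noteq> 0" for i using a_pos[of i] by (cases "i < N") (auto simp: a_def)
  have inj: "inj_on aa {..<m}"
  proof (rule inj_onI)
    fix i j assume ij: "i \<in> {..<m}" "j \<in> {..<m}" "aa i = aa j"
    hence "a i = a j" by (simp add: aa_def)
    moreover have "i = N" if "i \<in> {..<m}" "\<not> i < N" for i using that N by auto
    moreover have "0 \<le> \<epsilon> * real i" "0 \<le> \<epsilon> * real j" using eps(1) by simp_all
    ultimately show "i = j" using ij(1,2) eps(1)
      by (cases "i < N"; cases "j < N") (auto simp: a_def)
  qed
  let ?q = "qpoly m aa"
  define Z where "Z = {s. poly (pderiv ?q) s = 0} \<union> {0}"
  define Bad where "Bad = {A. \<forall>s k. k\<^sup>2 = poly (kappa2 m aa A) s \<longrightarrow> line_disc m aa s k = 0}"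
  \<comment> \<open>The values of \<open>A\<close> to be avoided: identically vanishing
    discriminant, or a violation of \<open>regular_value\<close>.\<close>
  define F where "F = Bad \<union> (poly ?q ` Z \<union> (\<lambda>s. - poly ?q s) ` Z)"
  have "pderiv ?q \<noteq> 0" using m by (simp add: pderiv_eq_0_iff)
  hence "finite Z" by (simp add: Z_def poly_roots_finite)
  moreover have "finite Bad" unfolding Bad_def by (rule finite_bad_parameters[OF m inj]) (simp add: aa_def a0)
  ultimately have "finite F" by (simp add: F_def)
  moreover have "inj (\<lambda>B. complex_of_real (\<epsilon> ^ N * B))" using eps(1) by (auto intro!: injI)
  ultimately have "finite ((\<lambda>B. complex_of_real (\<epsilon> ^ N * B)) -` F)" by (rule finite_vimageI)
  moreover have "infinite {S<..<S + 1}" by simp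
  ultimately have "infinite ({S<..<S + 1} - (\<lambda>B. complex_of_real (\<epsilon> ^ N * B)) -` F)" by (rule Diff_infinite_finite)
  from infinite_imp_nonempty[OF this] obtain B
    where "B \<in> {S<..<S + 1} - (\<lambda>B. complex_of_real (\<epsilon> ^ N * B)) -` F" by blast
  hence B: "S < B" "B < S + 1" "complex_of_real (\<epsilon> ^ N * B) \<notin> F"
    by (simp_all only: Diff_iff vimage_eq greaterThanLessThan_iff simp_thms)
  define A where "A = \<epsilon> ^ N * B"
  have Apos: "A > 0" using B(1) S(1) eps(1) by (simp add: A_def)
  have A1: "A < 1"
  proof -
    have "\<epsilon> ^ N \<le> \<epsilon> ^ 1" using eps1 eps(1) N1 by (intro power_decreasing) auto
    hence "A \<le> \<epsilon> * B" unfolding A_def using B(1) S(1) by (intro mult_right_mono) auto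
    also have "\<dots> < \<epsilon> * (2 + S)" using eps(1) B(2) by (intro mult_strict_left_mono) auto
    finally show ?thesis using epsS by simp
  qed
  obtain c where c: "\<And>x y z. hp_eval (2 * m) c x y z = rosette m a A (x + \<i> * y) (x - \<i> * y) z"
    using rosette_is_form[of m a A] unfolding is_form_def by blast
  have AF: "complex_of_real A \<notin> F" using B(3) by (simp add: A_def)
  have reg: "poly ?q s \<noteq> of_real A \<and> poly ?q s \<noteq> - of_real A" if "poly (pderiv ?q) s = 0 \<or> s = 0" for s
  proof -
    have "s \<in> Z" using that by (auto simp: Z_def)
    hence "poly ?q s \<in> F" "- poly ?q s \<in> F" by (auto simp: F_def)
    thus ?thesis using AF by auto
  qed
  have \<delta>B: "\<delta> * (1 + B) < \<mu>"
  proof -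
    have "\<delta> * (1 + B) \<le> \<delta> * (2 + S)" using \<delta> B(2) by (intro mult_left_mono) auto
    also have "\<dots> = \<mu> / 2" using S(1) by (simp add: \<delta>_def field_simps)
    finally show ?thesis using \<mu>(1) by simp
  qed
  have peakB: "2 ^ e * peak N j + 1 \<le> B" if "Suc j < N" for j
  proof -
    have "2 ^ e * peak N j \<le> 3 * real N ^ N"
      using N(3) peak_bound[of j N] peak_pos[OF that] that by (intro mult_mono) (auto simp: le_Suc_eq)
    thus ?thesis using B(1) by (simp add: S_def)
  qed
  interpret thin_ring_curve m a A c N e \<epsilon> B \<delta>
  proof
    show "hp_eval (2 * m) c x y z = rosette m a A (x + \<i> * y) (x - \<i> * y) z" for x y z by (rule c)
    show "poly (qpoly m (\<lambda>i. of_real (a i))) s \<noteq> of_real A \<and> poly (qpoly m (\<lambda>i. of_real (a i))) s \<noteq> - of_real A"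
      if "poly (pderiv (qpoly m (\<lambda>i. of_real (a i)))) s = 0 \<or> s = 0" for s
      using reg that unfolding aa_def[abs_def] by blast
    show "2 * (\<delta> * (1 + B)) < 2 ^ e * peak N j" if "Suc j < N" for j
      using \<mu>(3)[OF that] \<delta>B by linarith
    show "2 * (\<delta> * (1 + B)) < \<bar>2 ^ e * ((-1) ^ j * peak N j) - 2 ^ e * ((-1) ^ j' * peak N j')\<bar>"
      if "Suc j < N" "Suc j' < N" "j \<noteq> j'" for j j'
      using \<mu>(4)[OF that] \<delta>B by linarith
    show "\<delta> * (1 + B) < 1" using \<delta>B \<mu>(2) by linarith
    show "B > 0" using B(1) S(1) by linarith
    show "\<bar>height N e \<epsilon> w - height N e 0 w\<bar> < \<delta>" if "w \<in> {0..real N}" for w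
      using \<epsilon>0(2)[of \<epsilon> w] eps that by simp
    show "\<bar>Re (chord_point \<sigma> \<epsilon> \<phi>\<^sub>1 \<phi>\<^sub>2 w ^ (2 * m)) - Re (chord_point \<sigma> 0 \<phi>\<^sub>1 \<phi>\<^sub>2 w ^ (2 * m))\<bar> < \<delta>"
      if "w \<in> {0..real N}" "\<phi>\<^sub>1 \<in> {0..2 * pi}" "\<phi>\<^sub>2 \<in> {0..2 * pi}" "\<sigma> \<in> {1, -1}" for w \<phi>\<^sub>1 \<phi>\<^sub>2 \<sigma>
      using \<epsilon>0(3)[of \<epsilon> w \<phi>\<^sub>1 \<phi>\<^sub>2 \<sigma>] eps that by simp
  qed (use m Apos a0 N eps \<delta> thin peakB in \<open>auto simp: a_def A_def\<close>)
  have "complex_of_real A \<notin> Bad" using AF by (simp add: F_def)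
  then obtain s k where sk: "k\<^sup>2 = poly (kappa2 m (\<lambda>i. of_real (a i)) (of_real A)) s"
    "line_disc m (\<lambda>i. of_real (a i)) s k \<noteq> 0" unfolding Bad_def aa_def[abs_def] by blast
  note upper = finite_real_bitangents[OF sk]
  have conn: "real_part_connected (2 * m) c"
    using ring_connected B(1) A1 epsN epsS eps(1) by (auto simp: S_def algebra_simps)
  from bitangent_count_bounds[OF m mN conjunct1[OF card_separated_pairs[of "4 * m"]] many_bitangents]
  show ?thesis using nonsingular conn upper by blast
qed

theorem theorem1p11:
  shows "\<exists>(C :: nat \<Rightarrow> nat \<Rightarrow> nat \<Rightarrow> real) (K :: real).
     \<forall>d. even d \<and> d \<ge> 2 \<longrightarrow>
        nonsingular_curve d (C d) \<and> real_part_connected d (C d) \<and>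
        finite (real_bitangents d (C d)) \<and>
        \<bar>real (card (real_bitangents d (C d))) - t_C d\<bar> \<le> K * real d ^ 3"
proof -
  have "\<forall>d. \<exists>c. even d \<and> d \<ge> 2 \<longrightarrow> nonsingular_curve d c \<and> real_part_connected d c \<and>
     finite (real_bitangents d c) \<and> \<bar>real (card (real_bitangents d c)) - t_C d\<bar> \<le> 13 * real d ^ 3"
  proof
    fix d
    show "\<exists>c. even d \<and> d \<ge> 2 \<longrightarrow> nonsingular_curve d c \<and> real_part_connected d c \<and>
     finite (real_bitangents d c) \<and> \<bar>real (card (real_bitangents d c)) - t_C d\<bar> \<le> 13 * real d ^ 3"
    proof (cases "even d \<and> d \<ge> 2")
      case True
      then obtain m where m: "d = 2 * m" "m \<ge> 1" by (auto elim!: evenE)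
      from exists_curve[OF m(2)] show ?thesis unfolding m(1) by auto
    qed auto
  qed
  from choice[OF this] show ?thesis by blast
qed

end
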